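(* Let $G=(V,E)\subset\Sigma$ be a graph in a pseudo-surface. Then: (1) if $e\in E$ is neither a quasi-loop nor a quasi-bridge of $G$, then $L_{G\subset\Sigma}(x,y,z)=L_{G\setminus e\subset\Sigma}(x,y,z)+L_{G/e\subset\Sigma/e}(x,y,z)$; (2) if $e\in E$ is a bridge of $G$, then $L_{G\subset\Sigma}(x,y,z)=x\,L_{G\setminus e\subset\Sigma}(x,y,z)$; (3) if $e\in E$ is a quasi-loop of $G$, then $L_{G\subset\Sigma}(x,y,z)=y\,L_{G\setminus e\subset\Sigma}(x,y,z)$; (4) if $e\in E$ is a quasi-bridge but not a bridge of $G$, then $L_{G\subset\Sigma}(x,y,z)=z\,L_{G\setminus e\subset\Sigma}(x,y,z)+L_{G/e\subset\Sigma/e}(x,y,z)$; (5) if $E=\emptyset$, then $L_{G\subset\Sigma}(x,y,z)=1$.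
   Context: A pseudo-surface is a surface possibly with pinch points. A graph in a pseudo-surface $G=(V,E)\subset\Sigma$ is a graph drawn on $\Sigma$ so that edges meet only at their ends and every pinch point is a vertex; its regions are the components of $\Sigma\setminus G$. For $A\subseteq E$, $c(A)$ is the number of components of the abstract spanning subgraph $(V,A)$, and $\rho(A)$ is the number of connected components of $\Sigma\setminus(V\cup A)$ (with $A$ the union of the points of its edges). The Las Vergnas polynomial of $G\subset\Sigma$ is $L_{G\subset\Sigma}(x,y,z)=\sum_{A\subseteq E}(x-1)^{c(A)-c(E)}(y-1)^{\rho(A)-\rho(\emptyset)}z^{|E|-|A|-\rho(E)+\rho(A)+c(E)-c(A)}$ (this is the Tutte polynomial of the matroid perspective from the bond matroid of the region-adjacency graph $G^\dagger$ to the cycle matroid of $G$). An edge $e$ is a quasi-loop if $\rho(\{e\})>\rho(\emptyset)$, a quasi-bridge if it is adjacent to exactly one region of $G\subset\Sigma$, and a bridge if its deletion increases the number of components of the abstract graph $G$. $G\setminus e\subset\Sigma$ is obtained by removing the edge $e$ from the drawing (surface and vertices unchanged). $G/e\subset\Sigma/e$ is obtained by identifying the closed edge $e$ to a single point of the quotient space $\Sigma/e$, this point becoming a vertex. *)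

theory Defs
  imports "HOL-Analysis.Analysis"
begin

section \<open>Pseudo-surfaces\<close>

text \<open>\<open>discs_at X k x\<close>: some open neighbourhood of \<open>x\<close> is a union of \<open>k\<close> open discs that pairwise
  meet exactly in \<open>x\<close>. (Finitely many relatively closed pieces determine the topology of the
  neighbourhood, so this is the wedge of \<open>k\<close> discs at \<open>x\<close>.) For \<open>k = 1\<close> the neighbourhood itself is
  an open disc. The open disc is modelled by the plane.\<close>

definition discs_at :: "'p topology \<Rightarrow> nat \<Rightarrow> 'p \<Rightarrow> bool" where
  "discs_at X k x \<longleftrightarrow>
     (\<exists>\<D>. finite \<D> \<and> card \<D> = k \<and>
          openin X (\<Union>\<D>) \<and> x \<in> \<Union>\<D> \<and>
          (\<forall>D\<in>\<D>. x \<in> D \<and> closedin (subtopology X (\<Union>\<D>)) D \<and>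
                 subtopology X D homeomorphic_space (euclidean :: complex topology)) \<and>
          (\<forall>D\<in>\<D>. \<forall>D'\<in>\<D>. D \<noteq> D' \<longrightarrow> D \<inter> D' = {x}))"

text \<open>Surfaces are closed (compact, without boundary) and need be neither connected nor orientable.\<close>

definition pseudo_surface :: "'p topology \<Rightarrow> bool" where
  "pseudo_surface X \<longleftrightarrow>
     compact_space X \<and> Hausdorff_space X \<and> (\<forall>x\<in>topspace X. \<exists>k\<ge>1. discs_at X k x)"

definition pinch_points :: "'p topology \<Rightarrow> 'p set" where
  "pinch_points X = {x \<in> topspace X. \<exists>k\<ge>2. discs_at X k x}"

section \<open>Graphs in pseudo-surfaces\<close>

text \<open>A drawn multigraph: the edges are labels, and \<open>curve G e\<close>, restricted to \<open>{0..1}\<close>, is the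
  curve that draws \<open>e\<close>.\<close>

record ('p, 'e) drawing =
  space_of :: "'p topology"
  vertices :: "'p set"
  edges :: "'e set"
  curve :: "'e \<Rightarrow> real \<Rightarrow> 'p"

definition edge_points :: "('p, 'e) drawing \<Rightarrow> 'e \<Rightarrow> 'p set" where
  "edge_points G e = curve G e ` {0..1}"

text \<open>An edge is a simple arc, or a simple closed curve in the case of a loop.\<close>

definition graph_in_pseudo_surface :: "('p, 'e) drawing \<Rightarrow> bool" where
  "graph_in_pseudo_surface G \<longleftrightarrow>
     pseudo_surface (space_of G) \<and>
     finite (vertices G) \<and> finite (edges G) \<and>
     vertices G \<subseteq> topspace (space_of G) \<and>
     pinch_points (space_of G) \<subseteq> vertices G \<and>
     (\<forall>e\<in>edges G.
        pathin (space_of G) (curve G e) \<and>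
        (\<forall>s\<in>{0..1}. \<forall>t\<in>{0..1}. curve G e s = curve G e t \<longrightarrow> s = t \<or> {s, t} = {0, 1}) \<and>
        (\<forall>t\<in>{0..1}. curve G e t \<in> vertices G \<longleftrightarrow> t = 0 \<or> t = 1)) \<and>
     (\<forall>e\<in>edges G. \<forall>f\<in>edges G. e \<noteq> f \<longrightarrow> edge_points G e \<inter> edge_points G f \<subseteq> vertices G)"

definition joined :: "('p, 'e) drawing \<Rightarrow> 'e set \<Rightarrow> ('p \<times> 'p) set" where
  "joined G A = {(curve G e 0, curve G e 1) | e. e \<in> A}"

text \<open>The number \<open>c(A)\<close> of components of the abstract spanning subgraph \<open>(V, A)\<close>.\<close>

definition num_components :: "('p, 'e) drawing \<Rightarrow> 'e set \<Rightarrow> nat" where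
  "num_components G A = card (vertices G // (joined G A \<union> (joined G A)\<inverse>)\<^sup>*)"

definition complement_components :: "('p, 'e) drawing \<Rightarrow> 'e set \<Rightarrow> 'p set set" where
  "complement_components G A =
     connected_components_of
       (subtopology (space_of G)
          (topspace (space_of G) - (vertices G \<union> (\<Union>e\<in>A. edge_points G e))))"

abbreviation regions :: "('p, 'e) drawing \<Rightarrow> 'p set set" where
  "regions G \<equiv> complement_components G (edges G)"

text \<open>The number \<open>\<rho>(A)\<close>.\<close>

definition num_regions :: "('p, 'e) drawing \<Rightarrow> 'e set \<Rightarrow> nat" where
  "num_regions G A = card (complement_components G A)"

definition quasi_loop :: "('p, 'e) drawing \<Rightarrow> 'e \<Rightarrow> bool" where
  "quasi_loop G e \<longleftrightarrow> num_regions G {e} > num_regions G {}"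

text \<open>An edge is adjacent to the regions on whose boundary it lies. Regions are disjoint from
  edges, so it suffices to ask for the closure.\<close>

definition adjacent_region :: "('p, 'e) drawing \<Rightarrow> 'e \<Rightarrow> 'p set \<Rightarrow> bool" where
  "adjacent_region G e R \<longleftrightarrow> R \<in> regions G \<and> edge_points G e \<subseteq> space_of G closure_of R"

definition quasi_bridge :: "('p, 'e) drawing \<Rightarrow> 'e \<Rightarrow> bool" where
  "quasi_bridge G e \<longleftrightarrow> (\<exists>!R. adjacent_region G e R)"

definition bridge :: "('p, 'e) drawing \<Rightarrow> 'e \<Rightarrow> bool" where
  "bridge G e \<longleftrightarrow> num_components G (edges G - {e}) > num_components G (edges G)"

section \<open>Deletion and contraction\<close>

definition delete_edge :: "('p, 'e) drawing \<Rightarrow> 'e \<Rightarrow> ('p, 'e) drawing" where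
  "delete_edge G e = G\<lparr>edges := edges G - {e}\<rparr>"

text \<open>The points of \<open>X/S\<close> are the classes of the relation that identifies \<open>S\<close> to a single point.\<close>

definition collapse :: "'p set \<Rightarrow> 'p \<Rightarrow> 'p set" where
  "collapse S x = (if x \<in> S then S else {x})"

definition collapse_space :: "'p topology \<Rightarrow> 'p set \<Rightarrow> 'p set topology" where
  "collapse_space X S =
     topology (\<lambda>U. U \<subseteq> collapse S ` topspace X \<and> openin X {x \<in> topspace X. collapse S x \<in> U})"

lemma openin_collapse_space:
  "openin (collapse_space X S) U \<longleftrightarrow>
     U \<subseteq> collapse S ` topspace X \<and> openin X {x \<in> topspace X. collapse S x \<in> U}"
proof -
  let ?q = "collapse S"
  have *: "istopology (\<lambda>U. U \<subseteq> ?q ` topspace X \<and> openin X {x \<in> topspace X. ?q x \<in> U})"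
    unfolding istopology_def
  proof (intro conjI allI impI, goal_cases)
    case (1 U V)
    then show ?case by auto
  next
    case (2 U V)
    have "{x \<in> topspace X. ?q x \<in> U \<inter> V} =
        {x \<in> topspace X. ?q x \<in> U} \<inter> {x \<in> topspace X. ?q x \<in> V}" by auto
    with 2 show ?case by (simp add: openin_Int)
  next
    case (3 K)
    then show ?case by auto
  next
    case (4 K)
    have "{x \<in> topspace X. ?q x \<in> \<Union>K} = (\<Union>U\<in>K. {x \<in> topspace X. ?q x \<in> U})" by auto
    with 4 show ?case by (auto intro: openin_Union)
  qed
  show ?thesis
    unfolding collapse_space_def topology_inverse'[OF *] by simp
qed

lemma topspace_collapse_space: "topspace (collapse_space X S) = collapse S ` topspace X"
proof
  show "topspace (collapse_space X S) \<subseteq> collapse S ` topspace X"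
    using openin_collapse_space[of X S "topspace (collapse_space X S)"] by simp
  have "{x \<in> topspace X. collapse S x \<in> collapse S ` topspace X} = topspace X" by auto
  then have "openin (collapse_space X S) (collapse S ` topspace X)"
    by (simp add: openin_collapse_space)
  then show "collapse S ` topspace X \<subseteq> topspace (collapse_space X S)"
    by (rule openin_subset)
qed

lemma quotient_map_collapse: "quotient_map X (collapse_space X S) (collapse S)"
  by (auto simp: quotient_map_def topspace_collapse_space openin_collapse_space)

text \<open>The point to which \<open>e\<close> is collapsed is a vertex, being the image of the ends of \<open>e\<close>.\<close>

definition contract_edge :: "('p, 'e) drawing \<Rightarrow> 'e \<Rightarrow> ('p set, 'e) drawing" where
  "contract_edge G e =
     (let q = collapse (edge_points G e) in
      \<lparr>space_of = collapse_space (space_of G) (edge_points G e),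
       vertices = q ` vertices G,
       edges = edges G - {e},
       curve = (\<lambda>f. q \<circ> curve G f)\<rparr>)"

section \<open>The Las Vergnas polynomial\<close>

text \<open>The value at \<open>(x, y, z)\<close> over an arbitrary field. Identities valid over all fields, such as
  the field of rational functions in \<open>x\<close>, \<open>y\<close>, \<open>z\<close>, are identities of polynomials. Integer powers
  avoid truncated subtraction in the exponents; note \<open>0 powi 0 = 1\<close>.\<close>

definition las_vergnas :: "('p, 'e) drawing \<Rightarrow> 'k::field \<Rightarrow> 'k \<Rightarrow> 'k \<Rightarrow> 'k" where
  "las_vergnas G x y z =
     (let E = edges G; c = (\<lambda>A. int (num_components G A)); \<rho> = (\<lambda>A. int (num_regions G A)) in
      \<Sum>A\<in>Pow E. (x - 1) powi (c A - c E) * (y - 1) powi (\<rho> A - \<rho> {}) *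
        z powi (int (card E) - int (card A) - \<rho> E + \<rho> A + c E - c A))"

end

theory Submission
  imports Defs "HOL-Complex_Analysis.Contour_Integration"
begin

text \<open>
  Adding an edge \<open>e\<close> to \<open>A\<close> raises \<open>\<rho>\<close> by the number of components adjacent to \<open>e\<close> minus one.
  Locally an edge has two sides (Janiszewski's theorem), and which components lie on them does not
  change along the edge, so that number is \<open>1\<close> or \<open>2\<close>. It can only decrease when edges are removed
  from \<open>A\<close>, which gives the claims about quasi-loops and quasi-bridges.

  If \<open>e\<close> joins two components of \<open>(V, A)\<close>, then both its sides belong to the same region: if \<open>R\<close> were
  a region on only one side, then the edges with \<open>R\<close> on exactly one side would meet every vertex in
  an even number of edge ends, but \<open>e\<close> has exactly one end in the component of \<open>(V, A)\<close> at its start.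
  The evenness at a vertex is a planar fact, proved with square roots of \<open>z / (z - p)\<close> that
  change sign across an arc from \<open>0\<close> to \<open>p\<close>.

  Contraction removes the closed edge from the surface, so \<open>\<rho>(A)\<close> and \<open>c(A)\<close> in \<open>G/e\<close> are
  \<open>\<rho>(A \<union> {e})\<close> and \<open>c(A \<union> {e})\<close> in \<open>G\<close>, and the identities hold term by term in
  the sum over the sets \<open>A\<close> not containing \<open>e\<close>.
\<close>

section \<open>Arcs in the plane\<close>

text \<open>Edges are merely continuous arcs: the edge ends at a vertex come with no cyclic order,
  and a small circle around the vertex may meet an arc infinitely often, so colour changes along the
  circle cannot be counted. Square roots replace the circle. Off an arc from 0 to p the function z /
  (z - p) has a continuous root; it cannot extend across the arc, since it would become a root of z
  times a unit around 0. The function that is 1 on one region and -1 on the others flips exactly at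
  the boundary arcs; multiplied by their roots it flips nowhere, and its square vanishes at 0 to the
  order given by the number of these arcs, which must be even. A flip is expressed by the absence of
  a limit, the condition that continuous extension asks about. At a pinch point each disc of the
  wedge is treated separately. The algebra has an obstacle of its own:
  \<open>w powi (n + 1) = w * w powi n\<close> fails for w = 0 and n = -1, so the exponents must be
  shown nonnegative; this rests on the fact that no edge both joins two components and adds a
  region.\<close>

lemma first_time_on_sphere:
  fixes g :: "real \<Rightarrow> complex"
  assumes cont: "continuous_on {a..b} g" and "a < b" and r: "0 < r"
    and far: "dist (g a) (g b) > r"
  obtains s where "a < s" "s < b" "dist (g a) (g s) = r" "\<And>u. a \<le> u \<Longrightarrow> u < s \<Longrightarrow> dist (g a) (g u) < r"
proof -
  let ?T = "{u \<in> {a..b}. dist (g a) (g u) = r}"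
  have contd: "continuous_on {a..b} (\<lambda>u. dist (g a) (g u))"
    by (intro continuous_intros cont)
  have "\<exists>u\<ge>a. u \<le> b \<and> dist (g a) (g u) = r"
    by (rule IVT') (use assms contd in auto)
  then have ne: "?T \<noteq> {}" by auto
  have "closed ?T"
    using continuous_closed_preimage[OF contd, of "{r}"] by (simp add: vimage_def Int_def conj_commute)
  moreover have "bounded ?T" by (rule bounded_subset[of "{a..b}"]) auto
  \<comment> \<open>Compactness gives a first visit to the sphere; an earlier exit from the ball
    would force a still earlier visit.\<close>
  ultimately have "compact ?T" by (simp add: compact_eq_bounded_closed)
  from compact_attains_inf[OF this ne]
  obtain s where s: "s \<in> ?T" "\<And>u. u \<in> ?T \<Longrightarrow> s \<le> u"
    by blast
  show thesis
  proof
    have "s \<noteq> a" "s \<noteq> b" using s(1) r far by auto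
    then show "a < s" "s < b" using s(1) by auto
    show "dist (g a) (g s) = r" using s by auto
    fix u assume u: "a \<le> u" "u < s"
    show "dist (g a) (g u) < r"
    proof (rule ccontr)
      assume "\<not> dist (g a) (g u) < r"
      moreover have "continuous_on {a..u} (\<lambda>u. dist (g a) (g u))"
        by (rule continuous_on_subset[OF contd]) (use u s in auto)
      ultimately have "\<exists>v\<ge>a. v \<le> u \<and> dist (g a) (g v) = r"
        by (intro IVT') (use u r in auto)
      then show False using s u by force
    qed
  qed
qed

text \<open>The two sides are the two halves into which the piece of the arc inside a small disc cuts that
  disc. The arc may re-enter the disc; by Janiszewski's theorem this does not separate
  points of the same half that are close to \<open>g t\<close>.\<close>

lemma arc_two_sides:
  fixes g :: "real \<Rightarrow> complex"
  assumes "arc g" and t: "0 < t" "t < 1" and "open U" "g t \<in> U"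
  obtains W P Q where "open W" "g t \<in> W" "W \<subseteq> U" "W - path_image g = P \<union> Q"
    "\<And>x y. x \<in> P \<Longrightarrow> y \<in> P \<Longrightarrow> connected_component (U - path_image g) x y"
    "\<And>x y. x \<in> Q \<Longrightarrow> y \<in> Q \<Longrightarrow> connected_component (U - path_image g) x y"
    "W \<inter> path_image g \<subseteq> closure P" "W \<inter> path_image g \<subseteq> closure Q"
proof -
  have contg: "continuous_on {0..1} g" and inj: "inj_on g {0..1}"
    using \<open>arc g\<close> by (auto simp: arc_def path_def)
  have "open (U - {g 0, g 1})" using \<open>open U\<close> by (intro open_Diff) auto
  moreover have "g t \<in> U - {g 0, g 1}"
    using assms inj_onD[OF inj, of t 0] inj_onD[OF inj, of t 1] by auto
  \<comment> \<open>Both ends of the arc lie outside the closed disc, so the arc leaves it before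
    and after time \<open>t\<close>.\<close>
  ultimately obtain r where r: "0 < r" "cball (g t) r \<subseteq> U - {g 0, g 1}"
    using open_contains_cball by meson
  have far: "dist (g t) (g 0) > r" "dist (g t) (g 1) > r"
    using r by (auto simp: subset_eq)
  obtain t2 where t2: "t < t2" "t2 < 1" "dist (g t) (g t2) = r"
    "\<And>u. t \<le> u \<Longrightarrow> u < t2 \<Longrightarrow> dist (g t) (g u) < r"
    using first_time_on_sphere[of t 1 g r] t far r continuous_on_subset[OF contg, of "{t..1}"] by auto
  \<comment> \<open>The last visit to the circle before \<open>t\<close> is the first visit of the
    reversed arc after \<open>1 - t\<close>.\<close>
  have "continuous_on {1-t..1} (reversepath g)"
    unfolding reversepath_def
    by (rule continuous_on_compose2[OF contg]) (use t in \<open>auto intro!: continuous_intros\<close>)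
  then obtain t1' where t1': "1 - t < t1'" "t1' < 1" "dist (g t) (g (1 - t1')) = r"
    "\<And>u. 1 - t \<le> u \<Longrightarrow> u < t1' \<Longrightarrow> dist (g t) (g (1 - u)) < r"
    using first_time_on_sphere[of "1-t" 1 "reversepath g" r] t far r
    by (auto simp: reversepath_def)
  define t1 where "t1 = 1 - t1'"
  have t1: "t1 < t" "0 < t1" "dist (g t) (g t1) = r"
    "\<And>u. t1 < u \<Longrightarrow> u \<le> t \<Longrightarrow> dist (g t) (g u) < r"
    using t1' t1'(4)[of "1 - u" for u] by (auto simp: t1_def)
  have in_ball: "dist (g t) (g u) < r" if "t1 < u" "u < t2" for u
    using t1(4)[of u] t2(4)[of u] that by (cases "u \<le> t") auto
  \<comment> \<open>\<open>c\<close> is a crosscut of the disc: it meets the circle only in its ends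
    \<open>a\<close> and \<open>b\<close>.\<close>
  define a b c where "a = g t1" and "b = g t2" and "c = subpath t1 t2 g"
  have ab: "a \<noteq> b" using inj_onD[OF inj, of t1 t2] t1 t2 t by (auto simp: a_def b_def)
  have "arc c" unfolding c_def by (rule arc_subpath_arc) (use assms t1 t2 t ab in \<open>auto simp: a_def b_def\<close>)
  have pic: "path_image c = g ` {t1..t2}" using t1 t2 by (simp add: c_def path_image_subpath)
  have endc: "pathstart c = a" "pathfinish c = b" by (auto simp: c_def a_def b_def)
  have ab_sph: "a \<in> sphere (g t) r" "b \<in> sphere (g t) r" using t1 t2 by (auto simp: a_def b_def)
  have c_ab: "path_image c - {a, b} = g ` {t1<..<t2}"
  proof -
    have "{t1..t2} = {t1<..<t2} \<union> {t1,t2}" using t1 t2 by auto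
    then have "path_image c = g ` {t1<..<t2} \<union> {a,b}" by (simp add: pic a_def b_def image_Un)
    moreover have "a \<notin> g ` {t1<..<t2}" "b \<notin> g ` {t1<..<t2}"
      using in_ball ab_sph by force+
    ultimately show ?thesis by blast
  qed
  have c_ball: "path_image c - {a, b} \<subseteq> ball (g t) r" using in_ball c_ab by auto
  have c_sph: "path_image c \<inter> sphere (g t) r = {a, b}"
  proof -
    have "ball (g t) r \<inter> sphere (g t) r = {}" by auto
    moreover have "a \<in> path_image c" "b \<in> path_image c"
      using pathstart_in_path_image[of c] pathfinish_in_path_image[of c] endc by auto
    ultimately show ?thesis using c_ball ab_sph by blast
  qed
  \<comment> \<open>The circle splits at \<open>a\<close> and \<open>b\<close>; its two halves and
    \<open>c\<close> form a theta curve, whose three arcs are made to run from \<open>a\<close> to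
    \<open>b\<close>.\<close>
  obtain u d where ud: "arc u" "arc d" "pathstart u = a" "pathfinish u = b"
    "pathstart d = b" "pathfinish d = a" "path_image u \<inter> path_image d = {a, b}"
    "path_image u \<union> path_image d = sphere (g t) r"
    using exists_double_arc[of "circlepath (g t) r" a b] ab ab_sph r
    by (auto simp: simple_path_circlepath)
  define d' where "d' = reversepath d"
  have d': "arc d'" "pathstart d' = a" "pathfinish d' = b" "path_image d' = path_image d"
    using ud by (auto simp: d'_def arc_reversepath)
  have ins: "inside (path_image u \<union> path_image d') = ball (g t) r"
    using inside_frontier_eq_interior[of "cball (g t) r"] by (simp add: d' ud)
  have uc: "path_image u \<inter> path_image c = {a,b}" and dc: "path_image d' \<inter> path_image c = {a,b}"
    using c_sph ud d' by auto
  define P0 Q0 where "P0 = inside (path_image u \<union> path_image c)"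
    and "Q0 = inside (path_image d' \<union> path_image c)"
  have gt: "g t \<in> path_image c - {a,b}" using c_ab t1 t2 by auto
  have halves: "P0 \<inter> Q0 = {}" "P0 \<union> Q0 \<union> (path_image c - {a,b}) = ball (g t) r"
  proof -
    have ne: "path_image c \<inter> inside (path_image u \<union> path_image d') \<noteq> {}"
      using gt r unfolding ins by auto
    show "P0 \<inter> Q0 = {}" "P0 \<union> Q0 \<union> (path_image c - {a,b}) = ball (g t) r"
      unfolding P0_def Q0_def ins[symmetric]
      by (rule split_inside_simple_closed_curve[OF arc_imp_simple_path[OF ud(1)] ud(3,4)
          arc_imp_simple_path[OF d'(1)] d'(2,3) arc_imp_simple_path[OF \<open>arc c\<close>] endc ab _ uc dc ne];
        use ud d' in simp)+
  qed
  \<comment> \<open>By the Jordan curve theorem each half of the disc has its whole bounding curve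
    as frontier, so the points of \<open>c\<close> are limits of both halves.\<close>
  have J: "connected (inside (path_image v \<union> path_image c)) \<and>
      frontier (inside (path_image v \<union> path_image c)) = path_image v \<union> path_image c"
    if "arc v" "pathstart v = a" "pathfinish v = b" "path_image v \<inter> path_image c = {a,b}" for v
  proof -
    have "simple_path (v +++ reversepath c)"
      using that endc \<open>arc c\<close> ab by (subst simple_path_join_loop_eq) (auto simp: arc_reversepath)
    moreover have "path_image (v +++ reversepath c) = path_image v \<union> path_image c"
      using that endc by (simp add: path_image_join)
    moreover have "pathfinish (v +++ reversepath c) = pathstart (v +++ reversepath c)"
      using that endc by simp
    ultimately show ?thesis using Jordan_inside_outside[of "v +++ reversepath c"] by simp
  qed
  have P0: "connected P0" "frontier P0 = path_image u \<union> path_image c"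
    using J[of u] ud uc by (auto simp: P0_def)
  have Q0: "connected Q0" "frontier Q0 = path_image d' \<union> path_image c"
    using J[of d'] d' dc by (auto simp: Q0_def)
  have disj: "P0 \<inter> (sphere (g t) r \<union> path_image c) = {}" "Q0 \<inter> (sphere (g t) r \<union> path_image c) = {}"
    using halves inside_no_overlap[of "path_image u \<union> path_image c"]
      inside_no_overlap[of "path_image d' \<union> path_image c"]
    by (auto simp: P0_def[symmetric] Q0_def[symmetric] set_eq_iff)
  \<comment> \<open>The circle is put into both compact sets so that they meet exactly in it:
    Janiszewski's theorem needs a connected intersection, while \<open>c\<close> and the rest of the
    arc alone would meet in the two points \<open>a\<close> and \<open>b\<close>.\<close>
  define T where "T = sphere (g t) r \<union> g ` ({0..t1} \<union> {t2..1})"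
  have "compact (g ` ({0..t1} \<union> {t2..1}))"
    by (intro compact_continuous_image continuous_on_subset[OF contg] compact_Un) (use t1 t2 t in auto)
  then have "closed T" unfolding T_def by (intro closed_Un compact_imp_closed) auto
  have "g t \<notin> T"
  proof
    assume "g t \<in> T"
    then have "g t \<in> g ` ({0..t1} \<union> {t2..1})" using r by (simp add: T_def)
    then obtain s where "s \<in> {0..t1} \<union> {t2..1}" "g t = g s" by blast
    then show False using inj_onD[OF inj, of t s] t t1(1,2) t2(1,2) by auto
  qed
  then obtain e where e: "0 < e" "ball (g t) e \<subseteq> - T"
    using \<open>closed T\<close> open_contains_ball[of "- T"] by (metis ComplI open_Compl)
  define W where "W = ball (g t) e \<inter> ball (g t) r"
  have "connected W" unfolding W_def by (intro convex_connected convex_Int) auto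
  have WT: "W \<inter> T = {}" using e by (auto simp: W_def)
  have Un: "sphere (g t) r \<union> path_image c \<union> T = sphere (g t) r \<union> path_image g"
  proof -
    have "{0..1} = {t1..t2} \<union> ({0..t1} \<union> {t2..1})" using t1 t2 t by auto
    then show ?thesis unfolding pic T_def path_image_def[of g] by (simp only: image_Un) blast
  qed
  have "g ` {t1..t2} \<inter> g ` ({0..t1} \<union> {t2..1}) \<subseteq> g ` {t1,t2}"
  proof
    fix x assume "x \<in> g ` {t1..t2} \<inter> g ` ({0..t1} \<union> {t2..1})"
    then obtain p q where pq: "p \<in> {t1..t2}" "q \<in> {0..t1} \<union> {t2..1}" "x = g p" "g p = g q"
      by (elim IntE imageE) metis
    then have "p = q" using inj_onD[OF inj, of p q] t1 t2 t by auto
    with pq have "p = t1 \<or> p = t2" by auto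
    with pq show "x \<in> g ` {t1,t2}" by blast
  qed
  then have meet: "(sphere (g t) r \<union> path_image c) \<inter> T = sphere (g t) r"
    using ab_sph unfolding pic T_def a_def b_def by auto
  \<comment> \<open>\<open>H\<close> stands for either half: it joins \<open>x\<close> and
    \<open>y\<close> off the circle and \<open>c\<close>, while \<open>W\<close> joins them off
    \<open>T\<close>.\<close>
  have comp: "connected_component (U - path_image g) x y"
    if "connected H" "H \<inter> (sphere (g t) r \<union> path_image c) = {}" "x \<in> W \<inter> H" "y \<in> W \<inter> H" for H x y
  proof -
    have "connected_component (- (sphere (g t) r \<union> path_image c \<union> T)) x y"
    proof (rule Janiszewski)
      show "compact (sphere (g t) r \<union> path_image c)"
        using \<open>arc c\<close> by (simp add: compact_Un compact_arc_image)
      show "connected ((sphere (g t) r \<union> path_image c) \<inter> T)"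
        unfolding meet by (simp add: connected_sphere)
      show "connected_component (- (sphere (g t) r \<union> path_image c)) x y"
        unfolding connected_component_def using that by (intro exI[of _ H]) auto
      show "connected_component (- T) x y"
        unfolding connected_component_def using that \<open>connected W\<close> WT by (intro exI[of _ W]) auto
    qed fact
    then obtain C where C: "connected C" "C \<subseteq> - (sphere (g t) r \<union> path_image g)" "x \<in> C" "y \<in> C"
      unfolding Un connected_component_def by auto
    have "C \<subseteq> ball (g t) r"
    proof (rule ccontr)
      assume "\<not> C \<subseteq> ball (g t) r"
      moreover have "x \<in> C \<inter> ball (g t) r" using that C by (auto simp: W_def)
      ultimately have "C \<inter> frontier (ball (g t) r) \<noteq> {}"
        by (intro connected_Int_frontier C) blast+
      then show False using C r by auto
    qed
    moreover have "ball (g t) r \<subseteq> U" using r(2) ball_subset_cball[of "g t" r] by blast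
    ultimately show ?thesis unfolding connected_component_def using C by (intro exI[of _ C]) auto
  qed
  have Wg: "W \<inter> path_image g = W \<inter> path_image c" "W \<inter> path_image c \<subseteq> path_image c - {a,b}"
  proof -
    have "W \<inter> (sphere (g t) r \<union> path_image c \<union> T) = W \<inter> (sphere (g t) r \<union> path_image g)"
      by (simp only: Un)
    moreover have "W \<inter> sphere (g t) r = {}" by (auto simp: W_def)
    ultimately show "W \<inter> path_image g = W \<inter> path_image c" using WT by blast
    show "W \<inter> path_image c \<subseteq> path_image c - {a,b}"
      using ab_sph \<open>W \<inter> sphere (g t) r = {}\<close> by blast
  qed
  have clo: "W \<inter> path_image g \<subseteq> closure (W \<inter> H)" if "path_image c \<subseteq> frontier H" for H
  proof -
    have "W \<inter> path_image g \<subseteq> W \<inter> closure H"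
      using that Wg by (auto simp: frontier_def)
    also have "\<dots> \<subseteq> closure (W \<inter> H)"
      by (rule open_Int_closure_subset) (auto simp: W_def)
    finally show ?thesis .
  qed
  show thesis
  proof (rule that[of W "W \<inter> P0" "W \<inter> Q0"])
    show "open W" by (auto simp: W_def)
    show "g t \<in> W" using e r by (auto simp: W_def)
    show "W \<subseteq> U" using r(2) ball_subset_cball[of "g t" r] unfolding W_def by blast
    have "W \<subseteq> P0 \<union> Q0 \<union> (path_image c - {a,b})" using halves by (auto simp: W_def)
    then show "W - path_image g = W \<inter> P0 \<union> W \<inter> Q0" using Wg disj by blast
    show "W \<inter> path_image g \<subseteq> closure (W \<inter> P0)" "W \<inter> path_image g \<subseteq> closure (W \<inter> Q0)"
      using clo[of P0] clo[of Q0] P0(2) Q0(2) by simp_all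
  qed (use comp[of P0] comp[of Q0] P0(1) Q0(1) disj in simp_all)
qed

section \<open>Square roots and their changes of sign across arcs\<close>

text \<open>Moving the zero along the arc to the pole deforms \<open>z / (z - g 1)\<close> to \<open>1\<close>.\<close>

lemma sqrt_on_arc_complement:
  fixes g :: "real \<Rightarrow> complex"
  assumes "arc g" "g 0 = 0"
  obtains s where "continuous_on (- path_image g) s"
    "\<And>z. z \<in> - path_image g \<Longrightarrow> (s z)\<^sup>2 = z / (z - g 1)"
proof -
  let ?S = "- path_image g" and ?h = "\<lambda>p. (snd p - g (fst p)) / (snd p - g 1)"
  have contg: "continuous_on {0..1} g" using assms by (auto simp: arc_def path_def)
  have nz: "z - g t \<noteq> 0" "z \<noteq> g t" if "z \<in> ?S" "t \<in> {0..1}" for z t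
    using that by (auto simp: path_image_def)
  have "homotopic_with_canon (\<lambda>h. True) ?S (-{0}) (\<lambda>z. z / (z - g 1)) (\<lambda>z. 1)"
  proof (rule iffD2[OF homotopic_with], simp, intro exI[of _ ?h] conjI ballI allI)
    have "continuous_on ({0..1} \<times> ?S) ?h"
      using nz(2) nz(2)[of _ 1] by (intro continuous_intros continuous_on_compose2[OF contg]) force+
    moreover have "?h \<in> {0..1} \<times> ?S \<rightarrow> - {0}" using nz(2) nz(2)[of _ 1] by force
    ultimately show "continuous_map (prod_topology (top_of_set {0..1}) (top_of_set ?S)) (top_of_set (- {0})) ?h"
      by (simp add: image_subset_iff_funcset flip: subtopology_Times)
    show "?h (0, z) = z / (z - g 1)" for z using assms(2) by simp
    show "?h (1, z) = 1" if "z \<in> topspace (top_of_set ?S)" for z using nz(1)[of z 1] that by simp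
  qed auto
  \<comment> \<open>A map into the punctured plane that is homotopic to a constant has a continuous
    logarithm; half of the logarithm gives the root.\<close>
  then have "\<exists>l. continuous_on ?S l \<and> (\<forall>z\<in>?S. z / (z - g 1) = exp (l z))"
    by (subst inessential_eq_continuous_logarithm[symmetric]) (rule exI)
  then obtain l where l: "continuous_on ?S l" "\<And>z. z \<in> ?S \<Longrightarrow> z / (z - g 1) = exp (l z)"
    by blast
  show thesis
  proof
    show "continuous_on ?S (\<lambda>z. exp (l z / 2))" by (intro continuous_intros l) simp
    show "(exp (l z / 2))\<^sup>2 = z / (z - g 1)" if "z \<in> ?S" for z
      unfolding l(2)[OF that] using exp_double[of "l z / 2"] by simp
  qed
qed

text \<open>Dividing by \<open>u z * z ^ m\<close> leaves a continuous root of \<open>z\<close>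
  itself. Along a circle around 0 it differs from the branch with argument t / 2 by a constant sign,
  but that branch changes sign after a full turn.\<close>

lemma no_sqrt_odd_power:
  fixes s u :: "complex \<Rightarrow> complex"
  assumes r: "0 < r" and "odd n" and s: "continuous_on (ball 0 r - {0}) s"
    and u: "continuous_on (ball 0 r) u" "\<And>z. z \<in> ball 0 r \<Longrightarrow> u z \<noteq> 0"
    and sq: "\<And>z. z \<in> ball 0 r - {0} \<Longrightarrow> (s z)\<^sup>2 = z ^ n * (u z)\<^sup>2"
  shows False
proof -
  obtain m where n: "n = 2 * m + 1" using \<open>odd n\<close> oddE by blast
  define q where "q = r / 2"
  have q: "0 < q" "q < r" using r by (auto simp: q_def)
  define c where "c t = of_real q * exp (\<i> * of_real t)" for t
  have c: "c t \<in> ball 0 r - {0}" for t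
    using q by (auto simp: c_def norm_mult)
  define w where "w z = s z / (u z * z ^ m)" for z
  have contw: "continuous_on (ball 0 r - {0}) w"
    unfolding w_def using u by (intro continuous_intros s continuous_on_subset[OF u(1)]) auto
  have sqw: "(w z)\<^sup>2 = z" if "z \<in> ball 0 r - {0}" for z
  proof -
    have "z ^ n = z * (z ^ m)\<^sup>2" by (simp add: n power_mult [symmetric] mult.commute)
    then show ?thesis
      using sq[OF that] u(2)[of z] that by (auto simp: w_def power_divide power_mult_distrib field_simps)
  qed
  define f where "f t = w (c t) / (of_real (sqrt q) * exp (\<i> * of_real t / 2))" for t :: real
  have cf: "continuous_on {0..2*pi} f"
    unfolding f_def using q
    by (intro continuous_intros continuous_on_compose2[OF contw])
       (use c in \<open>auto simp: c_def intro!: continuous_intros\<close>)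
  have sqf: "(f t)\<^sup>2 = 1" for t
  proof -
    have "(of_real (sqrt q) * exp (\<i> * of_real t / 2))\<^sup>2 = c t"
      using q by (simp add: c_def power_mult_distrib flip: exp_double of_real_power)
    then show ?thesis using sqw[OF c[of t]] c[of t] by (simp add: f_def power_divide)
  qed
  have "f ` {0..2*pi} \<subseteq> {1, -1}" using sqf power2_eq_1_iff by auto
  then have "finite (f ` {0..2*pi})" by (rule finite_subset) auto
  then have "f constant_on {0..2*pi}"
    by (intro continuous_finite_range_constant cf) auto
  then have "f 0 = f (2*pi)" unfolding constant_on_def by auto
  moreover have "c 0 = c (2*pi)" using exp_two_pi_i by (simp add: c_def mult_ac)
  ultimately have "f 0 = - f 0"
    using exp_pi_i by (auto simp: f_def)
  then show False using sqf[of 0] by simp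
qed

text \<open>Both pieces accumulate at \<open>q\<close>, and along them \<open>h\<close> tends to
  \<open>\<sigma> * r q\<close> and \<open>\<tau> * r q\<close>, where \<open>r q\<close> is not 0.
  A change of sign across an arc is thus expressed by a missing limit, in the form needed for
  continuous extension.\<close>

lemma limit_iff_equal_signs:
  fixes h r :: "complex \<Rightarrow> complex"
  assumes W: "open W" "q \<in> W" "W \<inter> O' = P \<union> Q" "q \<notin> O'" "q \<in> closure P" "q \<in> closure Q"
    and h: "\<And>x. x \<in> P \<Longrightarrow> h x = \<sigma> * r x" "\<And>x. x \<in> Q \<Longrightarrow> h x = \<tau> * r x"
    and r: "isCont r q" "r q \<noteq> 0"
  shows "(\<exists>l. (h \<longlongrightarrow> l) (at q within O')) \<longleftrightarrow> \<sigma> = \<tau>"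
proof
  assume "\<exists>l. (h \<longlongrightarrow> l) (at q within O')"
  then obtain l where l: "(h \<longlongrightarrow> l) (at q within O')" ..
  have "l = a * r q" if "H \<subseteq> W \<inter> O'" "q \<in> closure H" "\<And>x. x \<in> H \<Longrightarrow> h x = a * r x" for H a
  proof (rule tendsto_unique)
    have "q \<notin> H" using W that by auto
    then show "at q within H \<noteq> bot" using that
      by (simp add: trivial_limit_within closure_def)
    have "((\<lambda>x. a * r x) \<longlongrightarrow> a * r q) (at q within H)"
      using r by (intro tendsto_intros) (auto simp: isCont_def intro: tendsto_within_subset)
    moreover have "\<forall>\<^sub>F x in at q within H. h x = a * r x"
      using that by (simp add: eventually_at_filter)
    ultimately show "(h \<longlongrightarrow> a * r q) (at q within H)"
      using tendsto_cong by fast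
    show "(h \<longlongrightarrow> l) (at q within H)" using l that by (auto intro: tendsto_within_subset)
  qed
  from this[of P \<sigma>] this[of Q \<tau>] have "\<sigma> * r q = \<tau> * r q" using W h by auto
  then show "\<sigma> = \<tau>" using r by simp
next
  assume "\<sigma> = \<tau>"
  have "((\<lambda>x. \<sigma> * r x) \<longlongrightarrow> \<sigma> * r q) (at q within O')"
    using r by (intro tendsto_intros) (auto simp: isCont_def intro: tendsto_within_subset)
  moreover have "\<forall>\<^sub>F x in at q within O'. h x = \<sigma> * r x"
    unfolding eventually_at_topological
    using W h \<open>\<sigma> = \<tau>\<close> by (intro exI[of _ W]) auto
  ultimately show "\<exists>l. (h \<longlongrightarrow> l) (at q within O')"
    using tendsto_cong by fast
qed

text \<open>The quotient \<open>h x / r x\<close> is continuous with values 1 and -1, hence constant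
  on connected sets. The set \<open>P\<close> itself may be disconnected; its points are joined
  within \<open>T\<close>.\<close>

lemma sqrt_ratio_constant:
  fixes h r :: "complex \<Rightarrow> complex"
  assumes cont: "continuous_on T h" "continuous_on T r"
    and sq: "\<And>x. x \<in> T \<Longrightarrow> (h x)\<^sup>2 = (r x)\<^sup>2" "\<And>x. x \<in> T \<Longrightarrow> r x \<noteq> 0"
    and P: "\<And>x y. x \<in> P \<Longrightarrow> y \<in> P \<Longrightarrow> connected_component T x y"
  obtains \<sigma> where "\<sigma> = 1 \<or> \<sigma> = -1" "\<And>x. x \<in> P \<Longrightarrow> h x = \<sigma> * r x"
proof (cases "P = {}")
  case False
  then obtain a where a: "a \<in> P" by auto
  have PT: "P \<subseteq> T" using P connected_component_in by blast
  let ?f = "\<lambda>x. h x / r x"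
  have sqf: "?f x = 1 \<or> ?f x = -1" if "x \<in> T" for x
    using sq[OF that] by (auto simp: power2_eq_iff)
  show thesis
  proof
    show "?f a = 1 \<or> ?f a = -1" using sqf a PT by auto
    fix x assume "x \<in> P"
    then obtain C where C: "connected C" "C \<subseteq> T" "x \<in> C" "a \<in> C"
      using P[OF \<open>x \<in> P\<close> a] by (auto simp: connected_component_def)
    have "continuous_on C ?f"
      using C sq(2) by (intro continuous_intros continuous_on_subset[OF cont(1)] continuous_on_subset[OF cont(2)]) auto
    moreover have "?f ` C \<subseteq> {1, -1}" using sqf C(2) by blast
    then have "finite (?f ` C)" by (rule finite_subset) auto
    ultimately have "?f constant_on C" using C by (intro continuous_finite_range_constant)
    then have "?f x = ?f a" using C unfolding constant_on_def by auto
    then show "h x = ?f a * r x" using sq(2)[of x] \<open>x \<in> P\<close> PT by (auto simp: field_simps)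
  qed
qed (use that in auto)

text \<open>Near \<open>g t\<close> the functions \<open>k1\<close> and \<open>k2\<close> have
  continuous roots, from which \<open>h1\<close> and \<open>h2\<close> differ by a sign on each side
  of the arc; \<open>b1\<close> and \<open>b2\<close> say that the signs on the two sides agree. The
  two roots are handled together because their product has a limit also when both flip. One pair
  \<open>b1\<close>, \<open>b2\<close> serves all arc points in \<open>W\<close>, so flipping is
  locally constant along the arc.\<close>

lemma two_sqrts_across_arc:
  fixes g :: "real \<Rightarrow> complex" and h1 h2 k1 k2 :: "complex \<Rightarrow> complex"
  assumes "arc g" and t: "0 < t" "t < 1" and V: "open V" "g t \<in> V" "V \<inter> O' = V - path_image g"
    and k1: "continuous_on V k1" "\<And>x. x \<in> V \<Longrightarrow> k1 x \<noteq> 0"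
    and k2: "continuous_on V k2" "\<And>x. x \<in> V \<Longrightarrow> k2 x \<noteq> 0"
    and h1: "continuous_on (V \<inter> O') h1" "\<And>x. x \<in> V \<inter> O' \<Longrightarrow> (h1 x)\<^sup>2 = k1 x"
    and h2: "continuous_on (V \<inter> O') h2" "\<And>x. x \<in> V \<inter> O' \<Longrightarrow> (h2 x)\<^sup>2 = k2 x"
  obtains W b1 b2 where "open W" "g t \<in> W" "W \<subseteq> V"
    "\<And>q. q \<in> W \<inter> path_image g \<Longrightarrow> (\<exists>l. (h1 \<longlongrightarrow> l) (at q within O')) \<longleftrightarrow> b1"
    "\<And>q. q \<in> W \<inter> path_image g \<Longrightarrow> (\<exists>l. (h2 \<longlongrightarrow> l) (at q within O')) \<longleftrightarrow> b2"
    "\<And>q. q \<in> W \<inter> path_image g \<Longrightarrow> (\<exists>l. ((\<lambda>z. h1 z * h2 z) \<longlongrightarrow> l) (at q within O')) \<longleftrightarrow> (b1 \<longleftrightarrow> b2)"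
    "\<And>q. q \<in> W \<inter> path_image g \<Longrightarrow> q \<in> closure (V \<inter> O')"
proof -
  obtain e where e: "0 < e" "ball (g t) e \<subseteq> V" using V open_contains_ball by blast
  let ?U = "ball (g t) e"
  have con: "contractible ?U" by (simp add: convex_imp_contractible)
  obtain r1 where r1: "continuous_on ?U r1" "\<And>x. x \<in> ?U \<Longrightarrow> k1 x = (r1 x)\<^sup>2"
    using continuous_sqrt_on_contractible[OF continuous_on_subset[OF k1(1) e(2)] con] k1(2) e by blast
  obtain r2 where r2: "continuous_on ?U r2" "\<And>x. x \<in> ?U \<Longrightarrow> k2 x = (r2 x)\<^sup>2"
    using continuous_sqrt_on_contractible[OF continuous_on_subset[OF k2(1) e(2)] con] k2(2) e by blast
  obtain W P Q where W: "open W" "g t \<in> W" "W \<subseteq> ?U" "W - path_image g = P \<union> Q"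
    "\<And>x y. x \<in> P \<Longrightarrow> y \<in> P \<Longrightarrow> connected_component (?U - path_image g) x y"
    "\<And>x y. x \<in> Q \<Longrightarrow> y \<in> Q \<Longrightarrow> connected_component (?U - path_image g) x y"
    "W \<inter> path_image g \<subseteq> closure P" "W \<inter> path_image g \<subseteq> closure Q"
    by (rule arc_two_sides[OF \<open>arc g\<close> t, of ?U]) (use e in auto)
  have sub: "?U - path_image g \<subseteq> V \<inter> O'" using V e by auto
  have T: "continuous_on (?U - path_image g) h1" "continuous_on (?U - path_image g) r1"
      "continuous_on (?U - path_image g) h2" "continuous_on (?U - path_image g) r2"
    using continuous_on_subset[OF h1(1) sub] continuous_on_subset[OF h2(1) sub]
      continuous_on_subset[OF r1(1)] continuous_on_subset[OF r2(1)] by auto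
  have sq: "(h1 x)\<^sup>2 = (r1 x)\<^sup>2" "(h2 x)\<^sup>2 = (r2 x)\<^sup>2" if "x \<in> ?U - path_image g" for x
    using h1(2)[of x] h2(2)[of x] r1(2)[of x] r2(2)[of x] that subsetD[OF sub that] by auto
  have nz: "r1 x \<noteq> 0" "r2 x \<noteq> 0" if "x \<in> ?U" for x
    using r1(2)[OF that] r2(2)[OF that] k1(2)[of x] k2(2)[of x] that e(2) by auto
  obtain \<sigma>1 where s1: "\<sigma>1 = 1 \<or> \<sigma>1 = -1" "\<And>x. x \<in> P \<Longrightarrow> h1 x = \<sigma>1 * r1 x"
    by (rule sqrt_ratio_constant[OF T(1,2) sq(1) nz(1) W(5)]) auto
  obtain \<tau>1 where t1: "\<tau>1 = 1 \<or> \<tau>1 = -1" "\<And>x. x \<in> Q \<Longrightarrow> h1 x = \<tau>1 * r1 x"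
    by (rule sqrt_ratio_constant[OF T(1,2) sq(1) nz(1) W(6)]) auto
  obtain \<sigma>2 where s2: "\<sigma>2 = 1 \<or> \<sigma>2 = -1" "\<And>x. x \<in> P \<Longrightarrow> h2 x = \<sigma>2 * r2 x"
    by (rule sqrt_ratio_constant[OF T(3,4) sq(2) nz(2) W(5)]) auto
  obtain \<tau>2 where t2: "\<tau>2 = 1 \<or> \<tau>2 = -1" "\<And>x. x \<in> Q \<Longrightarrow> h2 x = \<tau>2 * r2 x"
    by (rule sqrt_ratio_constant[OF T(3,4) sq(2) nz(2) W(6)]) auto
  have WO: "W \<inter> O' = P \<union> Q" using V W e by blast
  have cont: "isCont r1 q" "isCont r2 q" if "q \<in> W" for q
    using r1(1) r2(1) that W(3) by (auto simp: continuous_on_eq_continuous_at subset_eq)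
  have nO: "q \<notin> O'" if "q \<in> W \<inter> path_image g" for q
    using that W(3) e(2) V(3) by blast
  show thesis
  proof (rule that[of W "\<sigma>1 = \<tau>1" "\<sigma>2 = \<tau>2"])
    show "W \<subseteq> V" using W e by blast
    fix q assume q: "q \<in> W \<inter> path_image g"
    then have cl: "q \<in> W" "q \<in> closure P" "q \<in> closure Q" "q \<in> ?U" using W by auto
    show "(\<exists>l. (h1 \<longlongrightarrow> l) (at q within O')) \<longleftrightarrow> \<sigma>1 = \<tau>1"
      by (rule limit_iff_equal_signs[OF W(1) cl(1) WO nO[OF q] cl(2,3) s1(2) t1(2) cont(1)[OF cl(1)] nz(1)[OF cl(4)]])
    show "(\<exists>l. (h2 \<longlongrightarrow> l) (at q within O')) \<longleftrightarrow> \<sigma>2 = \<tau>2"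
      by (rule limit_iff_equal_signs[OF W(1) cl(1) WO nO[OF q] cl(2,3) s2(2) t2(2) cont(2)[OF cl(1)] nz(2)[OF cl(4)]])
    have "(\<exists>l. ((\<lambda>z. h1 z * h2 z) \<longlongrightarrow> l) (at q within O')) \<longleftrightarrow> \<sigma>1 * \<sigma>2 = \<tau>1 * \<tau>2"
      by (rule limit_iff_equal_signs[OF W(1) cl(1) WO nO[OF q] cl(2,3), where r = "\<lambda>z. r1 z * r2 z"])
         (use s1 s2 t1 t2 cont[OF cl(1)] nz[OF cl(4)] in \<open>auto intro!: continuous_intros\<close>)
    also have "\<dots> \<longleftrightarrow> (\<sigma>1 = \<tau>1 \<longleftrightarrow> \<sigma>2 = \<tau>2)"
      using s1(1) s2(1) t1(1) t2(1) by auto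
    finally show "(\<exists>l. ((\<lambda>z. h1 z * h2 z) \<longlongrightarrow> l) (at q within O')) \<longleftrightarrow> (\<sigma>1 = \<tau>1 \<longleftrightarrow> \<sigma>2 = \<tau>2)" .
    have "P \<subseteq> V \<inter> O'" using WO W(3) e by blast
    then show "q \<in> closure (V \<inter> O')" using cl(2) closure_mono[of P] by blast
  qed (fact W)+
qed

text \<open>The limits extend \<open>h\<close> continuously over the punctured disc, and the
  equation for its square persists because \<open>O'\<close> is dense there. This contradicts
  \<open>no_sqrt_odd_power\<close>.\<close>

lemma no_extendable_sqrt_odd_power:
  fixes h u :: "complex \<Rightarrow> complex"
  assumes r: "0 < r" and n: "odd n" and OB: "O' \<subseteq> ball 0 r - {0}" "ball 0 r - {0} \<subseteq> closure O'"
    and h: "continuous_on O' h" "\<And>z. z \<in> O' \<Longrightarrow> (h z)\<^sup>2 = z ^ n * (u z)\<^sup>2"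
    and u: "continuous_on (ball 0 r) u" "\<And>z. z \<in> ball 0 r \<Longrightarrow> u z \<noteq> 0"
    and lim: "\<And>q. q \<in> ball 0 r - {0} - O' \<Longrightarrow> \<exists>l. (h \<longlongrightarrow> l) (at q within O')"
  shows False
proof -
  let ?B = "ball 0 r - {0 :: complex}"
  have "\<exists>g. continuous_map (subtopology euclidean ?B) euclidean g \<and> (\<forall>x\<in>O'. g x = h x)"
    by (rule continuous_map_extension_pointwise_alt[of euclidean O' ?B euclidean h])
       (use OB h lim in \<open>auto simp: regular_space_euclidean atin_within_def nhdsin_def at_within_def nhds_def\<close>)
  then obtain g where g: "continuous_on ?B g" "\<And>x. x \<in> O' \<Longrightarrow> g x = h x" by auto
  have "(g z)\<^sup>2 = z ^ n * (u z)\<^sup>2" if "z \<in> ?B" for z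
  proof -
    let ?f = "\<lambda>z. (g z)\<^sup>2 - z ^ n * (u z)\<^sup>2"
    have "continuous_on ?B ?f"
      by (intro continuous_intros g continuous_on_subset[OF u(1)]) auto
    then have "closedin (top_of_set ?B) (?B \<inter> ?f -` {0})"
      by (intro continuous_closedin_preimage) auto
    then obtain C where C: "closed C" "?B \<inter> ?f -` {0} = ?B \<inter> C"
      unfolding closedin_closed by blast
    have "O' \<subseteq> ?B \<inter> ?f -` {0}" using g h OB by auto
    then have "closure O' \<subseteq> C" using C by (intro closure_minimal) auto
    then have "?B \<subseteq> ?B \<inter> ?f -` {0}" using OB C by blast
    then show ?thesis using that by auto
  qed
  then show False using no_sqrt_odd_power[OF r n g(1) u] by blast
qed

text \<open>Flipping is locally constant along the arc, so a limit at one interior point would give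
  limits at all of them. Then \<open>s\<close> would extend to a root of \<open>z\<close> times a
  unit on a punctured disc around 0.\<close>

lemma arc_sqrt_flips:
  fixes g :: "real \<Rightarrow> complex"
  assumes g: "arc g" "g 0 = 0" and t: "0 < t" "t < 1"
    and s: "continuous_on (- path_image g) s"
      "\<And>z. z \<in> - path_image g \<Longrightarrow> (s z)\<^sup>2 = z / (z - g 1)"
  shows "\<nexists>l. (s \<longlongrightarrow> l) (at (g t) within - path_image g)"
proof
  let ?O = "- path_image g" and ?L = "\<lambda>t. \<exists>l. (s \<longlongrightarrow> l) (at (g t) within - path_image g)"
  assume "?L t"
  have contg: "continuous_on {0..1} g" and inj: "inj_on g {0..1}"
    using g by (auto simp: arc_def path_def)
  have loc: "\<exists>W b. open W \<and> g t \<in> W \<and>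
      (\<forall>q \<in> W \<inter> path_image g. (\<exists>l. (s \<longlongrightarrow> l) (at q within ?O)) = b) \<and> g t \<in> closure ?O"
    if "t \<in> {0<..<1}" for t
  proof -
    let ?V = "- {0, g 1}"
    have t': "0 < t" "t < 1" using that by auto
    have gt: "g t \<in> ?V" using that inj_onD[OF inj, of t 0] inj_onD[OF inj, of t 1] g(2) by auto
    have 0: "0 \<in> path_image g" "g 1 \<in> path_image g"
      using pathstart_in_path_image[of g] pathfinish_in_path_image[of g] g(2)
      by (auto simp: pathstart_def pathfinish_def)
    have V: "?V \<inter> ?O = ?V - path_image g" by auto
    have k: "continuous_on ?V (\<lambda>z. z / (z - g 1))" by (intro continuous_intros) auto
    have sc: "continuous_on (?V \<inter> ?O) s" by (rule continuous_on_subset[OF s(1)]) auto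
    \<comment> \<open>Both roots are taken to be \<open>s\<close>: what matters is that one truth
      value serves a whole neighbourhood along the arc, and that the complement of the arc is dense
      at \<open>g t\<close>.\<close>
    obtain W b1 b2 where W: "open W" "g t \<in> W" "W \<subseteq> ?V"
      "\<And>q. q \<in> W \<inter> path_image g \<Longrightarrow> (\<exists>l. (s \<longlongrightarrow> l) (at q within ?O)) \<longleftrightarrow> b1"
      "\<And>q. q \<in> W \<inter> path_image g \<Longrightarrow> (\<exists>l. (s \<longlongrightarrow> l) (at q within ?O)) \<longleftrightarrow> b2"
      "\<And>q. q \<in> W \<inter> path_image g \<Longrightarrow> (\<exists>l. ((\<lambda>z. s z * s z) \<longlongrightarrow> l) (at q within ?O)) \<longleftrightarrow> (b1 \<longleftrightarrow> b2)"
      "\<And>q. q \<in> W \<inter> path_image g \<Longrightarrow> q \<in> closure (?V \<inter> ?O)"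
      by (rule two_sqrts_across_arc[OF g(1) t' _ gt V k _ k _ sc _ sc]) (use s(2) in auto)
    have "g t \<in> W \<inter> path_image g" using W that by (auto simp: path_image_def)
    then have "g t \<in> closure ?O" using W(7) closure_mono[of "?V \<inter> ?O" ?O] by blast
    with W show ?thesis by (intro exI[of _ W] exI[of _ b1]) simp
  qed
  have all: "?L u" if "u \<in> {0<..<1}" for u
  proof (rule connected_induction_simple[of "{0<..<1::real}" t u ?L])
    fix a :: real assume a: "a \<in> {0<..<1}"
    obtain W b where W: "open W" "g a \<in> W"
      "\<And>q. q \<in> W \<inter> path_image g \<Longrightarrow> (\<exists>l. (s \<longlongrightarrow> l) (at q within ?O)) = b"
      using loc[OF a] by blast
    have "openin (top_of_set {0<..<1}) ({0<..<1} \<inter> g -` W)"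
      by (intro continuous_openin_preimage_gen W continuous_on_subset[OF contg]) auto
    moreover have "?L x = b" if "x \<in> {0<..<1} \<inter> g -` W" for x
      using W(3)[of "g x"] that by (auto simp: path_image_def)
    ultimately show "\<exists>T. openin (top_of_set {0<..<1}) T \<and> a \<in> T \<and> (\<forall>x\<in>T. \<forall>y\<in>T. ?L x \<longrightarrow> ?L y)"
      using W(2) a by (intro exI[of _ "{0<..<1} \<inter> g -` W"]) auto
  qed (use t that \<open>?L t\<close> in auto)
  \<comment> \<open>The disc of this radius excludes the pole \<open>g 1\<close>; apart from 0 it
    meets the arc only in interior points, where \<open>s\<close> has limits.\<close>
  define \<rho> where "\<rho> = norm (g 1)"
  have "g 1 \<noteq> g 0" using inj_onD[OF inj, of 1 0] by auto
  then have \<rho>: "0 < \<rho>" using g(2) by (simp add: \<rho>_def)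
  have nz: "z - g 1 \<noteq> 0" if "z \<in> ball 0 \<rho>" for z using that by (auto simp: \<rho>_def)
  have "continuous_on (ball 0 \<rho>) (\<lambda>z. 1 / (z - g 1))" using nz by (intro continuous_intros) auto
  moreover have "contractible (ball (0::complex) \<rho>)" by (simp add: convex_imp_contractible)
  moreover have "1 / (z - g 1) \<noteq> 0" if "z \<in> ball 0 \<rho>" for z using nz[OF that] by simp
  ultimately obtain u where u: "continuous_on (ball 0 \<rho>) u" "\<And>z. z \<in> ball 0 \<rho> \<Longrightarrow> 1 / (z - g 1) = (u z)\<^sup>2"
    by (rule continuous_sqrt_on_contractible) auto
  have inner: "\<exists>t\<in>{0<..<1}. q = g t" if "q \<in> ball 0 \<rho> - {0}" "q \<in> path_image g" for q
  proof -
    obtain t where t: "t \<in> {0..1}" "q = g t" using \<open>q \<in> path_image g\<close> by (auto simp: path_image_def)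
    have "t \<noteq> 0" "t \<noteq> 1" using t that g(2) by (auto simp: \<rho>_def)
    with t show ?thesis by (intro bexI[of _ t]) auto
  qed
  show False
  proof (rule no_extendable_sqrt_odd_power[OF \<rho>, of 1 "ball 0 \<rho> - {0} - path_image g" s u])
    let ?B = "ball 0 \<rho> - {0 :: complex}"
    have oB: "open ?B" by (intro open_Diff) auto
    show "?B \<subseteq> closure (?B - path_image g)"
    proof
      fix q assume q: "q \<in> ?B"
      have "q \<in> closure ?O"
      proof (cases "q \<in> path_image g")
        case True
        then obtain t where "t \<in> {0<..<1}" "q = g t" using inner q by blast
        then show ?thesis using loc by blast
      qed (use closure_subset[of ?O] in auto)
      then have "q \<in> closure (?B \<inter> ?O)" using open_Int_closure_subset[OF oB, of ?O] q by blast
      then show "q \<in> closure (?B - path_image g)" by (simp add: Diff_eq)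
    qed
    show "continuous_on (?B - path_image g) s" by (rule continuous_on_subset[OF s(1)]) auto
    show "(s z)\<^sup>2 = z ^ 1 * (u z)\<^sup>2" if "z \<in> ?B - path_image g" for z
      using that s(2)[of z] u(2)[of z, symmetric] by simp
    show "u z \<noteq> 0" if "z \<in> ball 0 \<rho>" for z using u(2)[OF that] nz[OF that] by auto
    show "\<exists>l. (s \<longlongrightarrow> l) (at q within ?B - path_image g)" if q: "q \<in> ?B - (?B - path_image g)" for q
    proof -
      obtain t where "t \<in> {0<..<1}" "q = g t" using inner[of q] q by blast
      then obtain l where "(s \<longlongrightarrow> l) (at q within ?O)" using all by blast
      then show ?thesis by (intro exI[of _ l]) (auto intro: tendsto_within_subset)
    qed
  qed (use u in auto)
qed

text \<open>Each sign change of the square root of \<open>z / (z - \<gamma> i 1)\<close> across \<open>\<gamma> i\<close>, for \<open>i \<in> J\<close>, is undone by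
  the change of colour there. So the coloured product of these roots extends to a square root of
  \<open>z\<^sup>n\<close>, \<open>n = card J\<close>, up to a unit, around the puncture.\<close>

lemma even_number_of_flipping_arcs:
  fixes \<gamma> :: "'i \<Rightarrow> real \<Rightarrow> complex"
  assumes I: "finite I" "J \<subseteq> I" and r: "0 < r"
    and arcs: "\<And>i. i \<in> I \<Longrightarrow> arc (\<gamma> i)" "\<And>i. i \<in> I \<Longrightarrow> \<gamma> i 0 = 0"
      "\<And>i. i \<in> I \<Longrightarrow> \<gamma> i 1 \<notin> ball 0 r"
    and disj: "\<And>i j. i \<in> I \<Longrightarrow> j \<in> I \<Longrightarrow> i \<noteq> j \<Longrightarrow> path_image (\<gamma> i) \<inter> path_image (\<gamma> j) \<subseteq> {0}"
    and R: "open R1" "open R2" "R1 \<inter> R2 = {}"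
      "R1 \<union> R2 = ball 0 r - {0} - (\<Union>i\<in>I. path_image (\<gamma> i))"
    and flip: "\<And>i p. i \<in> J \<Longrightarrow> p \<in> path_image (\<gamma> i) \<inter> ball 0 r - {0} \<Longrightarrow> p \<in> closure R1 \<inter> closure R2"
    and stay: "\<And>i p. i \<in> I - J \<Longrightarrow> p \<in> path_image (\<gamma> i) \<inter> ball 0 r - {0} \<Longrightarrow> p \<notin> closure R1 \<inter> closure R2"
  shows "even (card J)"
proof (rule ccontr)
  assume oddJ: "odd (card J)"
  let ?B = "ball 0 r - {0 :: complex}"
  define O' where "O' = ?B - (\<Union>i\<in>I. path_image (\<gamma> i))"
  have finJ: "finite J" using I finite_subset by blast
  have closedI: "closed (path_image (\<gamma> i))" if "i \<in> I" for i
    using arcs(1)[OF that] by (simp add: closed_arc_image)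
  have openV: "open (?B - (\<Union>j\<in>I-{i}. path_image (\<gamma> j)))" for i
    using I closedI by (intro open_Diff closed_UN) auto
  have "\<exists>s. continuous_on (- path_image (\<gamma> i)) s \<and>
      (\<forall>z\<in>- path_image (\<gamma> i). (s z)\<^sup>2 = z / (z - \<gamma> i 1))" if "i \<in> I" for i
    by (rule sqrt_on_arc_complement[OF arcs(1)[OF that] arcs(2)[OF that]]) blast
  then obtain s where s: "\<And>i. i \<in> I \<Longrightarrow> continuous_on (- path_image (\<gamma> i)) (s i)"
      "\<And>i z. i \<in> I \<Longrightarrow> z \<in> - path_image (\<gamma> i) \<Longrightarrow> (s i z)\<^sup>2 = z / (z - \<gamma> i 1)"
    by metis
  \<comment> \<open>The colour: a square root of 1 that changes sign exactly where \<open>R1\<close>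
    and \<open>R2\<close> touch.\<close>
  define \<kappa> where "\<kappa> z = (if z \<in> R1 then 1 else -1 :: complex)" for z
  have RO: "R1 \<union> R2 = O'" unfolding O'_def by (rule R(4))
  have "continuous_on (R1 \<union> R2) \<kappa>"
  proof (rule continuous_on_open_Un)
    show "continuous_on R1 \<kappa>" by (rule continuous_on_eq[of _ "\<lambda>_. 1"]) (auto simp: \<kappa>_def)
    show "continuous_on R2 \<kappa>" by (rule continuous_on_eq[of _ "\<lambda>_. -1"]) (use R in \<open>auto simp: \<kappa>_def\<close>)
  qed (use R in auto)
  then have cont\<kappa>: "continuous_on O' \<kappa>" by (simp add: RO)
  define h where "h z = \<kappa> z * (\<Prod>i\<in>J. s i z)" for z
  have nz: "z - \<gamma> i 1 \<noteq> 0" if "z \<in> ball 0 r" "i \<in> I" for z i using arcs(3)[of i] that by auto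
  \<comment> \<open>Collects the poles: the product of the roots has square
    \<open>z ^ card J * ?k z\<close>, and \<open>?k\<close> has a root on the disc because the poles
    lie outside.\<close>
  let ?k = "\<lambda>z. \<Prod>i\<in>J. 1 / (z - \<gamma> i 1)"
  have "x - \<gamma> i 1 \<noteq> 0" if "x \<in> ball 0 r" "i \<in> J" for x i using nz that I by blast
  then have "continuous_on (ball 0 r) ?k" by (intro continuous_intros) blast
  moreover have "contractible (ball (0::complex) r)" by (simp add: convex_imp_contractible)
  moreover have knz: "?k z \<noteq> 0" if "z \<in> ball 0 r" for z
    using nz[OF that] I(2) finJ by (simp add: prod_zero_iff) blast
  ultimately obtain u where u: "continuous_on (ball 0 r) u" "\<And>z. z \<in> ball 0 r \<Longrightarrow> ?k z = (u z)\<^sup>2"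
    by (rule continuous_sqrt_on_contractible) auto
  have mem: "\<exists>i\<in>I. \<exists>t\<in>{0<..<1}. q = \<gamma> i t" if q: "q \<in> ?B - O'" for q
  proof -
    obtain i where i: "i \<in> I" "q \<in> path_image (\<gamma> i)" using q by (auto simp: O'_def)
    then obtain t where t: "t \<in> {0..1}" "q = \<gamma> i t" by (auto simp: path_image_def)
    have "t \<noteq> 0" "t \<noteq> 1" using t q i arcs(2,3)[of i] by auto
    with i t show ?thesis by (intro bexI[of _ i] bexI[of _ t]) auto
  qed
  have local: "(\<exists>l. (h \<longlongrightarrow> l) (at q within O')) \<and> q \<in> closure O'"
    if q: "q \<in> ?B - O'" for q
  proof -
    obtain i t where i: "i \<in> I" and t: "t \<in> {0<..<1}" "q = \<gamma> i t" using mem[OF q] by blast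
    have t': "0 < t" "t < 1" using t by auto
    \<comment> \<open>Near \<open>q\<close> only the arc \<open>i\<close> is present, as different
      arcs share at most the point 0.\<close>
    define V where "V = ?B - (\<Union>j\<in>I-{i}. path_image (\<gamma> j))"
    have qi: "q \<in> path_image (\<gamma> i)" using t by (auto simp: path_image_def)
    have qj: "q \<notin> path_image (\<gamma> j)" if "j \<in> I - {i}" for j
      using disj[of i j] i qi q that by auto
    have V: "open V" "\<gamma> i t \<in> V" using openV[of i] qj q t(2) by (auto simp: V_def)
    have VO: "V \<inter> O' = V - path_image (\<gamma> i)" using i by (auto simp: V_def O'_def)
    have sub: "V \<inter> O' \<subseteq> - path_image (\<gamma> i)" using VO by auto
    have k1: "continuous_on V (\<lambda>_. 1 :: complex)" by auto
    have k2: "continuous_on V (\<lambda>z. z / (z - \<gamma> i 1))"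
      using nz[OF _ i] by (intro continuous_intros) (auto simp: V_def)
    have k2': "z / (z - \<gamma> i 1) \<noteq> 0" if "z \<in> V" for z using nz[OF _ i, of z] that by (auto simp: V_def)
    have h1: "continuous_on (V \<inter> O') \<kappa>" by (rule continuous_on_subset[OF cont\<kappa>]) auto
    have h2: "continuous_on (V \<inter> O') (s i)" by (rule continuous_on_subset[OF s(1)[OF i] sub])
    \<comment> \<open>The colour is treated as a root of the constant 1, so that its change of sign
      can cancel that of \<open>s i\<close>.\<close>
    obtain W b1 b2 where W: "open W" "\<gamma> i t \<in> W" "W \<subseteq> V"
      "\<And>q. q \<in> W \<inter> path_image (\<gamma> i) \<Longrightarrow> (\<exists>l. (\<kappa> \<longlongrightarrow> l) (at q within O')) \<longleftrightarrow> b1"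
      "\<And>q. q \<in> W \<inter> path_image (\<gamma> i) \<Longrightarrow> (\<exists>l. (s i \<longlongrightarrow> l) (at q within O')) \<longleftrightarrow> b2"
      "\<And>q. q \<in> W \<inter> path_image (\<gamma> i) \<Longrightarrow> (\<exists>l. ((\<lambda>z. \<kappa> z * s i z) \<longlongrightarrow> l) (at q within O')) \<longleftrightarrow> (b1 \<longleftrightarrow> b2)"
      "\<And>q. q \<in> W \<inter> path_image (\<gamma> i) \<Longrightarrow> q \<in> closure (V \<inter> O')"
      by (rule two_sqrts_across_arc[OF arcs(1)[OF i] t' V VO k1 _ k2 k2' h1 _ h2])
         (use t s(2)[OF i] sub in \<open>auto simp: \<kappa>_def\<close>)
    have qW: "q \<in> W \<inter> path_image (\<gamma> i)" using W(2) qi t(2) by auto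
    have clO: "q \<in> closure O'" using W(7)[OF qW] closure_mono[of "V \<inter> O'" O'] by blast
    have "\<exists>l. (s j \<longlongrightarrow> l) (at q within O')" if "j \<in> J - {i}" for j
    proof -
      have j: "j \<in> I" "q \<in> - path_image (\<gamma> j)" using that I qj by auto
      then have "isCont (s j) q"
        using s(1)[of j] closedI[of j] continuous_on_eq_continuous_at[of "- path_image (\<gamma> j)" "s j"]
        by (simp add: open_Compl)
      then show ?thesis unfolding isCont_def by (intro exI[of _ "s j q"]) (auto intro: tendsto_within_subset)
    qed
    then obtain l where l: "\<And>j. j \<in> J - {i} \<Longrightarrow> (s j \<longlongrightarrow> l j) (at q within O')" by metis
    have lim_rest: "((\<lambda>z. \<Prod>j\<in>J-{i}. s j z) \<longlongrightarrow> (\<Prod>j\<in>J-{i}. l j)) (at q within O')"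
      by (intro tendsto_prod l) auto
    have qp: "q \<in> path_image (\<gamma> i) \<inter> ball 0 r - {0}" using qi q by auto
    have nqO: "q \<notin> O'" using q by auto
    have "\<exists>l. (h \<longlongrightarrow> l) (at q within O')"
    \<comment> \<open>For \<open>i\<close> in \<open>J\<close> both the colour and
      \<open>s i\<close> flip at \<open>q\<close>, so their product does not. Otherwise
      \<open>s i\<close> does not occur in \<open>h\<close>, and the colour is constant near
      \<open>q\<close>.\<close>
    proof (cases "i \<in> J")
      case True
      have "\<not> b2"
      proof
        assume b2
        then obtain l where "(s i \<longlongrightarrow> l) (at q within O')" using W(5)[OF qW] by auto
        moreover have "at q within O' = at q within - path_image (\<gamma> i)"
          by (rule at_within_nhd[of _ V]) (use V VO t(2) in auto)
        ultimately have "(s i \<longlongrightarrow> l) (at q within - path_image (\<gamma> i))" by simp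
        then show False using arc_sqrt_flips[OF arcs(1,2)[OF i] _ _ s[OF i]] t by auto
      qed
      moreover have "\<not> b1"
      proof
        assume b1
        then obtain l where l: "(\<kappa> \<longlongrightarrow> l) (at q within O')" using W(4)[OF qW] by auto
        have "l = c" if "H \<subseteq> O'" "q \<in> closure H" "\<And>z. z \<in> H \<Longrightarrow> \<kappa> z = c" for H c
        proof (rule tendsto_unique)
          show "at q within H \<noteq> bot"
            using that nqO by (auto simp: trivial_limit_within closure_def)
          show "(\<kappa> \<longlongrightarrow> l) (at q within H)" using l that by (auto intro: tendsto_within_subset)
          have "\<forall>\<^sub>F z in at q within H. \<kappa> z = c" using that by (simp add: eventually_at_filter)
          then show "(\<kappa> \<longlongrightarrow> c) (at q within H)" by (rule tendsto_eventually)
        qed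
        moreover have "\<kappa> z = 1" if "z \<in> R1" for z using that by (simp add: \<kappa>_def)
        moreover have "\<kappa> z = -1" if "z \<in> R2" for z using that R(3) by (auto simp: \<kappa>_def)
        ultimately have "l = 1" "l = -1" using RO flip[OF True qp] by blast+
        then have "1 = (-1::complex)" by simp
        then show False by simp
      qed
      ultimately obtain l' where "((\<lambda>z. \<kappa> z * s i z) \<longlongrightarrow> l') (at q within O')" using W(6)[OF qW] by auto
      from tendsto_mult[OF this lim_rest] show ?thesis
        unfolding h_def by (subst prod.remove[OF finJ True]) (auto simp: mult_ac)
    next
      case False
      have "\<exists>c. \<forall>\<^sub>F z in at q within O'. \<kappa> z = c"
      proof -
        have "q \<notin> closure R1 \<or> q \<notin> closure R2" using stay[of i q] False i qp by blast
        then show ?thesis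
        proof
          assume *: "q \<notin> closure R1"
          have "\<forall>\<^sub>F z in at q within O'. \<kappa> z = -1"
            unfolding eventually_at_topological
            by (rule exI[of _ "- closure R1"]) (use * closure_subset[of R1] in \<open>auto simp: \<kappa>_def\<close>)
          then show ?thesis ..
        next
          assume *: "q \<notin> closure R2"
          have "\<forall>\<^sub>F z in at q within O'. \<kappa> z = 1"
            unfolding eventually_at_topological
            by (rule exI[of _ "- closure R2"]) (use * closure_subset[of R2] RO in \<open>auto simp: \<kappa>_def\<close>)
          then show ?thesis ..
        qed
      qed
      then obtain c where "(\<kappa> \<longlongrightarrow> c) (at q within O')" using tendsto_eventually by blast
      from tendsto_mult[OF this lim_rest] show ?thesis
        unfolding h_def using False by auto
    qed
    with clO show ?thesis by simp
  qed
  show False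
  proof (rule no_extendable_sqrt_odd_power[OF r oddJ, of O' h u])
    show "O' \<subseteq> ?B" by (auto simp: O'_def)
    show "?B \<subseteq> closure O'" using local closure_subset[of O'] by blast
    have "O' \<subseteq> - path_image (\<gamma> j)" if "j \<in> J" for j using I that by (auto simp: O'_def)
    then show "continuous_on O' h"
      unfolding h_def using I by (intro continuous_intros cont\<kappa>) (blast intro: continuous_on_subset[OF s(1)])
    show "(h z)\<^sup>2 = z ^ card J * (u z)\<^sup>2" if "z \<in> O'" for z
    proof -
      have "(\<Prod>i\<in>J. s i z)\<^sup>2 = (\<Prod>i\<in>J. z * (1 / (z - \<gamma> i 1)))"
        unfolding prod_power_distrib using s(2) I that by (intro prod.cong) (auto simp: O'_def)
      also have "\<dots> = z ^ card J * (u z)\<^sup>2"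
        using u(2)[of z] that by (simp add: prod.distrib O'_def del: times_divide_eq_right)
      finally show ?thesis by (simp add: h_def power_mult_distrib \<kappa>_def)
    qed
    show "u z \<noteq> 0" if "z \<in> ball 0 r" for z using u(2)[OF that] knz[OF that] by auto
    show "\<exists>l. (h \<longlongrightarrow> l) (at q within O')" if "q \<in> ball 0 r - {0} - O'" for q using local[OF that] by simp
  qed (use u in auto)
qed

section \<open>Charts and connected components\<close>

definition chart :: "'p topology \<Rightarrow> 'p set \<Rightarrow> ('p \<Rightarrow> complex) \<Rightarrow> (complex \<Rightarrow> 'p) \<Rightarrow> bool" where
  "chart X D \<phi> \<psi> \<longleftrightarrow> D \<subseteq> topspace X \<and> homeomorphic_maps (subtopology X D) euclidean \<phi> \<psi>"

lemma chart_inverse: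
  assumes "chart X D \<phi> \<psi>"
  shows "\<psi> z \<in> D" "\<phi> (\<psi> z) = z" "x \<in> D \<Longrightarrow> \<psi> (\<phi> x) = x"
proof -
  have top: "topspace (subtopology X D) = D" using assms by (auto simp: chart_def)
  have h: "continuous_map euclidean (subtopology X D) \<psi>" "\<forall>x\<in>D. \<psi> (\<phi> x) = x" "\<forall>z. \<phi> (\<psi> z) = z"
    using assms top unfolding chart_def homeomorphic_maps_def by auto
  show "\<psi> z \<in> D" using continuous_map_funspace[OF h(1)] top by auto
  show "\<phi> (\<psi> z) = z" "x \<in> D \<Longrightarrow> \<psi> (\<phi> x) = x" using h by auto
qed

lemma chart_continuous:
  assumes "chart X D \<phi> \<psi>"
  shows "continuous_map euclidean X \<psi>" "continuous_map (subtopology X D) euclidean \<phi>"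
  using assms by (auto simp: chart_def homeomorphic_maps_def continuous_map_in_subtopology)

lemma chart_open_vimage:
  assumes "chart X D \<phi> \<psi>" "openin X U"
  shows "open (\<psi> -` U)"
  using openin_continuous_map_preimage[OF chart_continuous(1)[OF assms(1)] assms(2)]
  by (simp add: vimage_def)

lemma chart_open_image:
  assumes ch: "chart X D \<phi> \<psi>" and D': "openin X D'" "D' \<subseteq> D" and "open B" "\<psi> ` B \<subseteq> D'"
  shows "openin X (\<psi> ` B)"
proof -
  have "openin (subtopology X D') {x \<in> topspace (subtopology X D'). \<phi> x \<in> B}"
    using \<open>open B\<close> D' chart_continuous(2)[OF ch]
    by (intro openin_continuous_map_preimage[of _ euclidean])
       (auto intro: continuous_map_from_subtopology_mono)
  moreover have "{x \<in> topspace (subtopology X D'). \<phi> x \<in> B} = \<psi> ` B"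
  proof -
    have "D' \<subseteq> topspace X" using D' by (simp add: openin_subset)
    then have "{x \<in> topspace (subtopology X D'). \<phi> x \<in> B} = {x \<in> D'. \<phi> x \<in> B}" by auto
    also have "\<dots> = \<psi> ` B"
    proof (intro equalityI subsetI)
      fix x assume "x \<in> {x \<in> D'. \<phi> x \<in> B}"
      then have "x = \<psi> (\<phi> x)" "\<phi> x \<in> B" using chart_inverse(3)[OF ch, of x] D' by auto
      then show "x \<in> \<psi> ` B" by blast
    next
      fix x assume "x \<in> \<psi> ` B"
      then show "x \<in> {x \<in> D'. \<phi> x \<in> B}" using assms(5) chart_inverse(2)[OF ch] by auto
    qed
    finally show ?thesis .
  qed
  ultimately show ?thesis using D'(1) openin_trans_full by auto
qed

lemma chart_connected_image:
  assumes "chart X D \<phi> \<psi>" "connected C"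
  shows "connectedin X (\<psi> ` C)"
  using connectedin_continuous_map_image[OF chart_continuous(1)[OF assms(1)], of C] assms(2) by simp

text \<open>\<open>R\<close> and its complement in \<open>N\<close> are both open, so a connected
  subset of \<open>N\<close> that contains \<open>R\<close> cannot go beyond it.\<close>

lemma connected_componentsI:
  assumes "N \<subseteq> topspace X" "openin X R" "openin X (N - R)" "connectedin X R" "R \<noteq> {}" "R \<subseteq> N"
  shows "R \<in> connected_components_of (subtopology X N)"
proof -
  have "connectedin (subtopology X N) R" using assms by (simp add: connectedin_subtopology)
  moreover have "subtopology X N \<noteq> trivial_topology" using assms by (auto simp: subtopology_eq_discrete_topology_empty)
  ultimately obtain C where C: "C \<in> connected_components_of (subtopology X N)" "R \<subseteq> C"
    using exists_connected_component_of_superset by blast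
  have "connectedin X C" "C \<subseteq> N"
    using connectedin_connected_components_of[OF C(1)] by (auto simp: connectedin_subtopology)
  then have "(N - R) \<inter> C = {}"
  proof (rule_tac ccontr)
    assume "(N - R) \<inter> C \<noteq> {}"
    then show False
      using connectedinD[OF \<open>connectedin X C\<close> assms(2,3)] \<open>C \<subseteq> N\<close> assms(5) C(2) by blast
  qed
  then have "C = R" using \<open>C \<subseteq> N\<close> C(2) by auto
  then show ?thesis using C by simp
qed

lemma connected_components_of_subtopologyD:
  assumes "R \<in> connected_components_of (subtopology X N)"
  shows "R \<noteq> {}" "R \<subseteq> N" "connectedin X R" "R \<subseteq> topspace X"
proof -
  show "R \<noteq> {}" using assms by (rule nonempty_connected_components_of)
  have "connectedin (subtopology X N) R" using assms by (rule connectedin_connected_components_of)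
  then show "R \<subseteq> N" "connectedin X R" by (auto simp: connectedin_subtopology)
  then show "R \<subseteq> topspace X" by (simp add: connectedin_subset_topspace)
qed

lemma connected_components_of_subtopology_maximal:
  assumes "R \<in> connected_components_of (subtopology X N)" "connectedin X C" "C \<subseteq> N" "R \<inter> C \<noteq> {}"
  shows "C \<subseteq> R"
  using connected_components_of_maximal[OF assms(1), of C] assms by (auto simp: connectedin_subtopology disjnt_def)

lemma connected_components_of_subtopology_eq:
  assumes "R \<in> connected_components_of (subtopology X N)" "R' \<in> connected_components_of (subtopology X N)"
    "R \<inter> R' \<noteq> {}"
  shows "R = R'"
  using pairwise_disjoint_connected_components_of[of "subtopology X N"] assms
  by (auto simp: pairwise_def disjnt_def)

lemma connected_subset_component:
  assumes "connectedin X C" "C \<subseteq> N" "C \<noteq> {}"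
  obtains R where "R \<in> connected_components_of (subtopology X N)" "C \<subseteq> R"
proof -
  have "connectedin (subtopology X N) C" using assms by (simp add: connectedin_subtopology)
  moreover have "C \<subseteq> topspace X" using assms by (simp add: connectedin_subset_topspace)
  then have "subtopology X N \<noteq> trivial_topology" using assms by (auto simp: subtopology_eq_discrete_topology_empty)
  ultimately show ?thesis
    using exists_connected_component_of_superset[of "subtopology X N" C] that by blast
qed

lemma chart_translate:
  assumes ch: "chart X D \<phi> \<psi>"
  shows "chart X D (\<lambda>x. \<phi> x - c) (\<lambda>z. \<psi> (z + c))"
proof -
  have "continuous_map (subtopology X D) euclidean (\<lambda>x. \<phi> x - c)"
    using chart_continuous(2)[OF ch] by (intro continuous_intros)
  moreover have "continuous_map euclidean (subtopology X D) (\<lambda>z. \<psi> (z + c))"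
  proof -
    have "continuous_map euclidean euclidean (\<lambda>z. z + c)" by (auto intro!: continuous_intros)
    moreover have "continuous_map euclidean (subtopology X D) \<psi>"
      using ch by (auto simp: chart_def homeomorphic_maps_def)
    ultimately have "continuous_map euclidean (subtopology X D) (\<psi> \<circ> (\<lambda>z. z + c))"
      by (rule continuous_map_compose)
    then show ?thesis by (simp add: o_def)
  qed
  ultimately show ?thesis
    using ch chart_inverse[OF ch] unfolding chart_def homeomorphic_maps_def by auto
qed

text \<open>This direction needs images of open sets to be open, hence \<open>D'\<close>; the
  converse, \<open>chart_closure_image\<close>, rests on the continuity of
  \<open>\<psi>\<close>.\<close>

lemma chart_closure_vimage:
  assumes ch: "chart X D \<phi> \<psi>" and "openin X D'" "D' \<subseteq> D" and "open B" "\<psi> ` B \<subseteq> D'"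
    and "p \<in> B" "\<psi> p \<in> X closure_of H"
  shows "p \<in> closure (B \<inter> \<psi> -` H)"
proof (rule ccontr)
  assume "p \<notin> closure (B \<inter> \<psi> -` H)"
  define O' where "O' = B - closure (B \<inter> \<psi> -` H)"
  have "open O'" "p \<in> O'" using \<open>p \<notin> _\<close> assms by (auto simp: O'_def open_Diff)
  have "openin X (\<psi> ` O')"
    by (rule chart_open_image[OF ch assms(2,3) \<open>open O'\<close>]) (use assms in \<open>auto simp: O'_def\<close>)
  then obtain y where "y \<in> H" "y \<in> \<psi> ` O'"
    using assms(7) \<open>p \<in> O'\<close> unfolding in_closure_of by blast
  then obtain z where "z \<in> O'" "\<psi> z \<in> H" by auto
  then have "z \<in> B \<inter> \<psi> -` H" by (auto simp: O'_def)
  from subsetD[OF closure_subset this] show False using \<open>z \<in> O'\<close> unfolding O'_def by blast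
qed

lemma chart_closure_image:
  assumes ch: "chart X D \<phi> \<psi>" and p: "p \<in> closure (B \<inter> \<psi> -` H)"
  shows "\<psi> p \<in> X closure_of H"
  unfolding in_closure_of
proof (intro conjI allI impI)
  show "\<psi> p \<in> topspace X" using chart_inverse(1)[OF ch] ch by (auto simp: chart_def)
  fix T assume "\<psi> p \<in> T \<and> openin X T"
  then have "open (\<psi> -` T)" "p \<in> \<psi> -` T" using chart_open_vimage[OF ch] by auto
  then have "\<psi> -` T \<inter> (B \<inter> \<psi> -` H) \<noteq> {}" using p open_Int_closure_eq_empty by blast
  then show "\<exists>y. y \<in> H \<and> y \<in> T" by blast
qed

section \<open>Equivalence classes and integer powers\<close>

lemma rtrancl_sym_image_eq:
  "(b \<union> b\<inverse>)\<^sup>* `` {x} = (b \<union> b\<inverse>)\<^sup>* `` {y} \<longleftrightarrow> (x, y) \<in> (b \<union> b\<inverse>)\<^sup>*"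
proof -
  have "equiv UNIV ((b \<union> b\<inverse>)\<^sup>*)"
    by (rule equivI) (auto intro: refl_rtrancl trans_rtrancl sym_rtrancl sym_Un_converse)
  from equiv_class_eq_iff[OF this, of x y] show ?thesis by simp
qed

text \<open>The new pair merges exactly the two classes of \<open>u\<close> and \<open>v\<close>,
  and \<open>?C\<close> is their union. The relations live on the whole type, while the quotient
  takes only the classes of points of \<open>V\<close>.\<close>

lemma card_quotient_insert_pair:
  assumes V: "finite V" "u \<in> V" "v \<in> V" and r: "r = (b \<union> b\<inverse>)\<^sup>*" and new: "(u, v) \<notin> r"
    and r': "r' = (insert (u, v) b \<union> (insert (u, v) b)\<inverse>)\<^sup>*"
  shows "card (V // r) = Suc (card (V // r'))"
proof -
  have eq: "refl r" "sym r" "trans r"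
    unfolding r by (auto intro: refl_rtrancl trans_rtrancl sym_rtrancl sym_Un_converse)
  have sub: "b \<union> b\<inverse> \<subseteq> r" unfolding r by auto
  let ?C = "r `` {u} \<union> r `` {v}"
  have tr: "(x, z) \<in> r" if "(x, y) \<in> r" "(y, z) \<in> r" for x y z using eq(3) that by (auto dest: transD)
  have sy: "(y, x) \<in> r" if "(x, y) \<in> r" for x y using eq(2) that by (auto dest: symD)
  have rf: "(x, x) \<in> r" for x using eq(1) by (auto dest: refl_onD)
  have r'_eq: "r' = r \<union> ?C \<times> ?C"
  proof (intro equalityI subrelI)
    fix x y assume "(x, y) \<in> r'"
    then show "(x, y) \<in> r \<union> ?C \<times> ?C" unfolding r'
    proof (induction rule: rtrancl_induct)
      case base
      show ?case using rf by simp
    next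
      case (step y z)
      have "(y, z) \<in> r \<union> {(u, v), (v, u)}" using step.hyps(2) sub by auto
      moreover have "u \<in> ?C" "v \<in> ?C" using rf by auto
      ultimately have "(y, z) \<in> r \<or> (y \<in> ?C \<and> z \<in> ?C)" by auto
      then show ?case
      proof
        assume yz: "(y, z) \<in> r"
        from step.IH show ?case
        proof
          assume "(x, y) \<in> r"
          then show ?case using tr yz by blast
        next
          assume "(x, y) \<in> ?C \<times> ?C"
          then show ?case using tr yz by blast
        qed
      next
        assume yz: "y \<in> ?C \<and> z \<in> ?C"
        then have "x \<in> ?C" using step.IH sy tr by blast
        then show ?case using yz by blast
      qed
    qed
  next
    fix x y assume "(x, y) \<in> r \<union> ?C \<times> ?C"
    have mono: "r \<subseteq> r'" unfolding r r' by (intro rtrancl_mono) auto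
    have uv: "(u, v) \<in> r'" "(v, u) \<in> r'" unfolding r' by (auto intro: r_into_rtrancl)
    have trans': "(x, z) \<in> r'" if "(x, y) \<in> r'" "(y, z) \<in> r'" for x y z
      using that unfolding r' by (rule rtrancl_trans)
    have fromC: "(u, y) \<in> r'" "(y, u) \<in> r'" if y: "y \<in> ?C" for y
    proof -
      have "(u, y) \<in> r \<or> (v, y) \<in> r" using y by auto
      then show "(u, y) \<in> r'" using mono uv trans' by blast
      have "(y, u) \<in> r \<or> (y, v) \<in> r" using y sy by auto
      then show "(y, u) \<in> r'" using mono uv trans' by blast
    qed
    show "(x, y) \<in> r'" using \<open>(x, y) \<in> r \<union> ?C \<times> ?C\<close>
    proof
      assume "(x, y) \<in> r"
      then show ?thesis using mono by blast
    next
      assume "(x, y) \<in> ?C \<times> ?C"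
      then have "x \<in> ?C" "y \<in> ?C" by auto
      then show ?thesis using trans'[OF fromC(2) fromC(1)] by simp
    qed
  qed
  have cls: "r' `` {x} = (if x \<in> ?C then ?C else r `` {x})" for x
  proof (cases "x \<in> ?C")
    case True
    then have "r `` {x} \<subseteq> ?C" using tr by blast
    then show ?thesis using True unfolding r'_eq by auto
  qed (auto simp: r'_eq)
  have inC: "x \<in> ?C \<longleftrightarrow> r `` {x} \<in> {r `` {u}, r `` {v}}" for x
  proof
    assume "x \<in> ?C"
    then have "r `` {x} = r `` {u} \<or> r `` {x} = r `` {v}" using tr sy by blast
    then show "r `` {x} \<in> {r `` {u}, r `` {v}}" by simp
  next
    assume "r `` {x} \<in> {r `` {u}, r `` {v}}"
    moreover have "x \<in> r `` {x}" using rf by simp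
    ultimately show "x \<in> ?C" by auto
  qed
  have ne: "r `` {u} \<noteq> r `` {v}" using new rf by blast
  have Q: "V // r' = insert ?C (V // r - {r `` {u}, r `` {v}})"
  proof -
    have "V // r' = (\<lambda>x. if x \<in> ?C then ?C else r `` {x}) ` V" unfolding quotient_def cls by blast
    also have "\<dots> = insert ?C ((\<lambda>x. r `` {x}) ` {x \<in> V. x \<notin> ?C})" using V(2) rf[of u] by auto
    also have "(\<lambda>x. r `` {x}) ` {x \<in> V. x \<notin> ?C} = V // r - {r `` {u}, r `` {v}}"
      unfolding quotient_def using inC by blast
    finally show ?thesis .
  qed
  have nC: "?C \<notin> V // r"
  proof
    assume "?C \<in> V // r"
    then obtain x where x: "?C = r `` {x}" by (auto simp: quotient_def)
    then have "(x, u) \<in> r" "(x, v) \<in> r" using rf by blast+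
    then show False using new tr sy by blast
  qed
  have fin: "finite (V // r)" unfolding quotient_def using V(1) by auto
  have pair: "{r `` {u}, r `` {v}} \<subseteq> V // r" using V(2,3) by (auto simp: quotient_def)
  have "card {r `` {u}, r `` {v}} = 2" using ne by simp
  moreover have "card {r `` {u}, r `` {v}} \<le> card (V // r)" using fin pair by (rule card_mono)
  moreover have "card (V // r - {r `` {u}, r `` {v}}) = card (V // r) - card {r `` {u}, r `` {v}}"
    using pair by (intro card_Diff_subset) auto
  ultimately show ?thesis unfolding Q using nC fin by (subst card_insert_disjoint) auto
qed

text \<open>Allows quotients at different types to be compared; the bijection goes through a chosen
  preimage.\<close>

lemma card_image_cong_kernel:
  assumes "\<And>x y. x \<in> S \<Longrightarrow> y \<in> S \<Longrightarrow> f x = f y \<longleftrightarrow> g x = g y"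
  shows "card (f ` S) = card (g ` S)"
proof (rule bij_betw_same_card[of "\<lambda>y. g (inv_into S f y)"])
  have inv: "inv_into S f (f x) \<in> S" "f (inv_into S f (f x)) = f x" if "x \<in> S" for x
    using that by (auto simp: f_inv_into_f inv_into_into)
  then have gi: "g (inv_into S f (f x)) = g x" if "x \<in> S" for x using assms that by blast
  show "bij_betw (\<lambda>y. g (inv_into S f y)) (f ` S) (g ` S)"
    unfolding bij_betw_def
  proof
    show "inj_on (\<lambda>y. g (inv_into S f y)) (f ` S)"
      by (rule inj_onI) (use gi assms in \<open>elim imageE; simp\<close>)
    have "(\<lambda>y. g (inv_into S f y)) ` f ` S = (\<lambda>x. g x) ` S"
      unfolding image_image using gi by (intro image_cong) auto
    then show "(\<lambda>y. g (inv_into S f y)) ` f ` S = g ` S" by simp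
  qed
qed

text \<open>Nonnegativity matters at \<open>w = 0\<close>: for \<open>n = -1\<close> the left side
  would be 1 and the right side 0.\<close>

lemma power_int_nonneg_Suc: "0 \<le> n \<Longrightarrow> w powi (n + 1) = w * w powi n" for w :: "'k::field"
  by (rule power_int_add_1') auto

section \<open>Regions of a drawn graph\<close>

locale drawn_graph =
  fixes G :: "('p, 'e) drawing"
  assumes graph: "graph_in_pseudo_surface G"
begin

abbreviation "X \<equiv> space_of G"
abbreviation "V \<equiv> vertices G"
abbreviation "E \<equiv> edges G"

definition off :: "'e set \<Rightarrow> 'p set" where
  "off A = topspace X - (V \<union> (\<Union>e\<in>A. edge_points G e))"

abbreviation comps :: "'p set \<Rightarrow> 'p set set" where
  "comps N \<equiv> connected_components_of (subtopology X N)"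

definition open_edge :: "'e \<Rightarrow> 'p set" where
  "open_edge e = curve G e ` {0<..<1}"

lemma complement_components_eq: "complement_components G A = comps (off A)"
  by (simp add: complement_components_def off_def)

lemma compact: "compact_space X" and Hausdorff: "Hausdorff_space X"
  and finite_V: "finite V" and finite_E: "finite E" and V_sub: "V \<subseteq> topspace X"
  using graph by (auto simp: graph_in_pseudo_surface_def pseudo_surface_def)

lemma path_curve: "e \<in> E \<Longrightarrow> continuous_map (top_of_set {0..1}) X (curve G e)"
  using graph by (auto simp: graph_in_pseudo_surface_def pathin_def)

lemma curve_eqD:
  "e \<in> E \<Longrightarrow> s \<in> {0..1} \<Longrightarrow> t \<in> {0..1} \<Longrightarrow> curve G e s = curve G e t \<Longrightarrow> s = t \<or> {s, t} = {0, 1}"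
  using graph unfolding graph_in_pseudo_surface_def by blast

lemma curve_in_V: "e \<in> E \<Longrightarrow> t \<in> {0..1} \<Longrightarrow> curve G e t \<in> V \<longleftrightarrow> t = 0 \<or> t = 1"
  using graph unfolding graph_in_pseudo_surface_def by blast

lemma edges_meet: "e \<in> E \<Longrightarrow> f \<in> E \<Longrightarrow> e \<noteq> f \<Longrightarrow> edge_points G e \<inter> edge_points G f \<subseteq> V"
  using graph unfolding graph_in_pseudo_surface_def by blast

lemma curve_in_topspace: "e \<in> E \<Longrightarrow> t \<in> {0..1} \<Longrightarrow> curve G e t \<in> topspace X"
  using continuous_map_funspace[OF path_curve, of e] by auto

lemma closed_curve_image:
  assumes "e \<in> E" "closed S" "S \<subseteq> {0..1}"
  shows "closedin X (curve G e ` S)"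
proof (rule compactin_imp_closedin[OF Hausdorff])
  have "compact S" using assms(2,3) by (meson bounded_closed_interval bounded_subset compact_eq_bounded_closed)
  then show "compactin X (curve G e ` S)"
    using assms by (intro image_compactin[OF _ path_curve]) (auto simp: compactin_subtopology)
qed

lemma closed_edge: "e \<in> E \<Longrightarrow> closedin X (edge_points G e)"
  unfolding edge_points_def by (rule closed_curve_image) auto

lemma closed_V: "closedin X V"
  using closedin_Hausdorff_finite[OF Hausdorff V_sub finite_V] .

lemma open_off: "A \<subseteq> E \<Longrightarrow> openin X (off A)"
  unfolding off_def using finite_subset[OF _ finite_E] closed_edge
  by (intro openin_diff openin_topspace closedin_Un closed_V closedin_Union) auto

lemma off_sub: "off A \<subseteq> topspace X" "off A \<inter> V = {}"
  by (auto simp: off_def)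

lemma edge_points_eq: "edge_points G e = open_edge e \<union> {curve G e 0, curve G e 1}"
proof -
  have "{0..1} = {0<..<1} \<union> {0, 1::real}" by auto
  then show ?thesis unfolding edge_points_def open_edge_def by (simp only: image_Un) auto
qed

lemma open_edge_V: "e \<in> E \<Longrightarrow> open_edge e \<inter> V = {}"
  using curve_in_V by (force simp: open_edge_def)

lemma ends_V: "e \<in> E \<Longrightarrow> curve G e 0 \<in> V" "e \<in> E \<Longrightarrow> curve G e 1 \<in> V"
  using curve_in_V[of e 0] curve_in_V[of e 1] by auto

lemma edge_points_V: "e \<in> E \<Longrightarrow> edge_points G e - V = open_edge e"
  using open_edge_V ends_V by (auto simp: edge_points_eq)

lemma open_edge_in_topspace: "e \<in> E \<Longrightarrow> open_edge e \<subseteq> topspace X"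
  using curve_in_topspace by (force simp: open_edge_def)

lemma off_insert: "e \<in> E \<Longrightarrow> off (insert e A) = off A - open_edge e"
  using edge_points_V[of e] by (auto simp: off_def)

lemma open_edge_off:
  assumes "e \<in> E" "A \<subseteq> E" "e \<notin> A"
  shows "open_edge e \<subseteq> off A"
proof
  fix x assume x: "x \<in> open_edge e"
  then have "x \<notin> V" "x \<in> edge_points G e" using open_edge_V[OF assms(1)] by (auto simp: edge_points_eq)
  then show "x \<in> off A"
    using x assms edges_meet[OF assms(1)] open_edge_in_topspace[OF assms(1)] by (fastforce simp: off_def)
qed

section \<open>Charts and components of the surface off the vertices\<close>

lemma discs: "x \<in> topspace X \<Longrightarrow> \<exists>k\<ge>1. discs_at X k x"
  using graph by (auto simp: graph_in_pseudo_surface_def pseudo_surface_def)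

text \<open>The union of the other sheets is closed in the neighbourhood and meets \<open>D\<close>
  at most in \<open>x\<close>; removing it and \<open>x\<close> from the neighbourhood leaves
  \<open>D - {x}\<close>.\<close>

lemma sheet_chart:
  assumes "finite \<D>" "openin X (\<Union>\<D>)" and D: "D \<in> \<D>" "x \<in> D"
    and cl: "\<forall>D\<in>\<D>. x \<in> D \<and> closedin (subtopology X (\<Union>\<D>)) D \<and>
                 subtopology X D homeomorphic_space (euclidean :: complex topology)"
    and meet: "\<forall>D\<in>\<D>. \<forall>D'\<in>\<D>. D \<noteq> D' \<longrightarrow> D \<inter> D' = {x}"
  shows "openin X (D - {x})" "\<exists>\<phi> \<psi>. chart X D \<phi> \<psi>"
proof -
  have sub: "\<Union>\<D> \<subseteq> topspace X" using assms by (simp add: openin_subset)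
  show "\<exists>\<phi> \<psi>. chart X D \<phi> \<psi>"
    using cl D sub by (auto simp: chart_def homeomorphic_space_def)
  have "closedin (subtopology X (\<Union>\<D>)) (\<Union>(\<D> - {D}))"
    using assms by (intro closedin_Union) auto
  then have "openin (subtopology X (\<Union>\<D>)) (topspace (subtopology X (\<Union>\<D>)) - \<Union>(\<D> - {D}))"
    by blast
  moreover have "topspace (subtopology X (\<Union>\<D>)) = \<Union>\<D>" using sub by auto
  ultimately have op: "openin X (\<Union>\<D> - \<Union>(\<D> - {D}))"
    using openin_trans_full assms(2) by auto
  have "openin X ((\<Union>\<D> - \<Union>(\<D> - {D})) - {x})"
    by (rule open_in_Hausdorff_delete[OF Hausdorff op])
  moreover have "(\<Union>\<D> - \<Union>(\<D> - {D})) - {x} = D - {x}" using D meet by blast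
  ultimately show "openin X (D - {x})" by simp
qed

text \<open>A point off the vertices is no pinch point, so its neighbourhood is a single sheet, and
  this sheet is open.\<close>

lemma surface_chart:
  assumes "x \<in> topspace X - V"
  obtains D \<phi> \<psi> where "openin X D" "x \<in> D" "chart X D \<phi> \<psi>"
proof -
  obtain k where k: "k \<ge> 1" "discs_at X k x" using assms discs by auto
  have "x \<notin> pinch_points X" using assms graph by (auto simp: graph_in_pseudo_surface_def)
  then have "k = 1" using k assms unfolding pinch_points_def by (cases "k = 1") (auto dest!: spec[of _ k])
  then obtain \<D> where D: "finite \<D>" "card \<D> = 1" "openin X (\<Union>\<D>)"
      "\<forall>D\<in>\<D>. x \<in> D \<and> closedin (subtopology X (\<Union>\<D>)) D \<and>
                 subtopology X D homeomorphic_space (euclidean :: complex topology)"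
      "\<forall>D\<in>\<D>. \<forall>D'\<in>\<D>. D \<noteq> D' \<longrightarrow> D \<inter> D' = {x}"
    using k(2) unfolding discs_at_def by blast
  then obtain D where DD: "\<D> = {D}" by (auto simp: card_1_singleton_iff)
  obtain \<phi> \<psi> where "chart X D \<phi> \<psi>" using sheet_chart(2)[OF D(1,3) _ _ D(4,5), of D] D(4) DD by auto
  then show thesis using D DD by (intro that) auto
qed

text \<open>Small discs of a chart are connected, so the surface is locally connected off the
  vertices.\<close>

lemma open_component:
  assumes N: "openin X N" "N \<inter> V = {}" and R: "R \<in> comps N"
  shows "openin X R"
proof (subst openin_subopen, intro ballI)
  fix x assume x: "x \<in> R"
  have xN: "x \<in> N" "x \<in> topspace X - V"
    using connected_components_of_subtopologyD[OF R] x N by auto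
  obtain D \<phi> \<psi> where D: "openin X D" "x \<in> D" "chart X D \<phi> \<psi>" using surface_chart[OF xN(2)] by blast
  have "open (\<psi> -` N)" using chart_open_vimage[OF D(3) N(1)] .
  moreover have "\<phi> x \<in> \<psi> -` N" using chart_inverse(3)[OF D(3,2)] xN by simp
  ultimately obtain e where e: "0 < e" "ball (\<phi> x) e \<subseteq> \<psi> -` N" using open_contains_ball by blast
  let ?C = "\<psi> ` ball (\<phi> x) e"
  have "openin X ?C"
    by (rule chart_open_image[OF D(3,1)]) (use chart_inverse(1)[OF D(3)] in auto)
  moreover have "\<psi> (\<phi> x) \<in> ?C" using e by (intro imageI) simp
  then have xC: "x \<in> ?C" using chart_inverse(3)[OF D(3,2)] by simp
  moreover have "?C \<subseteq> R"
    by (rule connected_components_of_subtopology_maximal[OF R])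
       (use e x xC chart_connected_image[OF D(3)] in auto)
  ultimately show "\<exists>T. openin X T \<and> x \<in> T \<and> T \<subseteq> R" by blast
qed

lemma Union_comps: "N \<subseteq> topspace X \<Longrightarrow> \<Union>(comps N) = N"
  by (simp add: Union_connected_components_of inf_absorb2)

lemma open_component_complement:
  assumes N: "openin X N" "N \<inter> V = {}" and R: "R \<in> comps N"
  shows "openin X (N - R)"
proof -
  have "N - R = \<Union>(comps N - {R})"
    using complement_connected_components_of_Union[OF R] N by (simp add: openin_subset inf_absorb2)
  then show ?thesis using open_component[OF N] by auto
qed

text \<open>Each point has a neighbourhood that falls, after removal of \<open>V\<close>, into
  finitely many connected pieces, one per sheet, and compactness leaves finitely many pieces in all.
  Finiteness is what makes \<open>card\<close> count regions.\<close>

lemma finite_comps_off_empty: "finite (comps (off {}))"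
proof -
  have cover: "\<exists>U \<K>. openin X U \<and> x \<in> U \<and> finite \<K> \<and> (\<forall>K\<in>\<K>. connectedin X K) \<and> U - V = \<Union>\<K>"
    if "x \<in> topspace X" for x
  proof -
    obtain k where k: "discs_at X k x" using \<open>x \<in> topspace X\<close> discs by auto
    then obtain \<D> where D: "finite \<D>" "openin X (\<Union>\<D>)" "x \<in> \<Union>\<D>"
      "\<forall>D\<in>\<D>. x \<in> D \<and> closedin (subtopology X (\<Union>\<D>)) D \<and>
                 subtopology X D homeomorphic_space (euclidean :: complex topology)"
      "\<forall>D\<in>\<D>. \<forall>D'\<in>\<D>. D \<noteq> D' \<longrightarrow> D \<inter> D' = {x}"
      unfolding discs_at_def by blast
    have "connectedin X (D - V)" if DD: "D \<in> \<D>" for D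
    proof -
      obtain \<phi> \<psi> where c: "chart X D \<phi> \<psi>"
        using sheet_chart(2)[OF D(1,2) DD _ D(4,5)] D(4) DD by auto
      \<comment> \<open>The plane minus a countable set is path-connected.\<close>
      have "countable (\<phi> ` (V \<inter> D))" using finite_V by (intro countable_finite) auto
      then have "connected (UNIV - \<phi> ` (V \<inter> D))"
        by (intro path_connected_imp_connected path_connected_convex_diff_countable)
           (auto simp: collinear_aff_dim aff_dim_UNIV)
      from chart_connected_image[OF c this]
      have "connectedin X (\<psi> ` (UNIV - \<phi> ` (V \<inter> D)))" .
      moreover have "\<psi> ` (UNIV - \<phi> ` (V \<inter> D)) = D - V"
      proof (intro equalityI subsetI)
        fix y assume "y \<in> \<psi> ` (UNIV - \<phi> ` (V \<inter> D))"
        then obtain z where z: "y = \<psi> z" "z \<notin> \<phi> ` (V \<inter> D)" by auto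
        then have "\<psi> z \<notin> V" using chart_inverse(1,2)[OF c, of z] by (metis IntI imageI)
        then show "y \<in> D - V" using chart_inverse(1)[OF c, of z] z by auto
      next
        fix y assume y: "y \<in> D - V"
        have "\<phi> y \<notin> \<phi> ` (V \<inter> D)"
        proof
          assume "\<phi> y \<in> \<phi> ` (V \<inter> D)"
          then obtain w where "w \<in> V \<inter> D" "\<phi> y = \<phi> w" by auto
          then have "y = w" using chart_inverse(3)[OF c, of y] chart_inverse(3)[OF c, of w] y by auto
          with y \<open>w \<in> V \<inter> D\<close> show False by auto
        qed
        then have "\<psi> (\<phi> y) \<in> \<psi> ` (UNIV - \<phi> ` (V \<inter> D))" by blast
        then show "y \<in> \<psi> ` (UNIV - \<phi> ` (V \<inter> D))" using chart_inverse(3)[OF c, of y] y by simp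
      qed
      ultimately show ?thesis by simp
    qed
    then show ?thesis
      using D by (intro exI[of _ "\<Union>\<D>"] exI[of _ "(\<lambda>D. D - V) ` \<D>"]) auto
  qed
  define \<U> where "\<U> = {U. openin X U \<and> (\<exists>\<K>. finite \<K> \<and> (\<forall>K\<in>\<K>. connectedin X K) \<and> U - V = \<Union>\<K>)}"
  have "(\<forall>U\<in>\<U>. openin X U) \<and> topspace X \<subseteq> \<Union>\<U>" using cover by (fastforce simp: \<U>_def)
  then obtain \<F> where F: "finite \<F>" "\<F> \<subseteq> \<U>" "topspace X \<subseteq> \<Union>\<F>"
    using compact unfolding compact_space_alt by meson
  have "\<forall>U\<in>\<F>. \<exists>\<K>. finite \<K> \<and> (\<forall>K\<in>\<K>. connectedin X K) \<and> U - V = \<Union>\<K>"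
    using F(2) by (auto simp: \<U>_def)
  then obtain \<K> where K: "\<And>U. U \<in> \<F> \<Longrightarrow> finite (\<K> U)" "\<And>U K. U \<in> \<F> \<Longrightarrow> K \<in> \<K> U \<Longrightarrow> connectedin X K"
     "\<And>U. U \<in> \<F> \<Longrightarrow> U - V = \<Union>(\<K> U)"
    by metis
  define S where "S = (\<Union>U\<in>\<F>. \<K> U)"
  have "finite S" using F K by (auto simp: S_def)
  have S: "connectedin X K" "K \<subseteq> off {}" if KS: "K \<in> S" for K
  proof -
    obtain U where U: "U \<in> \<F>" "K \<in> \<K> U" using KS by (auto simp: S_def)
    show "connectedin X K" using K(2)[OF U] .
    then have "K \<subseteq> topspace X" by (rule connectedin_subset_topspace)
    moreover have "K \<inter> V = {}" using K(3)[OF U(1)] U(2) by blast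
    ultimately show "K \<subseteq> off {}" by (auto simp: off_def)
  qed
  have SU: "off {} \<subseteq> \<Union>S"
  proof
    fix x assume x: "x \<in> off {}"
    then obtain U where U: "U \<in> \<F>" "x \<in> U" using F(3) off_sub(1) by blast
    then have "x \<in> \<Union>(\<K> U)" using x K(3)[OF U(1)] off_sub(2) by blast
    then show "x \<in> \<Union>S" using U(1) unfolding S_def by blast
  qed
  have "\<exists>K\<in>S. K \<inter> R \<noteq> {}" if R: "R \<in> comps (off {})" for R
    using connected_components_of_subtopologyD(1,2)[OF R] SU by blast
  \<comment> \<open>A component contains every piece that it meets, so a choice of one piece for
    each component is injective.\<close>
  then obtain h where h: "\<And>R. R \<in> comps (off {}) \<Longrightarrow> h R \<in> S" "\<And>R. R \<in> comps (off {}) \<Longrightarrow> h R \<inter> R \<noteq> {}"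
    by metis
  have "inj_on h (comps (off {}))"
  proof (rule inj_onI)
    fix R R' assume R: "R \<in> comps (off {})" "R' \<in> comps (off {})" "h R = h R'"
    have sub: "h R \<subseteq> R" if "R \<in> comps (off {})" for R
      using connected_components_of_subtopology_maximal[OF that S[OF h(1)[OF that]]] h(2)[OF that] by blast
    show "R = R'"
      using connected_components_of_subtopology_eq[OF R(1,2)] sub[OF R(1)] sub[OF R(2)] h(2)[OF R(1)] R(3) by blast
  qed
  then show ?thesis using h(1) \<open>finite S\<close> by (meson finite_imageD finite_subset image_subsetI)
qed

section \<open>The two sides of an edge and their effect on the number of regions\<close>

lemma edge_two_sides:
  assumes e: "e \<in> E" and t: "0 < t" "t < 1" and U: "openin X U" "curve G e t \<in> U"
  obtains W P Q where "openin X W" "curve G e t \<in> W" "W \<subseteq> U - V" "W - open_edge e = P \<union> Q"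
    "\<And>x y. x \<in> P \<Longrightarrow> y \<in> P \<Longrightarrow> \<exists>C. connectedin X C \<and> C \<subseteq> U - edge_points G e \<and> x \<in> C \<and> y \<in> C"
    "\<And>x y. x \<in> Q \<Longrightarrow> y \<in> Q \<Longrightarrow> \<exists>C. connectedin X C \<and> C \<subseteq> U - edge_points G e \<and> x \<in> C \<and> y \<in> C"
    "W \<inter> open_edge e \<subseteq> X closure_of P" "W \<inter> open_edge e \<subseteq> X closure_of Q"
proof -
  let ?c = "curve G e"
  have p: "?c t \<in> topspace X - V" using curve_in_topspace[OF e, of t] curve_in_V[OF e, of t] t by auto
  obtain D \<phi> \<psi> where D: "openin X D" "?c t \<in> D" and ch: "chart X D \<phi> \<psi>" by (rule surface_chart[OF p])
  define U0 where "U0 = (U \<inter> D) - V"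
  have U0: "openin X U0" "?c t \<in> U0" using U D p closed_V by (auto simp: U0_def openin_diff)
  have "openin (top_of_set {0..1}) {s \<in> topspace (top_of_set {0..1}). ?c s \<in> U0}"
    by (rule openin_continuous_map_preimage[OF path_curve[OF e] U0(1)])
  then obtain T where T: "open T" "{s \<in> {0..1}. ?c s \<in> U0} = {0..1} \<inter> T"
    by (auto simp: openin_open)
  have Tiff: "?c s \<in> U0 \<longleftrightarrow> s \<in> T" if "s \<in> {0..1}" for s using T(2) that by blast
  have "t \<in> T \<inter> {0<..<1}" using Tiff[of t] U0(2) t by auto
  then obtain \<delta> where \<delta>: "0 < \<delta>" "cball t \<delta> \<subseteq> T \<inter> {0<..<1}"
    using open_Int[OF T(1) open_greaterThanLessThan[of 0 1]] unfolding open_contains_cball by meson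
  \<comment> \<open>Only the piece of the edge over \<open>[a, b]\<close> is moved into the plane.
    It lies in the chart, and since \<open>[a, b]\<close> avoids 0 and 1 the curve is injective
    there even for a loop.\<close>
  define a b where "a = t - \<delta>" and "b = t + \<delta>"
  have ab_sub: "{a..b} \<subseteq> T \<inter> {0<..<1}"
    using \<delta>(2) by (simp add: a_def b_def cball_eq_atLeastAtMost)
  have ab: "0 < a" "a < t" "t < b" "b < 1" using \<delta>(1) subsetD[OF ab_sub, of a] subsetD[OF ab_sub, of b] by (auto simp: a_def b_def)
  have abU: "?c s \<in> U0" if "s \<in> {a..b}" for s
    using Tiff[of s] subsetD[OF ab_sub that] by auto
  define l where "l s = a + (b - a) * s" for s
  have l: "l s \<in> {a..b}" if "s \<in> {0..1}" for s
  proof -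
    have "0 \<le> (b - a) * s" "(b - a) * s \<le> (b - a) * 1"
      using that ab by (intro mult_nonneg_nonneg mult_left_mono; simp)+
    then show ?thesis by (simp add: l_def)
  qed
  have l_onto: "\<exists>s'\<in>{0..1}. s = l s'" if "s \<in> {a..b}" for s
    using that ab by (intro bexI[of _ "(s - a) / (b - a)"]) (auto simp: l_def field_simps)
  define g where "g s = \<phi> (?c (l s))" for s
  define t' where "t' = (t - a) / (b - a)"
  have t': "0 < t'" "t' < 1" "l t' = t" using ab by (auto simp: t'_def l_def field_simps)
  have gc: "\<psi> (g s) = ?c (l s)" if "s \<in> {0..1}" for s
    using chart_inverse(3)[OF ch, of "?c (l s)"] abU[OF l[OF that]] by (auto simp: g_def U0_def)
  have inj: "s = s'" if "s \<in> {a..b}" "s' \<in> {0..1}" "?c s = ?c s'" for s s'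
  proof -
    have "s \<in> {0..1}" using that(1) ab by auto
    from curve_eqD[OF e this that(2,3)] show ?thesis using that(1) ab by (auto simp: doubleton_eq_iff)
  qed
  have "arc g"
    unfolding arc_def path_def
  proof
    have "continuous_map (top_of_set {0..1}) (subtopology X D) (?c \<circ> l)"
    proof (subst continuous_map_in_subtopology, intro conjI)
      have "continuous_map (top_of_set {0..1}) (top_of_set {0..1}) l"
        using l ab by (force simp: l_def intro!: continuous_intros)
      then show "continuous_map (top_of_set {0..1}) X (?c \<circ> l)"
        using path_curve[OF e] continuous_map_compose by blast
      show "?c \<circ> l \<in> topspace (top_of_set {0..1}) \<rightarrow> D" using abU l by (auto simp: U0_def)
    qed
    from continuous_map_compose[OF this chart_continuous(2)[OF ch]]
    have "continuous_on {0..1} (\<phi> \<circ> (?c \<circ> l))" by simp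
    then show "continuous_on {0..1} g" by (simp add: g_def[abs_def] o_def)
    show "inj_on g {0..1}"
    proof (rule inj_onI)
      fix s s' assume s: "s \<in> {0..1}" "s' \<in> {0..1}" "g s = g s'"
      then have "?c (l s) = ?c (l s')" using gc[of s] gc[of s'] by simp
      moreover have "l s' \<in> {0..1}" using l[OF s(2)] ab by auto
      ultimately have "l s = l s'" using inj[OF l[OF s(1)]] by blast
      then show "s = s'" using ab by (simp add: l_def)
    qed
  qed
  \<comment> \<open>The rest of the edge may enter the chart again, but it is closed and misses the
    point. Removing it leaves a neighbourhood in which the edge is exactly the image of the arc
    \<open>g\<close>.\<close>
  define K where "K = ?c ` ({0..a} \<union> {b..1})"
  have K: "closedin X K" unfolding K_def by (rule closed_curve_image[OF e]) (use ab in auto)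
  have edge_split: "edge_points G e = K \<union> \<psi> ` path_image g"
  proof -
    have "{0..1} = ({0..a} \<union> {b..1}) \<union> {a..b}" using ab by auto
    then have "edge_points G e = K \<union> ?c ` {a..b}" unfolding edge_points_def K_def by (simp only: image_Un)
    moreover have "?c ` {a..b} = \<psi> ` path_image g"
    proof (intro equalityI subsetI)
      fix x assume "x \<in> ?c ` {a..b}"
      then obtain s where "s \<in> {0..1}" "x = ?c (l s)" using l_onto by blast
      then have "x = \<psi> (g s)" "g s \<in> path_image g" using gc by (auto simp: path_image_def)
      then show "x \<in> \<psi> ` path_image g" by blast
    next
      fix x assume "x \<in> \<psi> ` path_image g"
      then obtain s where "s \<in> {0..1}" "x = \<psi> (g s)" by (auto simp: path_image_def)
      then show "x \<in> ?c ` {a..b}" using gc l by blast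
    qed
    ultimately show ?thesis by simp
  qed
  have tK: "?c t \<notin> K"
  proof
    assume "?c t \<in> K"
    then obtain s where s: "s \<in> {0..a} \<union> {b..1}" "?c t = ?c s" unfolding K_def by blast
    then have "t = s" using inj[of t s] ab by auto
    then show False using s(1) ab by auto
  qed
  have psi_inj: "z = w" if "\<psi> z = \<psi> w" for z w
    using arg_cong[OF that, of \<phi>] by (simp only: chart_inverse(2)[OF ch])
  define U' where "U' = \<psi> -` (U0 - K)"
  have "open U'" unfolding U'_def by (rule chart_open_vimage[OF ch openin_diff[OF U0(1) K]])
  have gt': "\<psi> (g t') = ?c t" using gc[of t'] t' by simp
  then have "g t' \<in> U'" using U0(2) tK by (simp add: U'_def)
  obtain W P Q where W: "open W" "g t' \<in> W" "W \<subseteq> U'" "W - path_image g = P \<union> Q"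
    "\<And>x y. x \<in> P \<Longrightarrow> y \<in> P \<Longrightarrow> connected_component (U' - path_image g) x y"
    "\<And>x y. x \<in> Q \<Longrightarrow> y \<in> Q \<Longrightarrow> connected_component (U' - path_image g) x y"
    "W \<inter> path_image g \<subseteq> closure P" "W \<inter> path_image g \<subseteq> closure Q"
    by (rule arc_two_sides[OF \<open>arc g\<close> t'(1,2) \<open>open U'\<close> \<open>g t' \<in> U'\<close>]) (rule that)
  have on_edge: "\<psi> z \<in> edge_points G e \<longleftrightarrow> z \<in> path_image g" if "z \<in> U'" for z
    using that psi_inj unfolding edge_split U'_def by blast
  have U'D: "\<psi> z \<in> U" "\<psi> z \<notin> V" if "z \<in> U'" for z using that by (auto simp: U'_def U0_def)
  have on_open: "\<psi> z \<in> open_edge e \<longleftrightarrow> z \<in> path_image g" if "z \<in> U'" for z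
    using on_edge[OF that] U'D(2)[OF that] edge_points_V[OF e] by blast
  have conn: "\<exists>C. connectedin X C \<and> C \<subseteq> U - edge_points G e \<and> x \<in> C \<and> y \<in> C"
    if H: "\<And>x y. x \<in> H \<Longrightarrow> y \<in> H \<Longrightarrow> connected_component (U' - path_image g) x y"
      and xy: "x \<in> \<psi> ` H" "y \<in> \<psi> ` H" for H x y
  proof -
    obtain x' y' where x': "x' \<in> H" "x = \<psi> x'" "y' \<in> H" "y = \<psi> y'" using xy by auto
    obtain C where C: "connected C" "C \<subseteq> U' - path_image g" "x' \<in> C" "y' \<in> C"
      using H[OF x'(1,3)] by (auto simp: connected_component_def)
    show ?thesis
    proof (intro exI[of _ "\<psi> ` C"] conjI)
      show "connectedin X (\<psi> ` C)" by (rule chart_connected_image[OF ch C(1)])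
      show "\<psi> ` C \<subseteq> U - edge_points G e" using C(2) on_edge U'D by blast
    qed (use C x' in auto)
  qed
  have clos: "\<psi> ` W \<inter> open_edge e \<subseteq> X closure_of (\<psi> ` H)" if H: "W \<inter> path_image g \<subseteq> closure H" for H
  proof
    fix q assume q: "q \<in> \<psi> ` W \<inter> open_edge e"
    then obtain z where z: "z \<in> W" "q = \<psi> z" by auto
    then have "z \<in> closure H" using q on_open W(3) H by blast
    show "q \<in> X closure_of (\<psi> ` H)"
      unfolding in_closure_of
    proof (intro conjI allI impI)
      show "q \<in> topspace X" using q open_edge_in_topspace[OF e] by auto
      fix T assume "q \<in> T \<and> openin X T"
      then have "open (\<psi> -` T)" "z \<in> \<psi> -` T" using chart_open_vimage[OF ch] z by auto
      then have "\<psi> -` T \<inter> H \<noteq> {}" using \<open>z \<in> closure H\<close> open_Int_closure_eq_empty by blast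
      then show "\<exists>y. y \<in> \<psi> ` H \<and> y \<in> T" by blast
    qed
  qed
  show thesis
  proof (rule that[of "\<psi> ` W" "\<psi> ` P" "\<psi> ` Q"])
    show "openin X (\<psi> ` W)"
      by (rule chart_open_image[OF ch D(1) order_refl W(1)]) (use chart_inverse(1)[OF ch] in auto)
    show "?c t \<in> \<psi> ` W" using W(2) gt' imageI[of "g t'" W \<psi>] by simp
    show "\<psi> ` W \<subseteq> U - V" using W(3) U'D by blast
    have "\<psi> ` W - open_edge e = \<psi> ` (W - path_image g)" using on_open W(3) by blast
    then show "\<psi> ` W - open_edge e = \<psi> ` P \<union> \<psi> ` Q" using W(4) by (simp add: image_Un)
  qed (use conn[OF W(5)] conn[OF W(6)] clos[OF W(7)] clos[OF W(8)] in simp_all)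
qed

text \<open>The components on the two sides at one point are the only ones adjacent to the edge
  nearby, so the set of adjacent components is locally constant along the open edge, hence constant.
  \<open>R1 = R2\<close> is the case where both sides lie in one component.\<close>

lemma edge_adjacent_components:
  assumes e: "e \<in> E" and N: "openin X N" "N \<inter> V = {}" "open_edge e \<subseteq> N"
  obtains R1 R2 where "R1 \<in> comps (N - open_edge e)" "R2 \<in> comps (N - open_edge e)"
    "\<And>p. p \<in> open_edge e \<Longrightarrow> {R \<in> comps (N - open_edge e). p \<in> X closure_of R} = {R1, R2}"
    "\<And>p. p \<in> open_edge e \<Longrightarrow> \<exists>W. openin X W \<and> p \<in> W \<and> W \<inter> (N - open_edge e) \<subseteq> R1 \<union> R2"
proof -
  let ?M = "N - open_edge e" and ?c = "curve G e"
  let ?adj = "\<lambda>p. {R \<in> comps ?M. p \<in> X closure_of R}"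
  have loc: "\<exists>W R1 R2. openin X W \<and> ?c t \<in> W \<and> R1 \<in> comps ?M \<and> R2 \<in> comps ?M \<and> W \<inter> ?M \<subseteq> R1 \<union> R2 \<and>
      (\<forall>q \<in> W \<inter> open_edge e. ?adj q = {R1, R2})" if t: "t \<in> {0<..<1}" for t
  proof -
    have t': "0 < t" "t < 1" "?c t \<in> N" using t N(3) by (auto simp: open_edge_def)
    obtain W P Q where W: "openin X W" "?c t \<in> W" "W \<subseteq> N - V" "W - open_edge e = P \<union> Q"
      "\<And>x y. x \<in> P \<Longrightarrow> y \<in> P \<Longrightarrow> \<exists>C. connectedin X C \<and> C \<subseteq> N - edge_points G e \<and> x \<in> C \<and> y \<in> C"
      "\<And>x y. x \<in> Q \<Longrightarrow> y \<in> Q \<Longrightarrow> \<exists>C. connectedin X C \<and> C \<subseteq> N - edge_points G e \<and> x \<in> C \<and> y \<in> C"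
      "W \<inter> open_edge e \<subseteq> X closure_of P" "W \<inter> open_edge e \<subseteq> X closure_of Q"
      by (rule edge_two_sides[OF e t'(1,2) N(1) t'(3)]) (rule that)
    have tW: "?c t \<in> W \<inter> open_edge e" using W(2) t by (auto simp: open_edge_def)
    have Msub: "N - edge_points G e \<subseteq> ?M" by (auto simp: edge_points_eq)
    have comp: "\<exists>R\<in>comps ?M. H \<subseteq> R"
      if H: "\<And>x y. x \<in> H \<Longrightarrow> y \<in> H \<Longrightarrow> \<exists>C. connectedin X C \<and> C \<subseteq> N - edge_points G e \<and> x \<in> C \<and> y \<in> C"
        and ne: "W \<inter> open_edge e \<subseteq> X closure_of H" for H
    proof -
      have "X closure_of H \<noteq> {}" using ne tW by blast
      then obtain x where x: "x \<in> H" by fastforce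
      obtain C0 where C0: "connectedin X C0" "C0 \<subseteq> N - edge_points G e" "x \<in> C0" using H[OF x x] by blast
      have "C0 \<noteq> {}" using C0 by auto
      from connected_subset_component[OF C0(1) order_trans[OF C0(2) Msub] this]
      obtain R where R: "R \<in> comps ?M" "C0 \<subseteq> R" by blast
      have "y \<in> R" if y: "y \<in> H" for y
      proof -
        obtain C where C: "connectedin X C" "C \<subseteq> N - edge_points G e" "x \<in> C" "y \<in> C" using H[OF x y] by blast
        have "C \<subseteq> R"
          by (rule connected_components_of_subtopology_maximal[OF R(1) C(1)]) (use C C0 R Msub in blast)+
        with C show ?thesis by auto
      qed
      then show ?thesis using R by blast
    qed
    obtain R1 where R1: "R1 \<in> comps ?M" "P \<subseteq> R1" using comp[OF W(5) W(7)] by blast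
    obtain R2 where R2: "R2 \<in> comps ?M" "Q \<subseteq> R2" using comp[OF W(6) W(8)] by blast
    have WM: "W \<inter> ?M \<subseteq> R1 \<union> R2" using W(4) R1 R2 by blast
    have "?adj q = {R1, R2}" if q: "q \<in> W \<inter> open_edge e" for q
    proof
      have "q \<in> X closure_of R1" "q \<in> X closure_of R2"
        using q W(7,8) closure_of_mono[OF R1(2), of X] closure_of_mono[OF R2(2), of X] by blast+
      then show "{R1, R2} \<subseteq> ?adj q" using R1 R2 by auto
      show "?adj q \<subseteq> {R1, R2}"
      proof
        fix R assume R: "R \<in> ?adj q"
        then obtain y where y: "y \<in> R" "y \<in> W" using q W(1) by (auto simp: in_closure_of)
        have RM: "R \<subseteq> ?M" using R connected_components_of_subtopologyD(2) by blast
        then have "y \<in> R1 \<union> R2" using WM y by blast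
        moreover have Rc: "R \<in> comps ?M" using R by simp
        ultimately show "R \<in> {R1, R2}"
          using connected_components_of_subtopology_eq[OF Rc R1(1)]
            connected_components_of_subtopology_eq[OF Rc R2(1)] y by blast
      qed
    qed
    then show ?thesis using W(1,2) R1 R2 WM by blast
  qed
  obtain W0 R1 R2 where R: "openin X W0" "?c (1/2) \<in> W0" "R1 \<in> comps ?M" "R2 \<in> comps ?M"
     "\<forall>q \<in> W0 \<inter> open_edge e. ?adj q = {R1, R2}"
    using loc[of "1/2", simplified] by (elim exE conjE) (rule that)
  have all: "?adj (?c t) = {R1, R2}" if t: "t \<in> {0<..<1}" for t
  proof (rule connected_induction_simple[of "{0<..<1::real}" "1/2" t "\<lambda>t. ?adj (?c t) = {R1, R2}"])
    have "?c (1/2) \<in> W0 \<inter> open_edge e" using R(2) by (auto simp: open_edge_def)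
    with R(5) show "?adj (?c (1/2)) = {R1, R2}" by (rule bspec)
    fix a :: real assume a: "a \<in> {0<..<1}"
    obtain W S1 S2 where W: "openin X W" "?c a \<in> W" "\<forall>q \<in> W \<inter> open_edge e. ?adj q = {S1, S2}"
      using loc[OF a] by (elim exE conjE) (rule that)
    have "openin (top_of_set {0..1}) {s \<in> topspace (top_of_set {0..1}). ?c s \<in> W}"
      by (rule openin_continuous_map_preimage[OF path_curve[OF e] W(1)])
    then obtain T where T: "open T" "{s \<in> {0..1}. ?c s \<in> W} = {0..1} \<inter> T" by (auto simp: openin_open)
    have Tiff: "?c s \<in> W \<longleftrightarrow> s \<in> T" if "s \<in> {0..1}" for s using T(2) that by blast
    have sub: "?c x \<in> W \<inter> open_edge e" if x: "x \<in> {0<..<1} \<inter> T" for x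
      using Tiff[of x] x by (auto simp: open_edge_def)
    show "\<exists>T. openin (top_of_set {0<..<1}) T \<and> a \<in> T \<and>
       (\<forall>x\<in>T. \<forall>y\<in>T. ?adj (?c x) = {R1, R2} \<longrightarrow> ?adj (?c y) = {R1, R2})"
    proof (intro exI[of _ "{0<..<1} \<inter> T"] conjI ballI impI)
      show "openin (top_of_set {0<..<1}) ({0<..<1} \<inter> T)" using T(1) by auto
      show "a \<in> {0<..<1} \<inter> T" using a W(2) Tiff[of a] by auto
      fix x y assume xy: "x \<in> {0<..<1} \<inter> T" "y \<in> {0<..<1} \<inter> T" and *: "?adj (?c x) = {R1, R2}"
      have "?adj (?c x) = {S1, S2}" "?adj (?c y) = {S1, S2}"
        using W(3)[rule_format, OF sub[OF xy(1)]] W(3)[rule_format, OF sub[OF xy(2)]] .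
      then show "?adj (?c y) = {R1, R2}" using * by simp
    qed
  qed (use t in auto)
  show thesis
  proof (rule that[of R1 R2])
    fix p assume "p \<in> open_edge e"
    then obtain t where t: "t \<in> {0<..<1}" "p = ?c t" by (auto simp: open_edge_def)
    show *: "?adj p = {R1, R2}" using all[OF t(1)] t(2) by simp
    obtain W S1 S2 where W: "openin X W" "?c t \<in> W" "W \<inter> ?M \<subseteq> S1 \<union> S2"
      "\<forall>q \<in> W \<inter> open_edge e. ?adj q = {S1, S2}"
      using loc[OF t(1)] by (elim exE conjE) (rule that)
    have "p \<in> W \<inter> open_edge e" using W(2) t(2) \<open>p \<in> open_edge e\<close> by auto
    with W(4) have "?adj p = {S1, S2}" by (rule bspec)
    then have "{S1, S2} = {R1, R2}" using * by (simp only:)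
    then have "S1 \<union> S2 = R1 \<union> R2" by (auto simp: doubleton_eq_iff)
    then show "\<exists>W. openin X W \<and> p \<in> W \<and> W \<inter> ?M \<subseteq> R1 \<union> R2" using W t by auto
  qed (use R in auto)
qed

text \<open>The open edge together with \<open>R1\<close> and \<open>R2\<close> is open, by the
  neighbourhoods \<open>W\<close>, and connected, because the open edge lies in the closure of both.
  Every other component stays open with open complement, hence remains a component.\<close>

lemma comps_remove_edge:
  assumes e: "e \<in> E" and N: "openin X N" "N \<inter> V = {}" "open_edge e \<subseteq> N"
    and R: "R1 \<in> comps (N - open_edge e)" "R2 \<in> comps (N - open_edge e)"
    and adj: "\<And>p. p \<in> open_edge e \<Longrightarrow> {R \<in> comps (N - open_edge e). p \<in> X closure_of R} = {R1, R2}"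
    and loc: "\<And>p. p \<in> open_edge e \<Longrightarrow> \<exists>W. openin X W \<and> p \<in> W \<and> W \<inter> (N - open_edge e) \<subseteq> R1 \<union> R2"
    and M: "openin X (N - open_edge e)"
  shows "comps N = insert (open_edge e \<union> R1 \<union> R2) (comps (N - open_edge e) - {R1, R2})"
    and "open_edge e \<union> R1 \<union> R2 \<notin> comps (N - open_edge e)"
proof -
  let ?M = "N - open_edge e" and ?K = "open_edge e \<union> R1 \<union> R2"
  have MV: "?M \<inter> V = {}" using N(2) by auto
  have MX: "?M \<subseteq> topspace X" "N \<subseteq> topspace X" using M N(1) openin_subset by auto
  have opn: "openin X S" if S: "S \<in> comps ?M" for S by (rule open_component[OF M MV S])
  have ne: "curve G e (1/2) \<in> open_edge e" by (auto simp: open_edge_def)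
  show notin: "?K \<notin> comps ?M" using connected_components_of_subtopologyD(2)[of ?K X ?M] ne by blast
  have Rsub: "R1 \<subseteq> ?M" "R2 \<subseteq> ?M" using R connected_components_of_subtopologyD(2) by blast+
  have oK: "openin X ?K"
  proof (subst openin_subopen, intro ballI)
    fix x assume x: "x \<in> ?K"
    show "\<exists>T. openin X T \<and> x \<in> T \<and> T \<subseteq> ?K"
    proof (cases "x \<in> open_edge e")
      case True
      obtain W where W: "openin X W" "x \<in> W" "W \<inter> ?M \<subseteq> R1 \<union> R2" using loc[OF True] by blast
      have "W \<inter> N \<subseteq> ?K" using W(3) by blast
      then show ?thesis using W(1,2) N(1,3) True by (intro exI[of _ "W \<inter> N"]) auto
    next
      case False
      then show ?thesis using x opn[OF R(1)] opn[OF R(2)] by blast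
    qed
  qed
  have NK: "N - ?K = \<Union>(comps ?M - {R1, R2})"
  proof (intro equalityI subsetI)
    fix x assume x: "x \<in> N - ?K"
    then have "x \<in> \<Union>(comps ?M)" using Union_comps[OF MX(1)] by auto
    then show "x \<in> \<Union>(comps ?M - {R1, R2})" using x by blast
  next
    fix x assume "x \<in> \<Union>(comps ?M - {R1, R2})"
    then obtain S where S: "S \<in> comps ?M" "S \<noteq> R1" "S \<noteq> R2" "x \<in> S" by auto
    have "S \<inter> R1 = {}" "S \<inter> R2 = {}" using connected_components_of_subtopology_eq[OF S(1)] R S by blast+
    then show "x \<in> N - ?K" using connected_components_of_subtopologyD(2)[OF S(1)] S by blast
  qed
  have oNK: "openin X (N - ?K)" unfolding NK using opn by (intro openin_Union) auto
  have cK: "connectedin X ?K"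
  proof -
    \<comment> \<open>The set lies between the connected \<open>S\<close> and its closure.\<close>
    have cR: "connectedin X (open_edge e \<union> S)" if S: "S \<in> {R1, R2}" for S
    proof (rule connectedin_intermediate_closure_of[of X S])
      have Sc: "S \<in> comps ?M" using S R by auto
      show "connectedin X S" by (rule connected_components_of_subtopologyD(3)[OF Sc])
      have "open_edge e \<subseteq> X closure_of S" using adj S by blast
      moreover have "S \<subseteq> X closure_of S"
        by (rule closure_of_subset[OF connected_components_of_subtopologyD(4)[OF Sc]])
      ultimately show "open_edge e \<union> S \<subseteq> X closure_of S" by blast
    qed auto
    have "connectedin X (\<Union>{open_edge e \<union> R1, open_edge e \<union> R2})"
      by (rule connectedin_Union) (use cR ne in auto)
    then show ?thesis by (simp add: Un_ac)
  qed
  have "?K \<in> comps N"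
    by (rule connected_componentsI[OF MX(2) oK oNK cK]) (use ne N(3) Rsub in auto)
  moreover have "S \<in> comps N" if S: "S \<in> comps ?M - {R1, R2}" for S
  proof -
    have Sc: "S \<in> comps ?M" using S by auto
    have "N - S = ?K \<union> (?M - S)"
    proof -
      have "S \<inter> R1 = {}" "S \<inter> R2 = {}" using connected_components_of_subtopology_eq[OF Sc] R S by blast+
      then show ?thesis using connected_components_of_subtopologyD(2)[OF Sc] Rsub N(3) by blast
    qed
    then have "openin X (N - S)" using oK open_component_complement[OF M MV Sc] by auto
    then show ?thesis
      using connected_componentsI[OF MX(2) opn[OF Sc]] connected_components_of_subtopologyD[OF Sc] by blast
  qed
  ultimately have sub: "insert ?K (comps ?M - {R1, R2}) \<subseteq> comps N" by blast
  moreover have "S \<in> insert ?K (comps ?M - {R1, R2})" if S: "S \<in> comps N" for S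
  proof -
    have "\<Union>(insert ?K (comps ?M - {R1, R2})) = N" using NK N(3) Rsub by auto
    moreover obtain x where x: "x \<in> S" "x \<in> N" using connected_components_of_subtopologyD(1,2)[OF S] by blast
    ultimately obtain T where T: "T \<in> insert ?K (comps ?M - {R1, R2})" "x \<in> T" by blast
    then have "T = S" using connected_components_of_subtopology_eq[of T X N S] S sub x by blast
    then show ?thesis using T by simp
  qed
  ultimately show "comps N = insert ?K (comps ?M - {R1, R2})" by blast
qed

text \<open>The regions adjacent to \<open>e\<close>, tested at its midpoint; by
  \<open>sides_properties\<close> every point of the open edge gives the same set. The set has a
  single element when both sides of \<open>e\<close> belong to one region.\<close>

definition sides :: "'e set \<Rightarrow> 'e \<Rightarrow> 'p set set" where
  "sides A e = {R \<in> comps (off (insert e A)). curve G e (1/2) \<in> X closure_of R}"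

lemma sides_properties:
  assumes e: "e \<in> E" "A \<subseteq> E" "e \<notin> A"
  obtains R1 R2 where "sides A e = {R1, R2}" "R1 \<in> comps (off (insert e A))" "R2 \<in> comps (off (insert e A))"
    "\<And>p. p \<in> open_edge e \<Longrightarrow> {R \<in> comps (off (insert e A)). p \<in> X closure_of R} = {R1, R2}"
    "\<And>p. p \<in> open_edge e \<Longrightarrow> \<exists>W. openin X W \<and> p \<in> W \<and> W \<inter> off (insert e A) \<subseteq> R1 \<union> R2"
    "comps (off A) = insert (open_edge e \<union> R1 \<union> R2) (comps (off (insert e A)) - {R1, R2})"
    "open_edge e \<union> R1 \<union> R2 \<notin> comps (off (insert e A))"
proof -
  note N = open_off[OF e(2)] off_sub(2)[of A] open_edge_off[OF e]
  note eq = off_insert[OF e(1), of A]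
  have M: "openin X (off A - open_edge e)" using open_off[of "insert e A"] e eq by simp
  obtain R1 R2 where R: "R1 \<in> comps (off A - open_edge e)" "R2 \<in> comps (off A - open_edge e)"
    "\<And>p. p \<in> open_edge e \<Longrightarrow> {R \<in> comps (off A - open_edge e). p \<in> X closure_of R} = {R1, R2}"
    "\<And>p. p \<in> open_edge e \<Longrightarrow> \<exists>W. openin X W \<and> p \<in> W \<and> W \<inter> (off A - open_edge e) \<subseteq> R1 \<union> R2"
    by (rule edge_adjacent_components[OF e(1) N]) (rule that)
  have "curve G e (1/2) \<in> open_edge e" by (auto simp: open_edge_def)
  then have "sides A e = {R1, R2}" using R(3) by (simp add: sides_def eq)
  then show thesis
    using that[of R1 R2] R comps_remove_edge[OF e(1) N R M] unfolding eq by blast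
qed

lemma finite_comps_off:
  assumes "A \<subseteq> E"
  shows "finite (comps (off A))"
proof -
  have "finite A" using assms finite_E finite_subset by blast
  then show ?thesis using assms
  proof (induction A)
    case empty
    show ?case by (rule finite_comps_off_empty)
  next
    case (insert e A)
    then have e: "e \<in> E" "A \<subseteq> E" "e \<notin> A" and fin: "finite (comps (off A))" by auto
    obtain R1 R2 where
      "comps (off A) = insert (open_edge e \<union> R1 \<union> R2) (comps (off (insert e A)) - {R1, R2})"
      by (rule sides_properties[OF e]) (rule that)
    with fin have "finite (comps (off (insert e A)) - {R1, R2})" by simp
    then show ?case by simp
  qed
qed

text \<open>When \<open>e\<close> is removed, the regions in \<open>sides A e\<close> and the open
  edge become one region and all others remain. Finiteness turns this into an equation between
  values of \<open>card\<close>.\<close>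

lemma num_regions_insert:
  assumes e: "e \<in> E" "A \<subseteq> E" "e \<notin> A"
  shows "num_regions G (insert e A) + 1 = num_regions G A + card (sides A e)"
    and "card (sides A e) = 1 \<or> card (sides A e) = 2"
proof -
  obtain R1 R2 where R: "sides A e = {R1, R2}" "R1 \<in> comps (off (insert e A))" "R2 \<in> comps (off (insert e A))"
    "comps (off A) = insert (open_edge e \<union> R1 \<union> R2) (comps (off (insert e A)) - {R1, R2})"
    "open_edge e \<union> R1 \<union> R2 \<notin> comps (off (insert e A))"
    by (rule sides_properties[OF e]) (rule that)
  show "card (sides A e) = 1 \<or> card (sides A e) = 2" using R(1) by (cases "R1 = R2") auto
  have fin: "finite (comps (off (insert e A)))" using finite_comps_off e by simp
  have sub: "{R1, R2} \<subseteq> comps (off (insert e A))" using R by auto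
  then have "card {R1, R2} \<le> card (comps (off (insert e A)))" using fin card_mono by blast
  moreover have "card (comps (off A)) = Suc (card (comps (off (insert e A))) - card {R1, R2})"
    unfolding R(4) using R(5) fin card_Diff_subset[OF finite_subset[OF sub fin] sub]
    by (subst card_insert_disjoint) auto
  ultimately show "num_regions G (insert e A) + 1 = num_regions G A + card (sides A e)"
    unfolding num_regions_def complement_components_eq R(1) by simp
qed

text \<open>If \<open>R1\<close> occupies both sides of \<open>e\<close> in the smaller complement,
  every region of the larger complement that is adjacent to \<open>e\<close> meets \<open>R1\<close>
  near the midpoint and so contains it. Regions with a common part are equal.\<close>

lemma sides_single_mono:
  assumes e: "e \<in> E" "B \<subseteq> E" "e \<notin> B" and A: "A \<subseteq> B" and one: "card (sides B e) = 1"
  shows "card (sides A e) = 1"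
proof -
  have eA: "e \<in> E" "A \<subseteq> E" "e \<notin> A" using e A by auto
  let ?M = "off (insert e B)" and ?N = "off (insert e A)"
  obtain R1 R2 where R: "sides B e = {R1, R2}" "R1 \<in> comps ?M"
    "\<And>p. p \<in> open_edge e \<Longrightarrow> \<exists>W. openin X W \<and> p \<in> W \<and> W \<inter> ?M \<subseteq> R1 \<union> R2"
    by (rule sides_properties[OF e]) (rule that)
  have "R1 = R2" using one R(1) by (cases "R1 = R2") auto
  define p where "p = curve G e (1/2)"
  have p: "p \<in> open_edge e" by (auto simp: open_edge_def p_def)
  obtain W where W: "openin X W" "p \<in> W" "W \<inter> ?M \<subseteq> R1" using R(3)[OF p] \<open>R1 = R2\<close> by auto
  have MN: "?M \<subseteq> ?N" using A by (auto simp: off_def)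
  have R1: "connectedin X R1" "R1 \<subseteq> ?N"
    using connected_components_of_subtopologyD[OF R(2)] MN by auto
  obtain S1 S2 where S: "sides A e = {S1, S2}" "S1 \<in> comps ?N" "S2 \<in> comps ?N"
    by (rule sides_properties[OF eA]) (rule that)
  have "R1 \<subseteq> S" if S: "S \<in> sides A e" for S
  proof -
    have Sc: "S \<in> comps ?N" "p \<in> X closure_of S" using S by (auto simp: sides_def p_def)
    \<comment> \<open>Inside \<open>off B\<close>, a point off \<open>A\<close> and \<open>e\<close>
      is also off \<open>B\<close> and \<open>e\<close>; near \<open>p\<close> it therefore lies in
      \<open>R1\<close>.\<close>
    have "p \<in> off B" using open_edge_off[OF e] p by auto
    then have "p \<in> W \<inter> off B \<and> openin X (W \<inter> off B)" using W open_off[OF e(2)] by auto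
    then obtain y where y: "y \<in> S" "y \<in> W \<inter> off B" using Sc(2) unfolding in_closure_of by blast
    have "y \<in> ?N" using connected_components_of_subtopologyD(2)[OF Sc(1)] y by auto
    then have "y \<in> ?M" using y off_insert[OF e(1)] by auto
    then have "y \<in> R1" using W y by auto
    then show ?thesis using connected_components_of_subtopology_maximal[OF Sc(1) R1] y by blast
  qed
  then have "R1 \<subseteq> S1" "R1 \<subseteq> S2" using S(1) by auto
  then have "S1 = S2"
    using connected_components_of_subtopology_eq[OF S(2,3)] connected_components_of_subtopologyD(1)[OF R(2)] by blast
  then show ?thesis using S(1) by simp
qed

text \<open>Adjacency is defined through the closed edge, \<open>sides\<close> through the midpoint.
  A region that has the midpoint in its closure has the whole open edge there, and by continuity of
  the curve also the ends.\<close>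

lemma quasi_bridge_iff:
  assumes e: "e \<in> E"
  shows "quasi_bridge G e \<longleftrightarrow> card (sides (E - {e}) e) = 1"
proof -
  have e': "e \<in> E" "E - {e} \<subseteq> E" "e \<notin> E - {e}" and ins: "insert e (E - {e}) = E" using e by auto
  obtain R1 R2 where R: "sides (E - {e}) e = {R1, R2}"
    "\<And>p. p \<in> open_edge e \<Longrightarrow> {R \<in> comps (off E). p \<in> X closure_of R} = {R1, R2}"
    by (rule sides_properties[OF e', unfolded ins]) (rule that)
  have "adjacent_region G e R \<longleftrightarrow> R \<in> sides (E - {e}) e" for R
  proof
    assume "adjacent_region G e R"
    then have *: "R \<in> comps (off E)" "edge_points G e \<subseteq> X closure_of R"
      by (auto simp: adjacent_region_def complement_components_eq)
    have "curve G e (1/2) \<in> edge_points G e" by (auto simp: edge_points_def)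
    then show "R \<in> sides (E - {e}) e" using * by (auto simp: sides_def insert_absorb[OF e])
  next
    assume RR: "R \<in> sides (E - {e}) e"
    then have Rc: "R \<in> comps (off E)" by (simp add: sides_def insert_absorb[OF e])
    have "open_edge e \<subseteq> X closure_of R" using R RR by blast
    then have "X closure_of (curve G e ` {0<..<1}) \<subseteq> X closure_of R"
      by (intro closure_of_minimal) (auto simp: open_edge_def)
    moreover have "curve G e ` ((top_of_set {0..1}) closure_of {0<..<1}) \<subseteq> X closure_of (curve G e ` {0<..<1})"
      using path_curve[OF e] unfolding continuous_map_eq_image_closure_subset by auto
    moreover have "(top_of_set {0..1::real}) closure_of {0<..<1} = {0..1}"
      by (simp add: closure_of_subtopology Int_absorb1 greaterThanLessThan_subseteq_atLeastAtMost_iff)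
    ultimately have "edge_points G e \<subseteq> X closure_of R" by (auto simp: edge_points_def)
    then show "adjacent_region G e R" using Rc by (simp add: adjacent_region_def complement_components_eq)
  qed
  then have "quasi_bridge G e \<longleftrightarrow> (\<exists>!R. R \<in> sides (E - {e}) e)" by (simp add: quasi_bridge_def)
  also have "\<dots> \<longleftrightarrow> (\<exists>R. sides (E - {e}) e = {R})"
  proof
    assume "\<exists>!R. R \<in> sides (E - {e}) e"
    then obtain R where "R \<in> sides (E - {e}) e" "\<And>S. S \<in> sides (E - {e}) e \<Longrightarrow> S = R" by (elim ex1E) blast
    then have "sides (E - {e}) e = {R}" by blast
    then show "\<exists>R. sides (E - {e}) e = {R}" ..
  next
    assume "\<exists>R. sides (E - {e}) e = {R}"
    then show "\<exists>!R. R \<in> sides (E - {e}) e" by auto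
  qed
  also have "\<dots> \<longleftrightarrow> card (sides (E - {e}) e) = 1" by (simp add: card_1_singleton_iff)
  finally show ?thesis .
qed

section \<open>Parity of the boundary of a region\<close>

text \<open>The edges of \<open>A\<close> with \<open>R\<close> on exactly one side, expressed by
  closures. One point of the open edge suffices, since by \<open>boundary_edges_everywhere\<close>
  all its points then qualify.\<close>

definition boundary_edges :: "'e set \<Rightarrow> 'p set \<Rightarrow> 'e set" where
  "boundary_edges A R =
     {f \<in> A. \<exists>p\<in>open_edge f. p \<in> X closure_of R \<and> p \<in> X closure_of (off A - R)}"

text \<open>At the given point the sides are \<open>R\<close> and some region \<open>S\<close> other
  than \<open>R\<close>, and the sides are the same at every point of the open edge.\<close>

lemma boundary_edges_everywhere:
  assumes A: "A \<subseteq> E" and R: "R \<in> comps (off A)" and f: "f \<in> boundary_edges A R" and p: "p \<in> open_edge f"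
  shows "p \<in> X closure_of R" "p \<in> X closure_of (off A - R)"
proof -
  have fA: "f \<in> A" using f by (simp add: boundary_edges_def)
  then have f': "f \<in> E" "A - {f} \<subseteq> E" "f \<notin> A - {f}" and ins: "insert f (A - {f}) = A" using A by auto
  obtain S1 S2 where S: "S1 \<in> comps (off A)" "S2 \<in> comps (off A)"
    "\<And>p. p \<in> open_edge f \<Longrightarrow> {R \<in> comps (off A). p \<in> X closure_of R} = {S1, S2}"
    "\<And>p. p \<in> open_edge f \<Longrightarrow> \<exists>W. openin X W \<and> p \<in> W \<and> W \<inter> off A \<subseteq> S1 \<union> S2"
    by (rule sides_properties[OF f', unfolded ins]) (rule that)
  obtain q where q: "q \<in> open_edge f" "q \<in> X closure_of R" "q \<in> X closure_of (off A - R)"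
    using f by (auto simp: boundary_edges_def)
  have RS: "R \<in> {S1, S2}" using S(3)[OF q(1)] R q(2) by blast
  obtain W where W: "openin X W" "q \<in> W" "W \<inter> off A \<subseteq> S1 \<union> S2" using S(4)[OF q(1)] by blast
  obtain y where "y \<in> off A - R" "y \<in> W" using q(3) W(1,2) unfolding in_closure_of by blast
  then obtain S where SS: "S \<in> {S1, S2}" "S \<noteq> R" using W(3) by blast
  have Sc: "S \<in> comps (off A)" using SS S(1,2) by auto
  have "S \<inter> R = {}" using connected_components_of_subtopology_eq[OF Sc R] SS(2) by blast
  then have sub: "S \<subseteq> off A - R" using connected_components_of_subtopologyD(2)[OF Sc] by blast
  show "p \<in> X closure_of R" using S(3)[OF p] RS by blast
  have "p \<in> X closure_of S" using S(3)[OF p] SS(1) by blast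
  then show "p \<in> X closure_of (off A - R)" using closure_of_mono[OF sub, of X] by blast
qed

text \<open>A dart is an edge with a direction, \<open>True\<close> being that of the curve, and
  stands for the edge end at which it starts. A loop has two darts at its vertex, so counting darts
  counts its ends twice there, as the parity argument requires.\<close>

definition dart :: "'e \<times> bool \<Rightarrow> real \<Rightarrow> 'p" where
  "dart d s = curve G (fst d) (if snd d then s else 1 - s)"

lemma dart_continuous:
  assumes "fst d \<in> E"
  shows "continuous_map (top_of_set {0..1}) X (dart d)"
proof -
  let ?l = "\<lambda>s::real. if snd d then s else 1 - s"
  have "continuous_map (top_of_set {0..1}) (top_of_set {0..1}) ?l"
    by (cases "snd d") (auto intro!: continuous_intros)
  then have "continuous_map (top_of_set {0..1}) X (curve G (fst d) \<circ> ?l)"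
    using path_curve[OF assms] continuous_map_compose by blast
  then show ?thesis by (simp add: dart_def[abs_def] o_def)
qed

lemma dart_in_V: "fst d \<in> E \<Longrightarrow> s \<in> {0..1} \<Longrightarrow> dart d s \<in> V \<longleftrightarrow> s = 0 \<or> s = 1"
  using curve_in_V[of "fst d" "if snd d then s else 1 - s"] by (auto simp: dart_def)

lemma dart_inj:
  assumes "fst d \<in> E" "s \<in> {0..<1}" "t \<in> {0..<1}" "dart d s = dart d t"
  shows "s = t"
  using curve_eqD[OF assms(1), of "if snd d then s else 1 - s" "if snd d then t else 1 - t"] assms
  by (auto simp: dart_def doubleton_eq_iff split: if_splits)

lemma dart_edge_points: "s \<in> {0..1} \<Longrightarrow> dart d s \<in> edge_points G (fst d)"
  by (auto simp: dart_def edge_points_def)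

lemma dart_open_edge: "s \<in> {0<..<1} \<Longrightarrow> dart d s \<in> open_edge (fst d)"
  by (auto simp: dart_def open_edge_def)

text \<open>The parameters stop short of 1/2 because the two darts of one edge meet at its
  midpoint.\<close>

lemma dart_eqD:
  assumes d: "fst d \<in> E" "fst d' \<in> E" "d \<noteq> d'" and s: "s \<in> {0..<1/2}" "t \<in> {0..<1/2}"
    and eq: "dart d s = dart d' t"
  shows "s = 0"
proof (cases "fst d = fst d'")
  case True
  then have snd: "snd d \<noteq> snd d'" using d(3) by (simp add: prod_eq_iff)
  have "curve G (fst d) (if snd d then s else 1 - s) = curve G (fst d) (if snd d' then t else 1 - t)"
    using eq True by (simp add: dart_def)
  from curve_eqD[OF d(1) _ _ this] show ?thesis
    using s snd by (auto simp: doubleton_eq_iff split: if_splits)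
next
  case False
  have "dart d s \<in> edge_points G (fst d) \<inter> edge_points G (fst d')"
    using dart_edge_points[of s d] dart_edge_points[of t d'] s eq by auto
  then have "dart d s \<in> V" using edges_meet[OF d(1,2) False] by blast
  then show ?thesis using dart_in_V[OF d(1), of s] s by auto
qed

text \<open>A short initial piece without its start is connected and lies in the union of the sets
  \<open>D - {v}\<close>, which are open and pairwise disjoint.\<close>

lemma dart_in_one_sheet:
  assumes d: "fst d \<in> E" "dart d 0 = v"
    and \<D>: "finite \<D>" "openin X (\<Union>\<D>)" "v \<in> \<Union>\<D>"
      "\<forall>D\<in>\<D>. v \<in> D \<and> closedin (subtopology X (\<Union>\<D>)) D \<and>
                 subtopology X D homeomorphic_space (euclidean :: complex topology)"
      "\<forall>D\<in>\<D>. \<forall>D'\<in>\<D>. D \<noteq> D' \<longrightarrow> D \<inter> D' = {v}"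
  shows "\<exists>\<delta>>0. \<exists>D\<in>\<D>. dart d ` {0<..\<delta>} \<subseteq> D - {v}"
proof -
  have vV: "v \<in> V" using dart_in_V[OF d(1), of 0] d(2) by simp
  have "openin (top_of_set {0..1}) {s \<in> topspace (top_of_set {0..1}). dart d s \<in> \<Union>\<D>}"
    by (rule openin_continuous_map_preimage[OF dart_continuous[OF d(1)] \<D>(2)])
  then obtain T where T: "open T" "{s \<in> {0..1}. dart d s \<in> \<Union>\<D>} = {0..1} \<inter> T" by (auto simp: openin_open)
  have Tiff: "dart d s \<in> \<Union>\<D> \<longleftrightarrow> s \<in> T" if "s \<in> {0..1}" for s using T(2) that by blast
  have "0 \<in> T" using Tiff[of 0] d(2) \<D>(3) by simp
  then obtain \<epsilon> where \<epsilon>: "0 < \<epsilon>" "ball 0 \<epsilon> \<subseteq> T" using T(1) open_contains_ball by blast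
  define \<delta> where "\<delta> = min (\<epsilon>/2) (1/2)"
  have \<delta>: "0 < \<delta>" "\<delta> < \<epsilon>" "\<delta> < 1" using \<epsilon>(1) by (auto simp: \<delta>_def)
  have in\<D>: "dart d s \<in> \<Union>\<D> - {v}" if s: "s \<in> {0<..\<delta>}" for s
  proof -
    have "s \<in> T" using s \<delta> \<epsilon>(2) by (auto simp: subset_eq)
    moreover have "s \<in> {0..1}" using s \<delta> by auto
    ultimately have "dart d s \<in> \<Union>\<D>" using Tiff[of s] by simp
    moreover have "dart d s \<notin> V" using dart_in_V[OF d(1), of s] s \<delta> by auto
    then have "dart d s \<noteq> v" using vV by metis
    ultimately show ?thesis by (intro DiffI) (simp_all only: singleton_iff not_False_eq_True)
  qed
  have sub: "dart d ` {0<..\<delta>} \<subseteq> \<Union>\<D> - {v}" using in\<D> by (rule image_subsetI)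
  obtain D where D: "D \<in> \<D>" "dart d \<delta> \<in> D - {v}" using in\<D>[of \<delta>] \<delta>(1) by auto
  define E1 E2 where "E1 = D - {v}" and "E2 = (\<Union>D'\<in>\<D> - {D}. D' - {v})"
  have op: "openin X (D' - {v})" if "D' \<in> \<D>" for D'
    using sheet_chart(1)[OF \<D>(1,2) that _ \<D>(4,5)] \<D>(4) that by blast
  have "openin X E1" unfolding E1_def by (rule op[OF D(1)])
  moreover have "openin X E2" unfolding E2_def using op by (intro openin_Union) blast
  moreover have "E1 \<inter> E2 = {}" unfolding E1_def E2_def using \<D>(5) D(1) by blast
  moreover have "dart d ` {0<..\<delta>} \<subseteq> E1 \<union> E2" unfolding E1_def E2_def using sub by blast
  moreover have "connectedin X (dart d ` {0<..\<delta>})"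
    by (rule connectedin_continuous_map_image[OF dart_continuous[OF d(1)]])
       (use \<delta> in \<open>auto simp: connectedin_subtopology\<close>)
  moreover have "E1 \<inter> dart d ` {0<..\<delta>} \<noteq> {}" using D(2) \<delta>(1) by (auto simp: E1_def)
  ultimately have "E2 \<inter> dart d ` {0<..\<delta>} = {}" using connectedinD[of X "dart d ` {0<..\<delta>}" E1 E2] by blast
  then have "dart d ` {0<..\<delta>} \<subseteq> D - {v}" using \<open>dart d ` {0<..\<delta>} \<subseteq> E1 \<union> E2\<close> by (auto simp: E1_def)
  then show ?thesis using D(1) \<delta>(1) by blast
qed

text \<open>In a chart of the sheet centred at \<open>v\<close>, the darts in \<open>I\<close>
  become arcs from 0, and close to 0 nothing else of the drawing is seen. \<open>R\<close> and the
  rest of \<open>off A\<close> colour the complement of these arcs, and the flipping arcs are the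
  darts of boundary edges, so \<open>even_number_of_flipping_arcs\<close> applies.\<close>

lemma even_boundary_darts_in_sheet:
  assumes A: "A \<subseteq> E" and R: "R \<in> comps (off A)" and v: "v \<in> V"
    and D: "openin X (D - {v})" "v \<in> D" "chart X D \<phi>0 \<psi>0"
    and \<delta>: "0 < \<delta>" "\<delta> < 1/2"
    and I: "finite I" "\<And>d. d \<in> I \<Longrightarrow> fst d \<in> A \<and> dart d 0 = v \<and> dart d ` {0<..\<delta>} \<subseteq> D - {v}"
    and other: "\<And>d. fst d \<in> A \<Longrightarrow> dart d 0 = v \<Longrightarrow> d \<notin> I \<Longrightarrow> dart d ` {0<..\<delta>} \<inter> D = {}"
  shows "even (card {d \<in> I. fst d \<in> boundary_edges A R})"
proof -
  define \<phi> \<psi> where "\<phi> x = \<phi>0 x - \<phi>0 v" and "\<psi> z = \<psi>0 (z + \<phi>0 v)" for x z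
  have ch: "chart X D \<phi> \<psi>" using chart_translate[OF D(3), of "\<phi>0 v"] by (simp add: \<phi>_def[abs_def] \<psi>_def[abs_def])
  have phi_v: "\<phi> v = 0" by (simp add: \<phi>_def)
  then have psi0: "\<psi> 0 = v" using chart_inverse(3)[OF ch D(2)] by simp
  have psi_nz: "\<psi> z \<in> D - {v}" if "z \<noteq> 0" for z
    using chart_inverse(1,2)[OF ch, of z] phi_v that by auto
  let ?M = "off A"
  have dE: "fst d \<in> E" if "d \<in> I" for d using I(2)[OF that] A by blast
  \<comment> \<open>The initial piece over \<open>[0, \<delta>]\<close>, rescaled to a path over
    \<open>[0, 1]\<close>.\<close>
  define \<gamma> where "\<gamma> d s = \<phi> (dart d (\<delta> * s))" for d s
  have ds: "\<delta> * s \<in> {0..\<delta>}" "\<delta> * s \<in> {0..1}" "\<delta> * s \<in> {0..<1}" "\<delta> * s \<in> {0..<1/2}"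
    "s \<noteq> 0 \<Longrightarrow> \<delta> * s \<in> {0<..\<delta>}" "s \<noteq> 0 \<Longrightarrow> \<delta> * s \<in> {0<..<1}" if s: "s \<in> {0..1}" for s
  proof -
    have *: "0 \<le> \<delta> * s" "\<delta> * s \<le> \<delta>" using s \<delta> mult_left_le[of s \<delta>] by auto
    then show "\<delta> * s \<in> {0..\<delta>}" unfolding atLeastAtMost_iff by (intro conjI)
    from * show "\<delta> * s \<in> {0..1}" unfolding atLeastAtMost_iff using \<delta> by (intro conjI) linarith+
    from * show "\<delta> * s \<in> {0..<1}" "\<delta> * s \<in> {0..<1/2}"
      unfolding atLeastLessThan_iff using \<delta> by (intro conjI; linarith)+
    assume "s \<noteq> 0"
    then have "0 < \<delta> * s" using s \<delta> by simp
    with * show "\<delta> * s \<in> {0<..\<delta>}" "\<delta> * s \<in> {0<..<1}"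
      unfolding greaterThanAtMost_iff greaterThanLessThan_iff using \<delta> by (intro conjI; linarith)+
  qed
  have dD: "dart d (\<delta> * s) \<in> D" if d: "d \<in> I" and s: "s \<in> {0..1}" for d s
  proof (cases "s = 0")
    case False
    then show ?thesis using ds(5)[OF s] I(2)[OF d] by blast
  qed (use I(2)[OF d] D(2) in auto)
  have psi_gamma: "\<psi> (\<gamma> d s) = dart d (\<delta> * s)" if "d \<in> I" "s \<in> {0..1}" for d s
    using chart_inverse(3)[OF ch dD[OF that]] by (simp add: \<gamma>_def)
  have gamma0: "\<gamma> d 0 = 0" if "d \<in> I" for d using I(2)[OF that] phi_v by (simp add: \<gamma>_def)
  have arc: "arc (\<gamma> d)" if d: "d \<in> I" for d
    unfolding arc_def path_def
  proof
    have "continuous_map (top_of_set {0..1}) (subtopology X D) (dart d \<circ> (\<lambda>s. \<delta> * s))"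
    proof (subst continuous_map_in_subtopology, intro conjI)
      have "\<delta> * s \<in> {0..1}" if "s \<in> {0..1}" for s using ds(2)[OF that] .
      then have "continuous_map (top_of_set {0..1}) (top_of_set {0..1}) (\<lambda>s. \<delta> * s)"
        by (auto intro!: continuous_intros)
      then show "continuous_map (top_of_set {0..1}) X (dart d \<circ> (\<lambda>s. \<delta> * s))"
        using dart_continuous[OF dE[OF d]] continuous_map_compose by blast
      show "dart d \<circ> (\<lambda>s. \<delta> * s) \<in> topspace (top_of_set {0..1}) \<rightarrow> D" using dD[OF d] by auto
    qed
    from continuous_map_compose[OF this chart_continuous(2)[OF ch]]
    have "continuous_on {0..1} (\<phi> \<circ> (dart d \<circ> (\<lambda>s. \<delta> * s)))" by simp
    then show "continuous_on {0..1} (\<gamma> d)" by (simp add: \<gamma>_def[abs_def] o_def)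
    show "inj_on (\<gamma> d) {0..1}"
    proof (rule inj_onI)
      fix s t assume s: "s \<in> {0..1}" "t \<in> {0..1}" "\<gamma> d s = \<gamma> d t"
      then have "dart d (\<delta> * s) = dart d (\<delta> * t)" using psi_gamma[OF d] by metis
      moreover have "\<delta> * s \<in> {0..<1}" "\<delta> * t \<in> {0..<1}" using ds(3)[OF s(1)] ds(3)[OF s(2)] .
      ultimately have "\<delta> * s = \<delta> * t" using dart_inj[OF dE[OF d]] by blast
      then show "s = t" using \<delta> by simp
    qed
  qed
  have disj: "path_image (\<gamma> d) \<inter> path_image (\<gamma> d') \<subseteq> {0}" if d: "d \<in> I" "d' \<in> I" "d \<noteq> d'" for d d'
  proof
    fix z assume "z \<in> path_image (\<gamma> d) \<inter> path_image (\<gamma> d')"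
    then obtain s t where st: "s \<in> {0..1}" "t \<in> {0..1}" "z = \<gamma> d s" "z = \<gamma> d' t"
      unfolding path_image_def by blast
    have "dart d (\<delta> * s) = dart d' (\<delta> * t)"
      using psi_gamma[OF d(1) st(1)] psi_gamma[OF d(2) st(2)] st(3,4) by simp
    moreover have "\<delta> * s \<in> {0..<1/2}" "\<delta> * t \<in> {0..<1/2}" using ds(4)[OF st(1)] ds(4)[OF st(2)] .
    ultimately have "\<delta> * s = 0" using dart_eqD[OF dE[OF d(1)] dE[OF d(2)] d(3)] by blast
    then show "z \<in> {0}" using st(3) gamma0[OF d(1)] \<delta> by simp
  qed
  \<comment> \<open>\<open>S f\<close> consists of the parameters of \<open>f\<close> outside the
    initial pieces at \<open>v\<close>, so \<open>K\<close> is all of \<open>V\<close> and the edges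
    in \<open>A\<close> except \<open>v\<close> and the pieces before \<open>\<delta>\<close>. It is
    closed and misses \<open>v\<close>, which yields a disc of radius \<open>r\<close> free of
    \<open>K\<close>.\<close>
  define S where "S f = {t \<in> {0..1}. (curve G f 0 = v \<longrightarrow> \<delta> \<le> t) \<and> (curve G f 1 = v \<longrightarrow> t \<le> 1 - \<delta>)}" for f
  define K where "K = (V - {v}) \<union> (\<Union>f\<in>A. curve G f ` S f)"
  have "closed (S f)" for f
  proof -
    have "S f = {0..1} \<inter> (if curve G f 0 = v then {\<delta>..} else UNIV) \<inter> (if curve G f 1 = v then {..1-\<delta>} else UNIV)"
      by (auto simp: S_def)
    then show ?thesis by auto
  qed
  then have "closedin X (curve G f ` S f)" if "f \<in> A" for f
    using A that by (intro closed_curve_image) (auto simp: S_def)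
  moreover have "finite A" using A finite_E finite_subset by blast
  moreover have "closedin X (V - {v})"
    using V_sub finite_V by (intro closedin_Hausdorff_finite[OF Hausdorff]) auto
  ultimately have closedK: "closedin X K" unfolding K_def by (intro closedin_Un closedin_Union) auto
  have vK: "v \<notin> K"
  proof
    assume "v \<in> K"
    then obtain f t where f: "f \<in> A" "t \<in> S f" "v = curve G f t" unfolding K_def by blast
    then have "t = 0 \<or> t = 1" using curve_in_V[of f t] v A by (auto simp: S_def)
    then show False using f \<delta> by (auto simp: S_def)
  qed
  have "open (\<psi> -` (topspace X - K))" by (rule chart_open_vimage[OF ch]) (simp add: closedK openin_diff)
  moreover have "0 \<in> \<psi> -` (topspace X - K)" using psi0 vK v V_sub by auto
  ultimately obtain r where r: "0 < r" "ball 0 r \<subseteq> \<psi> -` (topspace X - K)" using open_contains_ball by blast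
  let ?B = "ball 0 r - {0 :: complex}"
  \<comment> \<open>The cut point at \<open>\<delta>\<close> itself belongs to \<open>K\<close>, so
    every arc leaves the disc; for a loop at \<open>v\<close> this uses
    \<open>\<delta> \<le> 1 - \<delta>\<close>.\<close>
  have end_out: "\<gamma> d 1 \<notin> ball 0 r" if d: "d \<in> I" for d
  proof
    assume "\<gamma> d 1 \<in> ball 0 r"
    then have "dart d \<delta> \<notin> K" using r(2) psi_gamma[OF d, of 1] by auto
    moreover have "dart d \<delta> \<in> curve G (fst d) ` S (fst d)"
      unfolding dart_def using \<delta> by (intro imageI) (auto simp: S_def)
    ultimately show False using I(2)[OF d] unfolding K_def by blast
  qed
  \<comment> \<open>Inside the disc the only drawn points are those of the arcs: a point of an edge
    that avoids \<open>K\<close> lies on an initial piece at \<open>v\<close>, and the initial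
    pieces of darts outside \<open>I\<close> miss the sheet.\<close>
  have mem: "\<psi> z \<in> ?M \<longleftrightarrow> z \<notin> (\<Union>d\<in>I. path_image (\<gamma> d))" if z: "z \<in> ?B" for z
  proof
    assume M: "\<psi> z \<in> ?M"
    show "z \<notin> (\<Union>d\<in>I. path_image (\<gamma> d))"
    proof
      assume "z \<in> (\<Union>d\<in>I. path_image (\<gamma> d))"
      then obtain d s where d: "d \<in> I" "s \<in> {0..1}" "z = \<gamma> d s" unfolding path_image_def by blast
      have "\<delta> * s \<in> {0..1}" using ds(2)[OF d(2)] .
      then have "\<psi> z \<in> edge_points G (fst d)" using psi_gamma[OF d(1,2)] d(3) dart_edge_points by simp
      then show False using M I(2)[OF d(1)] by (auto simp: off_def)
    qed
  next
    assume nz: "z \<notin> (\<Union>d\<in>I. path_image (\<gamma> d))"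
    have zX: "\<psi> z \<in> topspace X" "\<psi> z \<notin> K" using r(2) z by auto
    have zv: "\<psi> z \<in> D - {v}" using psi_nz z by auto
    have zV: "\<psi> z \<notin> V" using zX(2) zv by (auto simp: K_def)
    have "\<psi> z \<notin> edge_points G f" if f: "f \<in> A" for f
    proof
      assume "\<psi> z \<in> edge_points G f"
      then obtain t where t: "t \<in> {0..1}" "\<psi> z = curve G f t" by (auto simp: edge_points_def)
      have "t \<notin> S f" using zX(2) t(2) f unfolding K_def by blast
      then have "(curve G f 0 = v \<and> t < \<delta>) \<or> (curve G f 1 = v \<and> 1 - t < \<delta>)" using t(1) by (auto simp: S_def)
      then have "\<exists>d s. fst d = f \<and> dart d 0 = v \<and> s \<in> {0..\<delta>} \<and> \<psi> z = dart d s"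
      proof
        assume "curve G f 0 = v \<and> t < \<delta>"
        then show ?thesis using t by (intro exI[of _ "(f, True)"] exI[of _ t]) (auto simp: dart_def)
      next
        assume "curve G f 1 = v \<and> 1 - t < \<delta>"
        then show ?thesis using t by (intro exI[of _ "(f, False)"] exI[of _ "1 - t"]) (auto simp: dart_def)
      qed
      then obtain d s where d: "fst d = f" "dart d 0 = v" "s \<in> {0..\<delta>}" "\<psi> z = dart d s" by blast
      have "s \<noteq> 0" using d zv by auto
      then have "s \<in> {0<..\<delta>}" using d(3) by auto
      then have "d \<in> I" using other[of d] d zv f by blast
      have sd: "s / \<delta> \<in> {0..1}" "\<delta> * (s / \<delta>) = s" using d(3) \<delta> by auto
      have "z = \<phi> (\<psi> z)" using chart_inverse(2)[OF ch] by simp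
      then have "z = \<gamma> d (s / \<delta>)" using d(4) sd(2) by (simp add: \<gamma>_def)
      then have "z \<in> path_image (\<gamma> d)" using sd(1) unfolding path_image_def by blast
      then show False using nz \<open>d \<in> I\<close> by blast
    qed
    then show "\<psi> z \<in> ?M" using zX zV by (auto simp: off_def)
  qed
  define R1 R2 where "R1 = ?B \<inter> \<psi> -` R" and "R2 = ?B \<inter> \<psi> -` (?M - R)"
  have RM: "R \<subseteq> ?M" using connected_components_of_subtopologyD(2)[OF R] .
  have oB: "open ?B" by (intro open_Diff) auto
  have BD: "\<psi> ` ?B \<subseteq> D - {v}" using psi_nz by auto
  have inner: "\<psi> p \<in> open_edge (fst d)" if d: "d \<in> I" and p: "p \<in> path_image (\<gamma> d) \<inter> ball 0 r - {0}" for d p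
  proof -
    obtain s where s: "s \<in> {0..1}" "p = \<gamma> d s" using p unfolding path_image_def by blast
    have "s \<noteq> 0" using p s gamma0[OF d] by auto
    then have "\<delta> * s \<in> {0<..<1}" using ds(6)[OF s(1)] by blast
    then show ?thesis using dart_open_edge psi_gamma[OF d s(1)] s(2) by simp
  qed
  show ?thesis
  proof (rule even_number_of_flipping_arcs[of I _ r \<gamma> R1 R2])
    show "open R1" unfolding R1_def
      by (intro open_Int oB chart_open_vimage[OF ch] open_component[OF open_off[OF A] off_sub(2) R])
    show "open R2" unfolding R2_def
      by (intro open_Int oB chart_open_vimage[OF ch] open_component_complement[OF open_off[OF A] off_sub(2) R])
    show "R1 \<inter> R2 = {}" by (auto simp: R1_def R2_def)
    show "R1 \<union> R2 = ball 0 r - {0} - (\<Union>d\<in>I. path_image (\<gamma> d))"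
    proof -
      have "R1 \<union> R2 = ?B \<inter> \<psi> -` ?M" using RM by (auto simp: R1_def R2_def)
      also have "\<dots> = ?B - (\<Union>d\<in>I. path_image (\<gamma> d))" using mem by blast
      finally show ?thesis .
    qed
    show "p \<in> closure R1 \<inter> closure R2"
      if d: "d \<in> {d \<in> I. fst d \<in> boundary_edges A R}" and p: "p \<in> path_image (\<gamma> d) \<inter> ball 0 r - {0}" for d p
    proof -
      have dI: "d \<in> I" "fst d \<in> boundary_edges A R" using d by auto
      have pB: "p \<in> ?B" using p by auto
      note cl = boundary_edges_everywhere[OF A R dI(2) inner[OF dI(1) p]]
      show ?thesis
        unfolding R1_def R2_def
        using chart_closure_vimage[OF ch D(1) _ oB BD pB cl(1)] chart_closure_vimage[OF ch D(1) _ oB BD pB cl(2)]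
        by blast
    qed
    show "p \<notin> closure R1 \<inter> closure R2"
      if d: "d \<in> I - {d \<in> I. fst d \<in> boundary_edges A R}" and p: "p \<in> path_image (\<gamma> d) \<inter> ball 0 r - {0}" for d p
    proof
      assume "p \<in> closure R1 \<inter> closure R2"
      then have "\<psi> p \<in> X closure_of R" "\<psi> p \<in> X closure_of (?M - R)"
        using chart_closure_image[OF ch] unfolding R1_def R2_def by blast+
      moreover have dI: "d \<in> I" using d by auto
      ultimately have "fst d \<in> boundary_edges A R"
        using inner[OF dI p] I(2)[OF dI] unfolding boundary_edges_def by blast
      then show False using d by auto
    qed
  qed (use I(1) r(1) arc gamma0 end_out disj in auto)
qed

text \<open>Each dart at \<open>v\<close> starts in exactly one sheet, so the count splits into even
  counts over the sheets. There are finitely many darts, which allows one \<open>\<delta>\<close>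
  for all of them.\<close>

lemma even_boundary_darts_at_vertex:
  assumes A: "A \<subseteq> E" and R: "R \<in> comps (off A)" and v: "v \<in> V"
  shows "even (card {d. fst d \<in> boundary_edges A R \<and> dart d 0 = v})"
proof -
  obtain k where "discs_at X k v" using discs v V_sub by blast
  then obtain \<D> where D: "finite \<D>" "openin X (\<Union>\<D>)" "v \<in> \<Union>\<D>"
      "\<forall>D\<in>\<D>. v \<in> D \<and> closedin (subtopology X (\<Union>\<D>)) D \<and>
                 subtopology X D homeomorphic_space (euclidean :: complex topology)"
      "\<forall>D\<in>\<D>. \<forall>D'\<in>\<D>. D \<noteq> D' \<longrightarrow> D \<inter> D' = {v}"
    unfolding discs_at_def by blast
  define T where "T = {d. fst d \<in> A \<and> dart d 0 = v}"
  have "T \<subseteq> A \<times> UNIV" by (auto simp: T_def)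
  moreover have "finite A" using A finite_E finite_subset by blast
  then have "finite (A \<times> (UNIV :: bool set))" by simp
  ultimately have finT: "finite T" by (rule finite_subset)
  have "\<exists>\<delta>>0. \<exists>D\<in>\<D>. dart d ` {0<..\<delta>} \<subseteq> D - {v}" if "d \<in> T" for d
    by (rule dart_in_one_sheet[OF _ _ D]) (use that A in \<open>auto simp: T_def\<close>)
  then obtain \<delta>' Df where T: "\<And>d. d \<in> T \<Longrightarrow> 0 < \<delta>' d" "\<And>d. d \<in> T \<Longrightarrow> Df d \<in> \<D>"
      "\<And>d. d \<in> T \<Longrightarrow> dart d ` {0<..\<delta>' d} \<subseteq> Df d - {v}" by metis
  \<comment> \<open>The entry 1/4 keeps \<open>\<delta>\<close> below 1/2 and the set
    nonempty.\<close>
  define \<delta> where "\<delta> = Min (insert (1/4) (\<delta>' ` T))"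
  have "\<delta> \<le> 1/4" unfolding \<delta>_def using finT by (intro Min_le) auto
  moreover have "0 < \<delta>" unfolding \<delta>_def using finT T(1) by (subst Min_gr_iff) auto
  ultimately have \<delta>: "0 < \<delta>" "\<delta> < 1/2" by auto
  have "\<delta> \<le> \<delta>' d" if "d \<in> T" for d unfolding \<delta>_def using finT that by (intro Min_le) auto
  then have sheet: "dart d ` {0<..\<delta>} \<subseteq> Df d - {v}" if "d \<in> T" for d
    using T(3)[OF that] that by fastforce
  let ?J = "\<lambda>D. {d \<in> {d \<in> T. Df d = D}. fst d \<in> boundary_edges A R}"
  have "even (card (?J D))" if DD: "D \<in> \<D>" for D
  proof -
    have vD: "v \<in> D" using D(4) DD by blast
    obtain \<phi> \<psi> where ch: "chart X D \<phi> \<psi>" using sheet_chart(2)[OF D(1,2) DD vD D(4,5)] by blast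
    show ?thesis
    proof (rule even_boundary_darts_in_sheet[OF A R v sheet_chart(1)[OF D(1,2) DD vD D(4,5)] vD ch \<delta>])
      show "finite {d \<in> T. Df d = D}" using finT by simp
      show "fst d \<in> A \<and> dart d 0 = v \<and> dart d ` {0<..\<delta>} \<subseteq> D - {v}" if "d \<in> {d \<in> T. Df d = D}" for d
        using sheet[of d] that by (auto simp: T_def)
      show "dart d ` {0<..\<delta>} \<inter> D = {}" if d: "fst d \<in> A" "dart d 0 = v" "d \<notin> {d \<in> T. Df d = D}" for d
      proof -
        have "d \<in> T" "Df d \<noteq> D" using d by (auto simp: T_def)
        then have "Df d \<inter> D = {v}" using D(5) T(2) DD by blast
        then show ?thesis using sheet[OF \<open>d \<in> T\<close>] by blast
      qed
    qed
  qed
  then have "even (\<Sum>D\<in>\<D>. card (?J D))" by (intro dvd_sum) auto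
  also have "(\<Sum>D\<in>\<D>. card (?J D)) = card (\<Union>D\<in>\<D>. ?J D)"
    using D(1) finT by (intro card_UN_disjoint[symmetric]) auto
  also have "(\<Union>D\<in>\<D>. ?J D) = {d. fst d \<in> boundary_edges A R \<and> dart d 0 = v}"
    using T(2) by (auto simp: T_def boundary_edges_def)
  finally show ?thesis .
qed

lemma sides_bridge:
  assumes e: "e \<in> E" "A \<subseteq> E" "e \<notin> A"
    and sep: "(curve G e 0, curve G e 1) \<notin> (joined G A \<union> (joined G A)\<inverse>)\<^sup>*"
  shows "card (sides A e) = 1"
proof (rule ccontr)
  assume two: "card (sides A e) \<noteq> 1"
  let ?A = "insert e A"
  have A: "?A \<subseteq> E" using e by simp
  obtain R S where R: "sides A e = {R, S}" "R \<in> comps (off ?A)" "S \<in> comps (off ?A)"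
    by (rule sides_properties[OF e]) (rule that)
  have "R \<noteq> S" using two R(1) by auto
  let ?F = "boundary_edges ?A R"
  have eF: "e \<in> ?F"
  proof -
    have "S \<inter> R = {}" using connected_components_of_subtopology_eq[OF R(3,2)] \<open>R \<noteq> S\<close> by blast
    then have sub: "S \<subseteq> off ?A - R" using connected_components_of_subtopologyD(2)[OF R(3)] by blast
    have "R \<in> sides A e" "S \<in> sides A e" using R(1) by auto
    then have "curve G e (1/2) \<in> X closure_of R" "curve G e (1/2) \<in> X closure_of S"
      by (auto simp: sides_def)
    moreover have "curve G e (1/2) \<in> open_edge e" by (auto simp: open_edge_def)
    ultimately show ?thesis unfolding boundary_edges_def using closure_of_mono[OF sub, of X] by blast
  qed
  have FA: "?F \<subseteq> ?A" by (auto simp: boundary_edges_def)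
  have finF: "finite ?F" by (rule finite_subset[OF order_trans[OF FA A] finite_E])
  define r where "r = (joined G A \<union> (joined G A)\<inverse>)\<^sup>*"
  \<comment> \<open>The component of \<open>(V, A)\<close> at the start of \<open>e\<close>.\<close>
  define C where "C = {w \<in> V. (curve G e 0, w) \<in> r}"
  have finC: "finite C" using finite_V by (auto simp: C_def)
  have fin: "finite {d. fst d \<in> ?F \<and> P d}" for P :: "'e \<times> bool \<Rightarrow> bool"
    by (rule finite_subset[of _ "?F \<times> UNIV"]) (use finF in auto)
  have "even (\<Sum>v\<in>C. card {d. fst d \<in> ?F \<and> dart d 0 = v})"
    using even_boundary_darts_at_vertex[OF A R(2)] by (intro dvd_sum) (auto simp: C_def)
  also have "(\<Sum>v\<in>C. card {d. fst d \<in> ?F \<and> dart d 0 = v}) = card (\<Union>v\<in>C. {d. fst d \<in> ?F \<and> dart d 0 = v})"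
    using finC fin by (intro card_UN_disjoint[symmetric]) auto
  \<comment> \<open>The same edge ends, now grouped by edges instead of vertices.\<close>
  also have "(\<Union>v\<in>C. {d. fst d \<in> ?F \<and> dart d 0 = v}) = (\<Union>f\<in>?F. {d. fst d = f \<and> dart d 0 \<in> C})"
    by auto
  also have "card \<dots> = (\<Sum>f\<in>?F. card {d. fst d = f \<and> dart d 0 \<in> C})"
  proof (rule card_UN_disjoint[OF finF])
    show "\<forall>f\<in>?F. finite {d. fst d = f \<and> dart d 0 \<in> C}"
    proof
      fix f
      have "{d. fst d = f \<and> dart d 0 \<in> C} \<subseteq> {f} \<times> UNIV" by auto
      then show "finite {d. fst d = f \<and> dart d 0 \<in> C}" by (rule finite_subset) simp
    qed
  qed auto
  also have "\<dots> = card {d. fst d = e \<and> dart d 0 \<in> C} + (\<Sum>f\<in>?F - {e}. card {d. fst d = f \<and> dart d 0 \<in> C})"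
    by (rule sum.remove[OF finF eF])
  finally have ev: "even (card {d. fst d = e \<and> dart d 0 \<in> C} + (\<Sum>f\<in>?F - {e}. card {d. fst d = f \<and> dart d 0 \<in> C}))" .
  have darts: "{d. fst d = f \<and> dart d 0 \<in> C} =
      (if curve G f 0 \<in> C then {(f, True)} else {}) \<union> (if curve G f 1 \<in> C then {(f, False)} else {})" for f
    by (auto simp: dart_def split: if_splits)
  have "curve G e 0 \<in> C" "curve G e 1 \<notin> C" using ends_V[OF e(1)] sep by (auto simp: C_def r_def)
  then have "card {d. fst d = e \<and> dart d 0 \<in> C} = 1" unfolding darts by simp
  moreover have "even (\<Sum>f\<in>?F - {e}. card {d. fst d = f \<and> dart d 0 \<in> C})"
  proof (rule dvd_sum)
    \<comment> \<open>Such an edge lies in \<open>A\<close>, so both its ends are in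
      \<open>C\<close> or neither is.\<close>
    fix f assume "f \<in> ?F - {e}"
    then have f: "f \<in> A" using FA by auto
    then have j: "(curve G f 0, curve G f 1) \<in> r" "(curve G f 1, curve G f 0) \<in> r"
      unfolding r_def by (auto simp: joined_def intro!: r_into_rtrancl)
    have "trans r" by (simp add: r_def trans_rtrancl)
    then have "curve G f 0 \<in> C \<longleftrightarrow> curve G f 1 \<in> C"
      using j f e(2) ends_V[of f] unfolding C_def trans_def by blast
    then show "even (card {d. fst d = f \<and> dart d 0 \<in> C})" unfolding darts by auto
  qed
  ultimately show False using ev by simp
qed

section \<open>Deletion and contraction\<close>

abbreviation linked :: "'e set \<Rightarrow> ('p \<times> 'p) set" where
  "linked A \<equiv> (joined G A \<union> (joined G A)\<inverse>)\<^sup>*"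

definition separating :: "'e set \<Rightarrow> 'e \<Rightarrow> bool" where
  "separating A e \<longleftrightarrow> (curve G e 0, curve G e 1) \<notin> linked A"

lemma sym_linked: "sym (linked A)"
  by (intro sym_rtrancl sym_Un_converse)

lemma joined_insert: "joined G (insert e A) = insert (curve G e 0, curve G e 1) (joined G A)"
  by (auto simp: joined_def)

lemma linked_mono: "A \<subseteq> B \<Longrightarrow> linked A \<subseteq> linked B"
  by (intro rtrancl_mono) (auto simp: joined_def)

lemma separating_antimono: "A \<subseteq> B \<Longrightarrow> separating B e \<Longrightarrow> separating A e"
  using linked_mono unfolding separating_def by blast

lemma num_components_insert:
  assumes e: "e \<in> E"
  shows "num_components G A = num_components G (insert e A) + (if separating A e then 1 else 0)"
proof (cases "separating A e")
  case True
  then show ?thesis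
    using card_quotient_insert_pair[OF finite_V ends_V[OF e] refl _ refl, of "joined G A"]
    by (simp add: num_components_def separating_def joined_insert)
next
  case False
  have "joined G (insert e A) \<union> (joined G (insert e A))\<inverse> \<subseteq> linked A"
    using False sym_linked[of A] unfolding joined_insert separating_def
    by (auto dest: symD)
  then have "linked (insert e A) \<subseteq> (linked A)\<^sup>*" by (rule rtrancl_mono)
  then have "linked (insert e A) = linked A" using linked_mono[of A "insert e A"] by auto
  then show ?thesis using False by (simp add: num_components_def)
qed

lemma bridge_iff: "e \<in> E \<Longrightarrow> bridge G e \<longleftrightarrow> separating (E - {e}) e"
  using num_components_insert[of e "E - {e}"] by (auto simp: bridge_def insert_absorb)

text \<open>The collapse identifies two distinct vertices only if both are ends of \<open>e\<close>,
  and \<open>linked (insert e B)\<close> relates these anyway. The two quotients have different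
  types, hence the comparison of kernels.\<close>

lemma num_components_contract:
  assumes e: "e \<in> E" and B: "B \<subseteq> E"
  shows "num_components (contract_edge G e) B = num_components G (insert e B)"
proof -
  let ?S = "edge_points G e"
  let ?q = "collapse ?S"
  let ?j = "joined (contract_edge G e) B"
  let ?r' = "(?j \<union> ?j\<inverse>)\<^sup>*" and ?r = "linked (insert e B)"
  have j: "?j = {(?q (curve G f 0), ?q (curve G f 1)) | f. f \<in> B}"
    by (auto simp: joined_def contract_edge_def Let_def)
  have rtr: "(x, z) \<in> ?r" if "(x, y) \<in> ?r" "(y, z) \<in> ?r" for x y z using that by (rule rtrancl_trans)
  have base: "(x, y) \<in> ?r" if xy: "x \<in> V" "y \<in> V" "?q x = ?q y" for x y
  proof (cases "x \<in> ?S")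
    case True
    have "y \<in> ?S"
    proof (rule ccontr)
      assume "y \<notin> ?S"
      then have "?S = {y}" using xy(3) True by (simp add: collapse_def)
      then show False using \<open>y \<notin> ?S\<close> by auto
    qed
    have "(curve G e 0, curve G e 1) \<in> ?r" "(curve G e 1, curve G e 0) \<in> ?r"
      by (auto simp: joined_insert intro: r_into_rtrancl)
    moreover have "x \<in> {curve G e 0, curve G e 1}" "y \<in> {curve G e 0, curve G e 1}"
      using True \<open>y \<in> ?S\<close> xy(1,2) open_edge_V[OF e] by (auto simp: edge_points_eq)
    ultimately show ?thesis by auto
  next
    case False
    then have "x = y" using xy(3) by (auto simp: collapse_def split: if_splits)
    then show ?thesis by simp
  qed
  have fwd: "(?q x, ?q y) \<in> ?r'" if "(x, y) \<in> ?r" for x y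
    using that
  proof (induction rule: rtrancl_induct)
    case (step y z)
    have "(?q y, ?q z) \<in> ?r'"
    proof -
      have q01: "?q (curve G e 0) = ?q (curve G e 1)" by (simp add: collapse_def edge_points_def)
      obtain f where f: "f \<in> insert e B"
        "(y, z) = (curve G f 0, curve G f 1) \<or> (z, y) = (curve G f 0, curve G f 1)"
        using step.hyps(2) by (auto simp: joined_def)
      show ?thesis
      proof (cases "f = e")
        case True
        then have "?q y = ?q z" using f q01 by auto
        then show ?thesis by simp
      next
        case False
        then have "(?q y, ?q z) \<in> ?j \<union> ?j\<inverse>" using f unfolding j by blast
        then show ?thesis by (rule r_into_rtrancl)
      qed
    qed
    with step.IH show ?case by (rule rtrancl_trans)
  qed simp
  \<comment> \<open>Stated for all representatives of \<open>a\<close> and \<open>b\<close>, since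
    consecutive edges of a walk in the contraction may meet \<open>e\<close> at different
    ends.\<close>
  have bwd: "\<forall>x\<in>V. \<forall>y\<in>V. ?q x = a \<longrightarrow> ?q y = b \<longrightarrow> (x, y) \<in> ?r" if "(a, b) \<in> ?r'" for a b
    using that
  proof (induction rule: rtrancl_induct)
    case base': base
    then show ?case using base by auto
  next
    case (step b c)
    show ?case
    proof (intro ballI impI)
      fix x y assume xy: "x \<in> V" "y \<in> V" "?q x = a" "?q y = c"
      obtain f s t where f: "f \<in> B" "(s, t) = (curve G f 0, curve G f 1) \<or> (t, s) = (curve G f 0, curve G f 1)"
        "b = ?q s" "c = ?q t" using step.hyps(2) unfolding j by blast
      have "f \<in> E" using f(1) B by auto
      then have st: "s \<in> V" "t \<in> V" using f(2) ends_V by auto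
      have "(s, t) \<in> ?r" using f(1,2) by (intro r_into_rtrancl) (auto simp: joined_def)
      moreover have "(x, s) \<in> ?r" using step.IH xy(1,3) st(1) f(3) by blast
      moreover have "(t, y) \<in> ?r" using base[OF st(2) xy(2)] xy(4) f(4) by simp
      ultimately show "(x, y) \<in> ?r" using rtr by blast
    qed
  qed
  have "V // ?r = (\<lambda>x. ?r `` {x}) ` V" by (auto simp: quotient_def)
  moreover have "(?q ` V) // ?r' = (\<lambda>x. ?r' `` {?q x}) ` V" by (auto simp: quotient_def)
  moreover have "card ((\<lambda>x. ?r' `` {?q x}) ` V) = card ((\<lambda>x. ?r `` {x}) ` V)"
  proof (rule card_image_cong_kernel)
    fix x y assume xy: "x \<in> V" "y \<in> V"
    show "?r' `` {?q x} = ?r' `` {?q y} \<longleftrightarrow> ?r `` {x} = ?r `` {y}"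
      unfolding rtrancl_sym_image_eq using fwd[of x y] bwd[of "?q x" "?q y"] xy by blast
  qed
  moreover have "vertices (contract_edge G e) = ?q ` V" by (simp add: contract_edge_def Let_def)
  ultimately show ?thesis unfolding num_components_def by simp
qed

text \<open>The complement of the drawing in the quotient has preimage \<open>?N\<close>, an open
  set away from \<open>e\<close> on which the collapse is injective; there the quotient map is a
  homeomorphism.\<close>

lemma num_regions_contract:
  assumes e: "e \<in> E" and B: "B \<subseteq> E"
  shows "num_regions (contract_edge G e) B = num_regions G (insert e B)"
proof -
  let ?S = "edge_points G e" and ?C = "contract_edge G e"
  let ?q = "collapse ?S" and ?N = "off (insert e B)"
  let ?N' = "topspace (space_of ?C) - (vertices ?C \<union> (\<Union>f\<in>B. edge_points ?C f))"
  have sp: "space_of ?C = collapse_space X ?S" and ve: "vertices ?C = ?q ` V"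
    and ed: "edge_points ?C f = ?q ` edge_points G f" for f
    by (auto simp: contract_edge_def Let_def edge_points_def image_image)
  have uS: "curve G e 0 \<in> ?S" "curve G e 0 \<in> V" using ends_V[OF e] by (auto simp: edge_points_def)
  have qN: "?q x = {x}" if "x \<in> ?N" for x using that by (auto simp: off_def collapse_def)
  have pre: "{x \<in> topspace X. ?q x \<in> ?N'} = ?N"
  proof (intro equalityI subsetI)
    fix x assume "x \<in> {x \<in> topspace X. ?q x \<in> ?N'}"
    then have x: "x \<in> topspace X" "?q x \<notin> ?q ` V" "\<And>f. f \<in> B \<Longrightarrow> ?q x \<notin> ?q ` edge_points G f"
      unfolding ve ed by auto
    have "x \<notin> ?S"
    proof
      assume "x \<in> ?S"
      then have "?q x = ?q (curve G e 0)" using uS(1) by (simp add: collapse_def)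
      then show False using x(2) uS(2) by blast
    qed
    then show "x \<in> ?N" using x by (auto simp: off_def)
  next
    fix x assume x: "x \<in> ?N"
    have "x = y" if "?q x = ?q y" for y
      using that x qN[OF x] by (auto simp: collapse_def off_def split: if_splits)
    then have "?q x \<notin> ?q ` T" if "x \<notin> T" for T using that by blast
    then show "x \<in> {x \<in> topspace X. ?q x \<in> ?N'}"
      using x unfolding ve ed sp topspace_collapse_space by (auto simp: off_def)
  qed
  have oN: "openin X ?N" using open_off e B by simp
  have "openin (collapse_space X ?S) ?N'"
    unfolding openin_collapse_space
  proof
    show "?N' \<subseteq> ?q ` topspace X" unfolding sp topspace_collapse_space by auto
    show "openin X {x \<in> topspace X. ?q x \<in> ?N'}" unfolding pre by (rule oN)
  qed
  then have "quotient_map (subtopology X ?N) (subtopology (collapse_space X ?S) ?N') ?q"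
    using quotient_map_restriction[OF quotient_map_collapse pre] by blast
  moreover have top: "topspace (subtopology X ?N) = ?N" using off_sub(1) by auto
  moreover have inj: "inj_on ?q ?N" by (rule inj_onI) (simp add: qN)
  ultimately have "homeomorphic_map (subtopology X ?N) (subtopology (collapse_space X ?S) ?N') ?q"
    unfolding homeomorphic_map_def by simp
  then have comps_eq: "connected_components_of (subtopology (collapse_space X ?S) ?N') = (image ?q) ` comps ?N"
    by (rule homeomorphic_map_connected_components_of)
  have "inj_on (image ?q) (comps ?N)"
  proof (rule inj_onI)
    fix R R' assume R: "R \<in> comps ?N" "R' \<in> comps ?N" "?q ` R = ?q ` R'"
    show "R = R'"
      using inj_on_image_eq_iff[OF inj connected_components_of_subtopologyD(2)[OF R(1)]
          connected_components_of_subtopologyD(2)[OF R(2)]] R(3) by simp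
  qed
  then have "card (connected_components_of (subtopology (collapse_space X ?S) ?N')) = card (comps ?N)"
    unfolding comps_eq by (rule card_image)
  then show ?thesis
    unfolding num_regions_def complement_components_eq
    unfolding complement_components_def sp by (simp add: sp)
qed

section \<open>Exponents and the term-by-term comparison of the sums\<close>

lemma num_regions_insert_separating:
  assumes "e \<in> E" "A \<subseteq> E" "e \<notin> A" "separating A e"
  shows "num_regions G (insert e A) = num_regions G A"
  using num_regions_insert(1)[OF assms(1-3)] sides_bridge[OF assms(1-3)] assms(4)
  by (simp add: separating_def)

text \<open>An added edge either merges two components and keeps the number of regions, or keeps the
  components and adds at most one region. The bounds make the exponents of the polynomial
  nonnegative, as \<open>power_int_nonneg_Suc\<close> requires where \<open>x - 1\<close>,
  \<open>y - 1\<close> or \<open>z\<close> is 0.\<close>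

lemma exponent_bounds:
  assumes "A \<subseteq> B" "B \<subseteq> E"
  shows "num_regions G B + num_components G A + card A \<le> card B + num_regions G A + num_components G B"
    and "num_regions G A \<le> num_regions G B" and "num_components G B \<le> num_components G A"
proof -
  have finB: "finite B" using assms finite_E finite_subset by blast
  have finA: "finite A" using assms(1) finB by (rule finite_subset)
  have "num_regions G (A \<union> D) + num_components G A + card A
        \<le> card (A \<union> D) + num_regions G A + num_components G (A \<union> D) \<and>
      num_regions G A \<le> num_regions G (A \<union> D) \<and> num_components G (A \<union> D) \<le> num_components G A"
    if D: "D \<subseteq> B - A" for D
  proof -
    have "finite D" using D finB finite_subset by blast
    then show ?thesis using D
    proof (induction D)
      case (insert e D)
      then have e: "e \<in> E" "A \<union> D \<subseteq> E" "e \<notin> A \<union> D" using assms by auto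
      have fin: "finite (A \<union> D)" using finA insert.hyps(1) by simp
      note num_regions_insert[OF e] num_regions_insert_separating[OF e]
        num_components_insert[OF e(1), of "A \<union> D"]
      then show ?case using insert.IH insert.prems fin e(3) by (auto split: if_splits)
    qed simp
  qed
  from this[of "B - A"] show
    "num_regions G B + num_components G A + card A \<le> card B + num_regions G A + num_components G B"
    "num_regions G A \<le> num_regions G B" "num_components G B \<le> num_components G A"
    using assms(1) by (simp_all add: Un_absorb1)
qed

text \<open>Subsets of \<open>E\<close> are paired as \<open>A\<close> and
  \<open>insert e A\<close>; in the second term \<open>card (insert e A)\<close> is already resolved
  into \<open>card A + 1\<close>.\<close>

lemma las_vergnas_split:
  assumes e: "e \<in> E"
  shows "las_vergnas G x y z = (\<Sum>A\<in>Pow (E - {e}).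
     (x - 1) powi (int (num_components G A) - int (num_components G E)) *
     (y - 1) powi (int (num_regions G A) - int (num_regions G {})) *
     z powi (int (card E) - int (card A) - int (num_regions G E) + int (num_regions G A)
             + int (num_components G E) - int (num_components G A)) +
     (x - 1) powi (int (num_components G (insert e A)) - int (num_components G E)) *
     (y - 1) powi (int (num_regions G (insert e A)) - int (num_regions G {})) *
     z powi (int (card E) - int (card A) - 1 - int (num_regions G E) + int (num_regions G (insert e A))
             + int (num_components G E) - int (num_components G (insert e A))))"
proof -
  let ?g = "\<lambda>A. (x - 1) powi (int (num_components G A) - int (num_components G E)) *
     (y - 1) powi (int (num_regions G A) - int (num_regions G {})) *
     z powi (int (card E) - int (card A) - int (num_regions G E) + int (num_regions G A)
             + int (num_components G E) - int (num_components G A))"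
  have fin: "finite (Pow (E - {e}))" using finite_E by simp
  have "las_vergnas G x y z = sum ?g (Pow (insert e (E - {e})))"
    unfolding las_vergnas_def Let_def using e by (simp add: insert_absorb)
  also have "\<dots> = sum ?g (Pow (E - {e})) + sum ?g (insert e ` Pow (E - {e}))"
    unfolding Pow_insert using fin by (intro sum.union_disjoint) auto
  also have "sum ?g (insert e ` Pow (E - {e})) = (\<Sum>A\<in>Pow (E - {e}). ?g (insert e A))"
  proof (rule sum.reindex[unfolded o_def])
    show "inj_on (insert e) (Pow (E - {e}))" by (rule inj_onI) blast
  qed
  also have "\<dots> = (\<Sum>A\<in>Pow (E - {e}). (x - 1) powi (int (num_components G (insert e A)) - int (num_components G E)) *
     (y - 1) powi (int (num_regions G (insert e A)) - int (num_regions G {})) *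
     z powi (int (card E) - int (card A) - 1 - int (num_regions G E) + int (num_regions G (insert e A))
             + int (num_components G E) - int (num_components G (insert e A))))"
  proof (rule sum.cong[OF refl])
    fix A assume A: "A \<in> Pow (E - {e})"
    then have "finite A" using finite_E finite_subset by (metis PowD finite_Diff)
    moreover have "e \<notin> A" using A by auto
    ultimately have "card (insert e A) = card A + 1" by simp
    then have "int (card E) - int (card (insert e A)) = int (card E) - int (card A) - 1" by simp
    then show "?g (insert e A) = (x - 1) powi (int (num_components G (insert e A)) - int (num_components G E)) *
     (y - 1) powi (int (num_regions G (insert e A)) - int (num_regions G {})) *
     z powi (int (card E) - int (card A) - 1 - int (num_regions G E) + int (num_regions G (insert e A))
             + int (num_components G E) - int (num_components G (insert e A)))" by (simp only:)
  qed
  finally show ?thesis by (simp only: sum.distrib)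
qed

lemma las_vergnas_delete:
  "las_vergnas (delete_edge G e) x y z = (\<Sum>A\<in>Pow (E - {e}).
     (x - 1) powi (int (num_components G A) - int (num_components G (E - {e}))) *
     (y - 1) powi (int (num_regions G A) - int (num_regions G {})) *
     z powi (int (card (E - {e})) - int (card A) - int (num_regions G (E - {e})) + int (num_regions G A)
             + int (num_components G (E - {e})) - int (num_components G A)))"
proof -
  have "num_components (delete_edge G e) A = num_components G A"
    "num_regions (delete_edge G e) A = num_regions G A" "edges (delete_edge G e) = E - {e}" for A
    by (simp_all add: delete_edge_def num_components_def joined_def num_regions_def
        complement_components_def edge_points_def)
  then show ?thesis unfolding las_vergnas_def Let_def by (simp only:)
qed

text \<open>The empty set and the full edge set of the contraction correspond to \<open>{e}\<close>
  and \<open>E\<close>. Hence the base value \<open>num_regions G {e}\<close> in the exponent of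
  \<open>y - 1\<close>; it agrees with \<open>num_regions G {}\<close> when \<open>e\<close> is no
  quasi-loop.\<close>

lemma las_vergnas_contract:
  assumes e: "e \<in> E"
  shows "las_vergnas (contract_edge G e) x y z = (\<Sum>A\<in>Pow (E - {e}).
     (x - 1) powi (int (num_components G (insert e A)) - int (num_components G E)) *
     (y - 1) powi (int (num_regions G (insert e A)) - int (num_regions G {e})) *
     z powi (int (card (E - {e})) - int (card A) - int (num_regions G E) + int (num_regions G (insert e A))
             + int (num_components G E) - int (num_components G (insert e A))))"
proof -
  have edges: "edges (contract_edge G e) = E - {e}" by (simp add: contract_edge_def Let_def)
  have cr: "num_components (contract_edge G e) A = num_components G (insert e A)"
    "num_regions (contract_edge G e) A = num_regions G (insert e A)" if "A \<subseteq> E - {e}" for A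
    using num_components_contract[OF e, of A] num_regions_contract[OF e, of A] that by auto
  have E: "insert e (E - {e}) = E" using e by auto
  show ?thesis
    unfolding las_vergnas_def Let_def edges
    by (rule sum.cong[OF refl]) (simp only: cr[OF order_refl] cr[OF empty_subsetI] cr[OF PowD] E)
qed

text \<open>A bridge joins two components of \<open>(V, A)\<close> for every \<open>A\<close>
  without it, so it never changes the number of regions. The terms for \<open>A\<close> and
  \<open>insert e A\<close> differ by the factor \<open>x - 1\<close>, and (x - 1) + 1 = x.\<close>

lemma las_vergnas_bridge:
  assumes e: "e \<in> E" and br: "bridge G e"
  shows "las_vergnas G x y z = x * las_vergnas (delete_edge G e) x y z"
  unfolding las_vergnas_split[OF e] las_vergnas_delete sum_distrib_left
proof (rule sum.cong[OF refl])
  let ?c = "\<lambda>A. int (num_components G A)" and ?\<rho> = "\<lambda>A. int (num_regions G A)"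
  let ?D = "E - {e}"
  fix A assume "A \<in> Pow ?D"
  then have A: "A \<subseteq> ?D" "A \<subseteq> E" "e \<notin> A" by auto
  have D: "?D \<subseteq> E" "e \<notin> ?D" "insert e ?D = E" using e by auto
  have sep: "separating ?D e" using br bridge_iff[OF e] by simp
  have sepA: "separating A e" by (rule separating_antimono[OF A(1) sep])
  have cE: "?c ?D = ?c E + 1" using num_components_insert[OF e, of ?D] sep D(3) by simp
  have rE: "?\<rho> E = ?\<rho> ?D" using num_regions_insert_separating[OF e D(1,2) sep] D(3) by simp
  have cA: "?c (insert e A) = ?c A - 1" using num_components_insert[OF e, of A] sepA by simp
  have rA: "?\<rho> (insert e A) = ?\<rho> A" using num_regions_insert_separating[OF e A(2,3) sepA] by simp
  have card: "int (card E) = int (card ?D) + 1"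
    using card.remove[OF finite_E e] by simp
  have "0 \<le> ?c A - ?c ?D" using exponent_bounds(3)[OF A(1) D(1)] by simp
  then have pw: "(x - 1) powi (?c A - ?c ?D + 1) = (x - 1) * (x - 1) powi (?c A - ?c ?D)"
    by (rule power_int_nonneg_Suc)
  have exps: "?c A - ?c E = ?c A - ?c ?D + 1" "?c (insert e A) - ?c E = ?c A - ?c ?D"
    "int (card E) - int (card A) - ?\<rho> E + ?\<rho> A + ?c E - ?c A = int (card ?D) - int (card A) - ?\<rho> ?D + ?\<rho> A + ?c ?D - ?c A"
    "int (card E) - int (card A) - 1 - ?\<rho> E + ?\<rho> (insert e A) + ?c E - ?c (insert e A) =
       int (card ?D) - int (card A) - ?\<rho> ?D + ?\<rho> A + ?c ?D - ?c A"
    using cE rE cA rA card by linarith+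
  show "(x - 1) powi (?c A - ?c E) * (y - 1) powi (?\<rho> A - ?\<rho> {}) *
     z powi (int (card E) - int (card A) - ?\<rho> E + ?\<rho> A + ?c E - ?c A) +
     (x - 1) powi (?c (insert e A) - ?c E) * (y - 1) powi (?\<rho> (insert e A) - ?\<rho> {}) *
     z powi (int (card E) - int (card A) - 1 - ?\<rho> E + ?\<rho> (insert e A) + ?c E - ?c (insert e A)) =
     x * ((x - 1) powi (?c A - ?c ?D) * (y - 1) powi (?\<rho> A - ?\<rho> {}) *
     z powi (int (card ?D) - int (card A) - ?\<rho> ?D + ?\<rho> A + ?c ?D - ?c A))"
    unfolding exps unfolding pw rA by (simp add: algebra_simps)
qed

text \<open>By \<open>sides_single_mono\<close>, an edge with two different regions on its sides
  when drawn alone keeps this property for every \<open>A\<close>. It always adds a region, so it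
  never joins components, and the terms for \<open>insert e A\<close> and \<open>A\<close> differ by
  the factor \<open>y - 1\<close>.\<close>

lemma las_vergnas_quasi_loop:
  assumes e: "e \<in> E" and ql: "quasi_loop G e"
  shows "las_vergnas G x y z = y * las_vergnas (delete_edge G e) x y z"
  unfolding las_vergnas_split[OF e] las_vergnas_delete sum_distrib_left
proof (rule sum.cong[OF refl])
  let ?c = "\<lambda>A. int (num_components G A)" and ?\<rho> = "\<lambda>A. int (num_regions G A)"
  let ?D = "E - {e}"
  have step: "?\<rho> (insert e A) = ?\<rho> A + 1 \<and> ?c (insert e A) = ?c A" if A: "A \<subseteq> ?D" for A
  proof -
    have A': "A \<subseteq> E" "e \<notin> A" using A by auto
    have "card (sides {} e) \<noteq> 1"
      using ql num_regions_insert(1)[OF e, of "{}"] by (auto simp: quasi_loop_def)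
    then have "card (sides A e) \<noteq> 1" using sides_single_mono[OF e A', of "{}"] by auto
    then have r: "num_regions G (insert e A) = num_regions G A + 1" using num_regions_insert[OF e A'] by auto
    then have "\<not> separating A e" using num_regions_insert_separating[OF e A'] by auto
    then show ?thesis using r num_components_insert[OF e, of A] by simp
  qed
  fix A assume "A \<in> Pow ?D"
  then have A: "A \<subseteq> ?D" "A \<subseteq> E" by auto
  have D: "insert e ?D = E" using e by auto
  note sA = step[OF A(1)] and sE = step[OF order_refl, unfolded D]
  have card: "int (card E) = int (card ?D) + 1"
    using card.remove[OF finite_E e] by simp
  have "0 \<le> ?\<rho> A - ?\<rho> {}" using exponent_bounds(2)[OF empty_subsetI A(2)] by simp
  then have pw: "(y - 1) powi (?\<rho> A - ?\<rho> {} + 1) = (y - 1) * (y - 1) powi (?\<rho> A - ?\<rho> {})"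
    by (rule power_int_nonneg_Suc)
  have exps: "?c A - ?c E = ?c A - ?c ?D" "?c (insert e A) - ?c E = ?c A - ?c ?D"
    "?\<rho> (insert e A) - ?\<rho> {} = ?\<rho> A - ?\<rho> {} + 1"
    "int (card E) - int (card A) - ?\<rho> E + ?\<rho> A + ?c E - ?c A = int (card ?D) - int (card A) - ?\<rho> ?D + ?\<rho> A + ?c ?D - ?c A"
    "int (card E) - int (card A) - 1 - ?\<rho> E + ?\<rho> (insert e A) + ?c E - ?c (insert e A) =
       int (card ?D) - int (card A) - ?\<rho> ?D + ?\<rho> A + ?c ?D - ?c A"
    using sA sE card by linarith+
  show "(x - 1) powi (?c A - ?c E) * (y - 1) powi (?\<rho> A - ?\<rho> {}) *
     z powi (int (card E) - int (card A) - ?\<rho> E + ?\<rho> A + ?c E - ?c A) +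
     (x - 1) powi (?c (insert e A) - ?c E) * (y - 1) powi (?\<rho> (insert e A) - ?\<rho> {}) *
     z powi (int (card E) - int (card A) - 1 - ?\<rho> E + ?\<rho> (insert e A) + ?c E - ?c (insert e A)) =
     y * ((x - 1) powi (?c A - ?c ?D) * (y - 1) powi (?\<rho> A - ?\<rho> {}) *
     z powi (int (card ?D) - int (card A) - ?\<rho> ?D + ?\<rho> A + ?c ?D - ?c A))"
    unfolding exps unfolding pw by (simp add: algebra_simps)
qed

text \<open>The terms for \<open>insert e A\<close> give the contraction, those for \<open>A\<close>
  the deletion. In the latter only the exponent of \<open>z\<close> can differ:
  \<open>card E\<close> exceeds \<open>card (E - {e})\<close> by 1, and this is offset by one more
  region unless \<open>e\<close> is a quasi-bridge.\<close>

lemma las_vergnas_delete_contract: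
  assumes e: "e \<in> E" and nb: "\<not> bridge G e" and nl: "\<not> quasi_loop G e"
  shows "las_vergnas G x y z =
    (if quasi_bridge G e then z else 1) * las_vergnas (delete_edge G e) x y z
      + las_vergnas (contract_edge G e) x y z"
  unfolding las_vergnas_split[OF e] las_vergnas_delete las_vergnas_contract[OF e] sum_distrib_left sum.distrib[symmetric]
proof (rule sum.cong[OF refl])
  let ?c = "\<lambda>A. int (num_components G A)" and ?\<rho> = "\<lambda>A. int (num_regions G A)"
  let ?D = "E - {e}"
  fix A assume "A \<in> Pow ?D"
  then have A: "A \<subseteq> ?D" by auto
  have D: "?D \<subseteq> E" "e \<notin> ?D" "insert e ?D = E" using e by auto
  have cE: "?c E = ?c ?D" using num_components_insert[OF e, of ?D] nb bridge_iff[OF e] D(3) by simp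
  have rE: "?\<rho> E = ?\<rho> ?D + (if quasi_bridge G e then 0 else 1)"
    using num_regions_insert[OF e D(1,2)] D(3) quasi_bridge_iff[OF e] by auto
  have re: "?\<rho> {e} = ?\<rho> {}"
    using nl num_regions_insert[OF e, of "{}"] by (auto simp: quasi_loop_def)
  have card: "int (card E) = int (card ?D) + 1"
    using card.remove[OF finite_E e] by simp
  let ?k = "int (card ?D) - int (card A) - ?\<rho> ?D + ?\<rho> A + ?c ?D - ?c A"
  have "0 \<le> ?k" using exponent_bounds(1)[OF A D(1)] by simp
  then have pw: "z powi (?k + 1) = z * z powi ?k" by (rule power_int_nonneg_Suc)
  have exps: "int (card E) - int (card A) - ?\<rho> E + ?\<rho> A + ?c E - ?c A = (if quasi_bridge G e then ?k + 1 else ?k)"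
    "int (card E) - int (card A) - 1 - ?\<rho> E + ?\<rho> (insert e A) + ?c E - ?c (insert e A) =
       int (card ?D) - int (card A) - ?\<rho> E + ?\<rho> (insert e A) + ?c E - ?c (insert e A)"
    using cE rE card by auto
  show "(x - 1) powi (?c A - ?c E) * (y - 1) powi (?\<rho> A - ?\<rho> {}) *
     z powi (int (card E) - int (card A) - ?\<rho> E + ?\<rho> A + ?c E - ?c A) +
     (x - 1) powi (?c (insert e A) - ?c E) * (y - 1) powi (?\<rho> (insert e A) - ?\<rho> {}) *
     z powi (int (card E) - int (card A) - 1 - ?\<rho> E + ?\<rho> (insert e A) + ?c E - ?c (insert e A)) =
     (if quasi_bridge G e then z else 1) * ((x - 1) powi (?c A - ?c ?D) * (y - 1) powi (?\<rho> A - ?\<rho> {}) * z powi ?k) +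
     (x - 1) powi (?c (insert e A) - ?c E) * (y - 1) powi (?\<rho> (insert e A) - ?\<rho> {e}) *
     z powi (int (card ?D) - int (card A) - ?\<rho> E + ?\<rho> (insert e A) + ?c E - ?c (insert e A))"
    unfolding exps re cE[symmetric] using pw[unfolded cE[symmetric]] by (cases "quasi_bridge G e") (simp_all only: if_True if_False mult_ac mult_1 mult_1_right)
qed

lemma bridge_imp_quasi_bridge: "e \<in> E \<Longrightarrow> bridge G e \<Longrightarrow> quasi_bridge G e"
  using sides_bridge[of e "E - {e}"] by (auto simp: quasi_bridge_iff bridge_iff separating_def)

text \<open>If both sides of \<open>e\<close> lie in one region with all other edges drawn, they do
  so all the more with none of them drawn.\<close>

lemma quasi_bridge_imp_not_quasi_loop:
  assumes e: "e \<in> E" and "quasi_bridge G e"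
  shows "\<not> quasi_loop G e"
proof -
  have "card (sides (E - {e}) e) = 1" using assms(2) quasi_bridge_iff[OF e] by simp
  then have "card (sides {} e) = 1" by (rule sides_single_mono[OF e Diff_subset _ empty_subsetI, rotated]) simp
  then show ?thesis using num_regions_insert(1)[OF e, of "{}"] by (simp add: quasi_loop_def)
qed

lemma las_vergnas_edgeless: "E = {} \<Longrightarrow> las_vergnas G x y z = 1"
  by (simp add: las_vergnas_def)

end

theorem theorem4p9:
  fixes G :: "('p, 'e) drawing" and x y z :: "'k::field"
  assumes "graph_in_pseudo_surface G"
  shows "(\<forall>e\<in>edges G. \<not> quasi_loop G e \<and> \<not> quasi_bridge G e \<longrightarrow>
            las_vergnas G x y z =
              las_vergnas (delete_edge G e) x y z + las_vergnas (contract_edge G e) x y z) \<and>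
         (\<forall>e\<in>edges G. bridge G e \<longrightarrow>
            las_vergnas G x y z = x * las_vergnas (delete_edge G e) x y z) \<and>
         (\<forall>e\<in>edges G. quasi_loop G e \<longrightarrow>
            las_vergnas G x y z = y * las_vergnas (delete_edge G e) x y z) \<and>
         (\<forall>e\<in>edges G. quasi_bridge G e \<and> \<not> bridge G e \<longrightarrow>
            las_vergnas G x y z =
              z * las_vergnas (delete_edge G e) x y z + las_vergnas (contract_edge G e) x y z) \<and>
         (edges G = {} \<longrightarrow> las_vergnas G x y z = 1)"
proof -
  interpret drawn_graph G by unfold_locales (rule assms)
  have 1: "las_vergnas G x y z =
      las_vergnas (delete_edge G e) x y z + las_vergnas (contract_edge G e) x y z"
    if "e \<in> edges G" "\<not> quasi_loop G e" "\<not> quasi_bridge G e" for e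
    \<comment> \<open>A bridge would be a quasi-bridge, so \<open>e\<close> is not a bridge.\<close>
    using las_vergnas_delete_contract[OF that(1) _ that(2), of x y z] that bridge_imp_quasi_bridge[OF that(1)]
    by auto
  have 4: "las_vergnas G x y z =
      z * las_vergnas (delete_edge G e) x y z + las_vergnas (contract_edge G e) x y z"
    if "e \<in> edges G" "quasi_bridge G e" "\<not> bridge G e" for e
    using las_vergnas_delete_contract[OF that(1,3) quasi_bridge_imp_not_quasi_loop[OF that(1,2)], of x y z]
      that by simp
  show ?thesis
    using 1 4 las_vergnas_bridge las_vergnas_quasi_loop las_vergnas_edgeless by blast
qed

end
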